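(* Let $$w(x)=\sup_{\tau}\limsup_{T\to\infty}\mathbb E^x\Big\{\int_0^{\tau\wedge T}f(X_s)\,ds+g(X_{\tau\wedge T})\Big\}.$$ Assume (B1): for every $x\in E$ there is $d(x)<0$ such that $$\gamma(x)=\sup_\tau\limsup_{T\to\infty}\mathbb E^x\Big\{\int_0^{\tau\wedge T}\big(f(X_s)-d(x)\big)\,ds\Big\}<\infty.$$ Then $\tau^*=\inf\{t\ge0: g(X_t)\ge w(X_t)\}$ is an optimal stopping time for $w(x)$ for every $x$, and $\mathbb E^x\{\tau^*\}\le M(x):=\dfrac{\gamma(x)+2\|g\|+1}{-d(x)}$.
   Context: $E$ is a locally compact separable metric space in which every closed ball is compact. $(X_t)_{t\ge0}$ is a right-continuous time-homogeneous (standard) Markov process on $E$ with laws $\mathbb P^x$, expectations $\mathbb E^x$, transition probabilities $P_t(x,\cdot)$ and semigroup $P_t\phi(x)=\mathbb E^x\{\phi(X_t)\}$. Standing assumptions: (weak Feller) $P_t\mathcal C_0\subseteq\mathcal C_0$, $\mathcal C_0$ the continuous bounded functions vanishing at infinity; (ergodicity) there is a unique probability measure $\mu$ with $\|P_t(x,\cdot)-\mu\|_{TV}\to0$ for all $x$; $f,g:E\to\mathbb R$ continuous and bounded. $\|\cdot\|$ is the sup norm. Stopping times are with respect to the filtration of $X$ and may be infinite; $\tau$ is optimal if the expression inside the supremum equals $w(x)$. *)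

theory Defs
  imports "HOL-Probability.Probability"
begin

text \<open>Setting. The process lives on a sample space given by the measurable space M;
  P x is the law P^x of the process started at x (a probability measure on M);
  X t w is the position at time t. Time is real (t \<ge> 0); stopping times take
  values in [0,\<infinity>] and are represented as ennreal-valued functions.\<close>

definition nat_filt :: "'w measure \<Rightarrow> (real \<Rightarrow> 'w \<Rightarrow> 'a::topological_space) \<Rightarrow> real \<Rightarrow> 'w set set" where
  "nat_filt M X t = sigma_sets (space M)
     {X s -` A \<inter> space M | s A. 0 \<le> s \<and> s \<le> t \<and> A \<in> sets borel}"

definition nat_filt_plus :: "'w measure \<Rightarrow> (real \<Rightarrow> 'w \<Rightarrow> 'a::topological_space) \<Rightarrow> real \<Rightarrow> 'w set set" where
  "nat_filt_plus M X t = (\<Inter>u\<in>{t<..}. nat_filt M X u)"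

text \<open>Usual augmentation: F_t = intersection over all starting points x of the
  P^x-augmentation of F^0_{t+} (the filtration of the standard process X).\<close>
definition filt :: "'w measure \<Rightarrow> ('a \<Rightarrow> 'w measure) \<Rightarrow> (real \<Rightarrow> 'w \<Rightarrow> 'a::topological_space) \<Rightarrow> real \<Rightarrow> 'w set set" where
  "filt M P X t = {A \<in> sets M. \<forall>x. \<exists>B \<in> nat_filt_plus M X t. \<exists>N \<in> null_sets (P x).
       (A - B) \<union> (B - A) \<subseteq> N}"

definition stopping :: "'w measure \<Rightarrow> ('a \<Rightarrow> 'w measure) \<Rightarrow> (real \<Rightarrow> 'w \<Rightarrow> 'a::topological_space) \<Rightarrow> ('w \<Rightarrow> ennreal) \<Rightarrow> bool" where
  "stopping M P X \<tau> \<longleftrightarrow> (\<forall>t\<ge>0. {w \<in> space M. \<tau> w \<le> ennreal t} \<in> filt M P X t)"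

definition stopped_sets :: "'w measure \<Rightarrow> ('a \<Rightarrow> 'w measure) \<Rightarrow> (real \<Rightarrow> 'w \<Rightarrow> 'a::topological_space) \<Rightarrow> ('w \<Rightarrow> ennreal) \<Rightarrow> 'w set set" where
  "stopped_sets M P X \<tau> = {B \<in> sets M. \<forall>t\<ge>0. B \<inter> {w \<in> space M. \<tau> w \<le> ennreal t} \<in> filt M P X t}"

definition Xat :: "(real \<Rightarrow> 'w \<Rightarrow> 'a) \<Rightarrow> ('w \<Rightarrow> ennreal) \<Rightarrow> 'w \<Rightarrow> 'a" where
  "Xat X \<tau> w = X (enn2real (\<tau> w)) w"

definition semigroup :: "('a \<Rightarrow> 'w measure) \<Rightarrow> (real \<Rightarrow> 'w \<Rightarrow> 'a) \<Rightarrow> real \<Rightarrow> ('a \<Rightarrow> real) \<Rightarrow> 'a \<Rightarrow> real" where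
  "semigroup P X t \<phi> x = (\<integral>w. \<phi> (X t w) \<partial>P x)"

definition C0 :: "('a::metric_space \<Rightarrow> real) set" where
  "C0 = {\<phi>. continuous_on UNIV \<phi> \<and> bounded (range \<phi>) \<and>
           (\<forall>e>0. \<exists>K. compact K \<and> (\<forall>y. y \<notin> K \<longrightarrow> \<bar>\<phi> y\<bar> < e))}"

definition trans_prob :: "('a \<Rightarrow> 'w measure) \<Rightarrow> (real \<Rightarrow> 'w \<Rightarrow> 'a::topological_space) \<Rightarrow> real \<Rightarrow> 'a \<Rightarrow> 'a measure" where
  "trans_prob P X t x = distr (P x) borel (X t)"

definition tv_dist :: "'a measure \<Rightarrow> 'a measure \<Rightarrow> real" where
  "tv_dist \<mu> \<nu> = (SUP A \<in> sets \<mu>. \<bar>measure \<mu> A - measure \<nu> A\<bar>)"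

definition standard_markov :: "'w measure \<Rightarrow> ('a \<Rightarrow> 'w measure) \<Rightarrow> (real \<Rightarrow> 'w \<Rightarrow> 'a::metric_space) \<Rightarrow> bool" where
  "standard_markov M P X \<longleftrightarrow>
     (\<forall>x. prob_space (P x) \<and> sets (P x) = sets M) \<and>
     (\<forall>t\<ge>0. X t \<in> measurable M borel) \<and>
     (\<forall>w\<in>space M. \<forall>t\<ge>0. ((\<lambda>s. X s w) \<longlongrightarrow> X t w) (at_right t)) \<and>
     (\<forall>w\<in>space M. \<forall>t>0. \<exists>l. ((\<lambda>s. X s w) \<longlongrightarrow> l) (at_left t)) \<and>
     (\<forall>x. AE w in P x. X 0 w = x) \<and>
     (\<forall>A. A \<subseteq> space M \<longrightarrow>
        (\<forall>x. \<exists>B\<in>sets M. \<exists>N\<in>null_sets (P x). (A - B) \<union> (B - A) \<subseteq> N) \<longrightarrow> A \<in> sets M) \<and>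
     (\<forall>t\<ge>0. \<forall>A\<in>sets borel. (\<lambda>x. measure (P x) {w \<in> space M. X t w \<in> A}) \<in> borel_measurable borel) \<and>
     (\<forall>x \<tau> s A B. stopping M P X \<tau> \<longrightarrow> s \<ge> 0 \<longrightarrow> A \<in> sets borel \<longrightarrow> B \<in> stopped_sets M P X \<tau> \<longrightarrow>
        measure (P x) {w \<in> B. \<tau> w < \<infinity> \<and> X (enn2real (\<tau> w) + s) w \<in> A} =
        (\<integral>w. indicator {w \<in> B. \<tau> w < \<infinity>} w *
              measure (P (Xat X \<tau> w)) {v \<in> space M. X s v \<in> A} \<partial>P x)) \<and>
     (\<forall>x \<tau>n. (\<forall>n. stopping M P X (\<tau>n n)) \<longrightarrow> (\<forall>w. incseq (\<lambda>n. \<tau>n n w)) \<longrightarrow>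
        (AE w in P x. (SUP n. \<tau>n n w) < \<infinity> \<longrightarrow>
           (\<lambda>n. Xat X (\<tau>n n) w) \<longlonglongrightarrow> Xat X (\<lambda>v. SUP n. \<tau>n n v) w))"

definition weak_feller :: "('a \<Rightarrow> 'w measure) \<Rightarrow> (real \<Rightarrow> 'w \<Rightarrow> 'a::metric_space) \<Rightarrow> bool" where
  "weak_feller P X \<longleftrightarrow> (\<forall>t\<ge>0. \<forall>\<phi>\<in>C0. semigroup P X t \<phi> \<in> C0)"

text \<open>Ergodicity: a (necessarily unique) invariant probability measure mu attracting
  every transition probability in total variation.\<close>
definition ergodic :: "('a \<Rightarrow> 'w measure) \<Rightarrow> (real \<Rightarrow> 'w \<Rightarrow> 'a::metric_space) \<Rightarrow> bool" where
  "ergodic P X \<longleftrightarrow> (\<exists>!\<mu>. prob_space \<mu> \<and> sets \<mu> = sets borel \<and>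
      (\<forall>x. ((\<lambda>t. tv_dist (trans_prob P X t x) \<mu>) \<longlongrightarrow> 0) at_top))"

definition supnorm :: "('a \<Rightarrow> real) \<Rightarrow> real" where
  "supnorm g = (SUP y. \<bar>g y\<bar>)"

definition run_int :: "(real \<Rightarrow> 'w \<Rightarrow> 'a) \<Rightarrow> ('a \<Rightarrow> real) \<Rightarrow> ('w \<Rightarrow> ennreal) \<Rightarrow> real \<Rightarrow> 'w \<Rightarrow> real" where
  "run_int X h \<tau> T w = set_lebesgue_integral lborel {0..enn2real (min (\<tau> w) (ennreal T))} (\<lambda>s. h (X s w))"

definition payoff :: "('a \<Rightarrow> 'w measure) \<Rightarrow> (real \<Rightarrow> 'w \<Rightarrow> 'a) \<Rightarrow> ('a \<Rightarrow> real) \<Rightarrow> ('a \<Rightarrow> real)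
     \<Rightarrow> 'a \<Rightarrow> ('w \<Rightarrow> ennreal) \<Rightarrow> real \<Rightarrow> real" where
  "payoff P X f g x \<tau> T = (\<integral>w. run_int X f \<tau> T w + g (Xat X (\<lambda>v. min (\<tau> v) (ennreal T)) w) \<partial>P x)"

definition lim_payoff :: "('a \<Rightarrow> 'w measure) \<Rightarrow> (real \<Rightarrow> 'w \<Rightarrow> 'a) \<Rightarrow> ('a \<Rightarrow> real) \<Rightarrow> ('a \<Rightarrow> real)
     \<Rightarrow> 'a \<Rightarrow> ('w \<Rightarrow> ennreal) \<Rightarrow> ereal" where
  "lim_payoff P X f g x \<tau> = Limsup at_top (\<lambda>T. ereal (payoff P X f g x \<tau> T))"

definition value_fn :: "'w measure \<Rightarrow> ('a \<Rightarrow> 'w measure) \<Rightarrow> (real \<Rightarrow> 'w \<Rightarrow> 'a::topological_space)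
     \<Rightarrow> ('a \<Rightarrow> real) \<Rightarrow> ('a \<Rightarrow> real) \<Rightarrow> 'a \<Rightarrow> ereal" where
  "value_fn M P X f g x = (SUP \<tau> \<in> {\<tau>. stopping M P X \<tau>}. lim_payoff P X f g x \<tau>)"

definition gamma_fn :: "'w measure \<Rightarrow> ('a \<Rightarrow> 'w measure) \<Rightarrow> (real \<Rightarrow> 'w \<Rightarrow> 'a::topological_space)
     \<Rightarrow> ('a \<Rightarrow> real) \<Rightarrow> real \<Rightarrow> 'a \<Rightarrow> ereal" where
  "gamma_fn M P X f d x = (SUP \<tau> \<in> {\<tau>. stopping M P X \<tau>}.
      Limsup at_top (\<lambda>T. ereal (\<integral>w. run_int X (\<lambda>y. f y - d) \<tau> T w \<partial>P x)))"

text \<open>tau^* = inf {t >= 0 : g(X_t) >= w(X_t)} (inf of the empty set = infinity).\<close>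
definition tau_star :: "'w measure \<Rightarrow> ('a \<Rightarrow> 'w measure) \<Rightarrow> (real \<Rightarrow> 'w \<Rightarrow> 'a::topological_space)
     \<Rightarrow> ('a \<Rightarrow> real) \<Rightarrow> ('a \<Rightarrow> real) \<Rightarrow> 'w \<Rightarrow> ennreal" where
  "tau_star M P X f g w = Inf (ennreal ` {t. t \<ge> 0 \<and> ereal (g (X t w)) \<ge> value_fn M P X f g (X t w)})"

end

theory Submission
  imports Defs
begin

text \<open>
  Write \<open>F\<^sub>\<delta>\<close> for the expected running reward over a step of length \<open>\<delta>\<close>. Starting from \<open>g\<close> and
  repeatedly taking the maximum of \<open>\<phi>\<close> and \<open>F\<^sub>\<delta> + P\<^sub>\<delta> \<phi>\<close> produces an increasing sequence of bounded
  functions, continuous by the Feller property. Each of them is attained by a bounded stopping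
  time, and by the supermartingale inequality (first along grids, then in the limit from the right)
  their supremum dominates every payoff. So the supremum is the value \<open>w\<close>; it is finite by (B1) and
  lower semicontinuous, whence the sets \<open>{w \<le> g + \<epsilon>}\<close> are closed.

  Let \<open>\<sigma>\<^sub>n\<close> be bounded and \<open>2^-n\<close>-optimal. The supermartingale inequality gives
  \<open>P (w - g > \<epsilon> at \<sigma>\<^sub>n) \<le> 2^-n / \<epsilon>\<close>, so by Borel--Cantelli the hitting time \<open>\<tau>\<^sub>\<epsilon>\<close> of \<open>{w \<le> g + \<epsilon>}\<close> is
  eventually at most \<open>\<sigma>\<^sub>n\<close>. As (B1) bounds the expectation of \<open>\<sigma>\<^sub>n\<close>, Fatou's lemma bounds that of
  \<open>\<tau>\<^sub>\<epsilon>\<close>, and stopping at \<open>min \<tau>\<^sub>\<epsilon> \<sigma>\<^sub>n\<close> loses at most \<open>\<epsilon>\<close> compared with \<open>\<sigma>\<^sub>n\<close>. Finally \<open>\<tau>\<^sub>\<epsilon>\<close> increases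
  to \<open>\<tau>\<^sup>*\<close> as \<open>\<epsilon>\<close> decreases to 0, by quasi-left-continuity.
\<close>

subsection \<open>The process and its filtration\<close>

text \<open>The value function is not known to be integrable at a random time, so every inequality
  is first proved for its bounded continuous approximations and passed to the limit afterwards. (B1)
  enters through bounded times alone: splitting \<open>f\<close> into \<open>(f - d x) + d x\<close>
  bounds the payoff of a bounded time \<open>s\<close> by \<open>\<gamma> x + supnorm g\<close> plus
  \<open>d x\<close> times the mean of \<open>s\<close>, so the negative \<open>d x\<close> makes
  waiting costly. Stopping at once earns at least \<open>- supnorm g\<close>; hence for a time that
  loses at most 1 against the value, \<open>- d x\<close> times its mean is at most
  \<open>\<gamma> x + 2 * supnorm g + 1\<close>, and this is the origin of the bound in the theorem.
  The detour through a positive \<epsilon> is forced: a loss \<eta> is compatible with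
  \<open>w - g\<close> being of size \<eta> wherever the process is stopped, so near-optimality
  controls \<open>{w \<le> g + \<epsilon>}\<close> but not \<open>{w \<le> g}\<close>. The entry
  times then approach their limit from the left, where paths may jump.\<close>

lemma borel_measurable_right_continuous_pair:
  fixes h :: "real \<Rightarrow> 'b \<Rightarrow> 'c::metric_space"
  assumes meas: "\<And>t. t \<ge> 0 \<Longrightarrow> h t \<in> borel_measurable N"
    and rc: "\<And>t y. t \<ge> 0 \<Longrightarrow> y \<in> space N \<Longrightarrow> ((\<lambda>s. h s y) \<longlongrightarrow> h t y) (at_right t)"
  shows "(\<lambda>p. h (max 0 (fst p)) (snd p)) \<in> borel_measurable (borel \<Otimes>\<^sub>M N)"
proof (rule borel_measurable_LIMSEQ_metric)
  \<comment> \<open>\<open>q n s\<close> is a point of the grid of mesh \<open>1 / (n + 1)\<close>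
    strictly to the right of \<open>max 0 s\<close>. It has countably many values, so each
    approximation is measurable, and strictness lets it converge along
    \<open>at_right\<close>.\<close>
  define q where "q n s = (real (nat \<lfloor>real (Suc n) * max 0 s\<rfloor>) + 1) / real (Suc n)" for n and s :: real
  fix n
  show "(\<lambda>p. h (q n (fst p)) (snd p)) \<in> borel_measurable (borel \<Otimes>\<^sub>M N)"
    unfolding q_def
  proof (rule measurable_compose_countable[of "\<lambda>i (p::real\<times>'b). h ((real i + 1) / real (Suc n)) (snd p)"])
    show "(\<lambda>p. h ((real i + 1) / real (Suc n)) (snd (p::real\<times>'b))) \<in> borel_measurable (borel \<Otimes>\<^sub>M N)" for i :: nat
      by (rule measurable_compose[OF measurable_snd meas]) simp
    show "(\<lambda>p. nat \<lfloor>real (Suc n) * max 0 (fst p :: real)\<rfloor>) \<in> measurable (borel \<Otimes>\<^sub>M N) (count_space UNIV)"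
      by measurable
  qed
next
  define q where "q n s = (real (nat \<lfloor>real (Suc n) * max 0 s\<rfloor>) + 1) / real (Suc n)" for n and s :: real
  fix p :: "real \<times> 'b" assume p: "p \<in> space (borel \<Otimes>\<^sub>M N)"
  define t where "t = max 0 (fst p)"
  have t: "t \<ge> 0" by (simp add: t_def)
  have fl: "real (nat \<lfloor>real (Suc n) * t\<rfloor>) = of_int \<lfloor>real (Suc n) * t\<rfloor>" for n
    using t by simp
  have lo: "q n (fst p) > t" for n
  proof -
    have "real (Suc n) * t < real (nat \<lfloor>real (Suc n) * t\<rfloor>) + 1" unfolding fl by linarith
    then show ?thesis unfolding q_def t_def[symmetric]
      by (simp add: pos_less_divide_eq mult.commute)
  qed
  have hi: "q n (fst p) \<le> t + 1 / real (Suc n)" for n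
  proof -
    have "real (nat \<lfloor>real (Suc n) * t\<rfloor>) \<le> real (Suc n) * t" unfolding fl by linarith
    then have "q n (fst p) \<le> (real (Suc n) * t + 1) / real (Suc n)"
      unfolding q_def t_def[symmetric] by (intro divide_right_mono) auto
    also have "\<dots> = t + 1 / real (Suc n)" by (simp add: add_divide_distrib)
    finally show ?thesis .
  qed
  have "(\<lambda>n. t + 1 / real (Suc n)) \<longlonglongrightarrow> t"
    using LIMSEQ_inverse_real_of_nat_add[of t] by (simp only: inverse_eq_divide)
  then have "(\<lambda>n. q n (fst p)) \<longlonglongrightarrow> t"
    by (rule tendsto_sandwich[OF always_eventually always_eventually tendsto_const[of t], rotated -1])
       (use lo hi in \<open>auto intro: less_imp_le\<close>)
  then have "filterlim (\<lambda>n. q n (fst p)) (at_right t) sequentially"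
    unfolding filterlim_at using lo by (auto simp: less_le intro!: always_eventually)
  moreover have "((\<lambda>s. h s (snd p)) \<longlongrightarrow> h t (snd p)) (at_right t)"
    using p t by (intro rc) (auto simp: space_pair_measure)
  ultimately show "(\<lambda>n. h (q n (fst p)) (snd p)) \<longlonglongrightarrow> h (max 0 (fst p)) (snd p)"
    unfolding t_def[symmetric] by (rule filterlim_compose[rotated])
qed

text \<open>For a metric space the class \<open>heine_borel\<close> expresses that closed balls are
  compact, and second countability expresses separability.\<close>

locale feller_process =
  fixes M :: "'w measure"
    and P :: "'a::{heine_borel, second_countable_topology} \<Rightarrow> 'w measure"
    and X :: "real \<Rightarrow> 'w \<Rightarrow> 'a"
  assumes standard: "standard_markov M P X"
    and feller: "weak_feller P X"
begin

lemmas standard_unfolded = standard[unfolded standard_markov_def]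

lemma prob_space_P: "prob_space (P x)"
  using standard_unfolded[THEN conjunct1] by blast

lemma sets_P [measurable_cong, simp]: "sets (P x) = sets M"
  using standard_unfolded[THEN conjunct1] by blast

lemma space_P [simp]: "space (P x) = space M"
  by (rule sets_eq_imp_space_eq) simp

lemma measurable_P [simp]: "measurable (P x) N = measurable M N"
  by (rule measurable_cong_sets) simp_all

lemma measurable_X: "t \<ge> 0 \<Longrightarrow> X t \<in> borel_measurable M"
  using standard_unfolded[THEN conjunct2, THEN conjunct1] by blast

lemma right_continuous_X: "w \<in> space M \<Longrightarrow> t \<ge> 0 \<Longrightarrow> ((\<lambda>s. X s w) \<longlongrightarrow> X t w) (at_right t)"
  using standard_unfolded[THEN conjunct2, THEN conjunct2, THEN conjunct1] by blast

lemma AE_X_0: "AE w in P x. X 0 w = x"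
  using standard_unfolded[THEN conjunct2, THEN conjunct2, THEN conjunct2, THEN conjunct2, THEN conjunct1]
  by (rule spec)

lemma complete_M:
  assumes "A \<subseteq> space M" "\<And>x. \<exists>B\<in>sets M. \<exists>N\<in>null_sets (P x). (A - B) \<union> (B - A) \<subseteq> N"
  shows "A \<in> sets M"
  using standard_unfolded[THEN conjunct2, THEN conjunct2, THEN conjunct2, THEN conjunct2, THEN conjunct2,
      THEN conjunct1, THEN spec, THEN mp, THEN mp, OF assms(1)] assms(2) by blast

lemma measurable_P_X_in:
  assumes "t \<ge> 0" "A \<in> sets borel"
  shows "(\<lambda>x. measure (P x) {w \<in> space M. X t w \<in> A}) \<in> borel_measurable borel"
  by (rule standard_unfolded[THEN conjunct2, THEN conjunct2, THEN conjunct2, THEN conjunct2, THEN conjunct2,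
      THEN conjunct2, THEN conjunct1, THEN spec, THEN mp, THEN bspec, OF assms])

lemma strong_markov:
  assumes "stopping M P X \<tau>" "s \<ge> 0" "A \<in> sets borel" "B \<in> stopped_sets M P X \<tau>"
  shows "measure (P x) {w \<in> B. \<tau> w < \<infinity> \<and> X (enn2real (\<tau> w) + s) w \<in> A} =
        (\<integral>w. indicator {w \<in> B. \<tau> w < \<infinity>} w *
              measure (P (Xat X \<tau> w)) {v \<in> space M. X s v \<in> A} \<partial>P x)"
  by (rule standard_unfolded[THEN conjunct2, THEN conjunct2, THEN conjunct2, THEN conjunct2, THEN conjunct2,
      THEN conjunct2, THEN conjunct2, THEN conjunct1, THEN spec, THEN spec, THEN spec, THEN spec, THEN spec,
      THEN mp, THEN mp, THEN mp, THEN mp, OF assms])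

lemma quasi_left_continuous:
  assumes "\<And>n. stopping M P X (\<tau> n)" "\<And>w. incseq (\<lambda>n. \<tau> n w)"
  shows "AE w in P x. (SUP n. \<tau> n w) < \<infinity> \<longrightarrow>
           (\<lambda>n. Xat X (\<tau> n) w) \<longlonglongrightarrow> Xat X (\<lambda>v. SUP n. \<tau> n v) w"
  by (rule standard_unfolded[THEN conjunct2, THEN conjunct2, THEN conjunct2, THEN conjunct2, THEN conjunct2,
      THEN conjunct2, THEN conjunct2, THEN conjunct2, THEN spec, THEN spec, THEN mp, THEN mp])
     (use assms in blast)+

text \<open>Nothing is assumed about \<open>X t\<close> for negative \<open>t\<close>, hence the truncation of time at 0.\<close>
lemma measurable_X_pair [measurable]:
  "(\<lambda>p. X (max 0 (fst p)) (snd p)) \<in> borel_measurable (borel \<Otimes>\<^sub>M M)"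
  by (rule borel_measurable_right_continuous_pair) (auto intro: measurable_X right_continuous_X)

lemma measurable_X_at:
  assumes [measurable]: "r \<in> borel_measurable M" and "\<And>w. w \<in> space M \<Longrightarrow> 0 \<le> r w"
  shows "(\<lambda>w. X (r w) w) \<in> borel_measurable M"
proof -
  have "(\<lambda>w. X (max 0 (r w)) w) \<in> borel_measurable M"
    using measurable_compose[OF measurable_Pair[OF assms(1) measurable_ident] measurable_X_pair] by simp
  also have "?this \<longleftrightarrow> ?thesis"
    by (rule measurable_cong) (simp add: assms(2))
  finally show ?thesis .
qed

section \<open>The augmented filtration and its right-continuity\<close>

lemma sigma_algebra_nat_filt_plus: "sigma_algebra (space M) (nat_filt_plus M X t)"
proof -
  have *: "sigma_algebra (space M) (nat_filt M X u)" for u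
    unfolding nat_filt_def by (rule sigma_algebra_sigma_sets) auto
  show ?thesis
    unfolding sigma_algebra_iff2 nat_filt_plus_def
  proof (intro conjI allI ballI impI)
    have "nat_filt M X (t + 1) \<subseteq> Pow (space M)"
      using *[of "t + 1"] unfolding sigma_algebra_iff2 by (rule conjunct1)
    moreover have "(\<Inter>u\<in>{t<..}. nat_filt M X u) \<subseteq> nat_filt M X (t + 1)"
      by (rule INT_lower) simp
    ultimately show "(\<Inter>u\<in>{t<..}. nat_filt M X u) \<subseteq> Pow (space M)" by (rule order_trans[rotated])
  next
    show "{} \<in> (\<Inter>u\<in>{t<..}. nat_filt M X u)"
      by (intro INT_I *[unfolded sigma_algebra_iff2, THEN conjunct2, THEN conjunct1])
  next
    fix A assume "A \<in> (\<Inter>u\<in>{t<..}. nat_filt M X u)"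
    then show "space M - A \<in> (\<Inter>u\<in>{t<..}. nat_filt M X u)"
      by (intro INT_I algebra.compl_sets[OF sigma_algebra.axioms(1)[OF *]]) (erule INT_D)
  next
    fix A :: "nat \<Rightarrow> 'w set" assume A: "range A \<subseteq> (\<Inter>u\<in>{t<..}. nat_filt M X u)"
    show "(\<Union>i. A i) \<in> (\<Inter>u\<in>{t<..}. nat_filt M X u)"
    proof (rule INT_I)
      fix u assume "u \<in> {t<..}"
      then have "range A \<subseteq> nat_filt M X u" using A by blast
      then show "(\<Union>i. A i) \<in> nat_filt M X u"
        by (rule sigma_algebra.countable_nat_UN[OF *])
    qed
  qed
qed

lemma nat_filt_subset: "nat_filt M X t \<subseteq> sets M"
  unfolding nat_filt_def
  by (rule sets.sigma_sets_subset) (auto intro: measurable_sets[OF measurable_X])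

lemma nat_filt_plus_mono: "s \<le> t \<Longrightarrow> nat_filt_plus M X s \<subseteq> nat_filt_plus M X t"
  unfolding nat_filt_plus_def by (rule INT_anti_mono) auto

lemma nat_filt_plus_subset: "nat_filt_plus M X t \<subseteq> sets M"
proof -
  have "nat_filt_plus M X t \<subseteq> nat_filt M X (t + 1)"
    unfolding nat_filt_plus_def by (rule INT_lower) simp
  then show ?thesis using nat_filt_subset by blast
qed

lemma filt_mono: "s \<le> t \<Longrightarrow> filt M P X s \<subseteq> filt M P X t"
  using nat_filt_plus_mono[of s t] unfolding filt_def by blast

lemma filt_subset: "filt M P X t \<subseteq> sets M"
  by (auto simp: filt_def)

lemma nat_filt_plus_subset_filt: "nat_filt_plus M X t \<subseteq> filt M P X t"
  using nat_filt_plus_subset unfolding filt_def by blast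

lemma filtE:
  assumes "A \<in> filt M P X t"
  obtains B N where "B \<in> nat_filt_plus M X t" "N \<in> null_sets (P x)" "(A - B) \<union> (B - A) \<subseteq> N"
  using assms that unfolding filt_def by blast

lemma sigma_algebra_filt: "sigma_algebra (space M) (filt M P X t)"
  unfolding sigma_algebra_iff2
proof (intro conjI allI ballI impI)
  interpret sigma_algebra "space M" "nat_filt_plus M X t"
    by (rule sigma_algebra_nat_filt_plus)
  show "filt M P X t \<subseteq> Pow (space M)"
    using filt_subset[of t] sets.sets_into_space by blast
  show "{} \<in> filt M P X t"
    using nat_filt_plus_subset_filt empty_sets by (rule subsetD)
  show "space M - A \<in> filt M P X t" if A: "A \<in> filt M P X t" for A
    unfolding filt_def
  proof (intro CollectI conjI allI)
    show "space M - A \<in> sets M" using A by (auto simp: filt_def)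
    fix x
    obtain B N where B: "B \<in> nat_filt_plus M X t" "N \<in> null_sets (P x)" "(A - B) \<union> (B - A) \<subseteq> N"
      using A by (rule filtE)
    have "space M - B \<in> nat_filt_plus M X t" using B(1) by (rule compl_sets)
    moreover have "(space M - A - (space M - B)) \<union> (space M - B - (space M - A)) \<subseteq> N"
      using B by blast
    ultimately show "\<exists>B\<in>nat_filt_plus M X t. \<exists>N\<in>null_sets (P x). space M - A - B \<union> (B - (space M - A)) \<subseteq> N"
      using B by blast
  qed
  show "(\<Union>i. A i) \<in> filt M P X t" if A: "range A \<subseteq> filt M P X t" for A :: "nat \<Rightarrow> _"
    unfolding filt_def
  proof (intro CollectI conjI allI)
    have Ai: "A i \<in> filt M P X t" for i using A by blast
    show "(\<Union>i. A i) \<in> sets M"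
      using Ai subsetD[OF filt_subset] by (intro sets.countable_nat_UN) blast
    fix x
    have "\<forall>i. \<exists>B N. B \<in> nat_filt_plus M X t \<and> N \<in> null_sets (P x) \<and> (A i - B) \<union> (B - A i) \<subseteq> N"
      by (intro allI, rule filtE[OF Ai, where x = x]) blast
    from choice[OF this] obtain B where
      "\<forall>i. \<exists>N. B i \<in> nat_filt_plus M X t \<and> N \<in> null_sets (P x) \<and> (A i - B i) \<union> (B i - A i) \<subseteq> N" ..
    from choice[OF this] obtain N where B: "\<And>i. B i \<in> nat_filt_plus M X t" "\<And>i. N i \<in> null_sets (P x)"
      "\<And>i. (A i - B i) \<union> (B i - A i) \<subseteq> N i" by blast
    have "(\<Union>i. B i) \<in> nat_filt_plus M X t" using B(1) by (intro countable_nat_UN) blast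
    moreover have "(\<Union>i. N i) \<in> null_sets (P x)" by (intro null_sets_UN B(2))
    moreover have "(\<Union>i. A i) - (\<Union>i. B i) \<union> ((\<Union>i. B i) - (\<Union>i. A i)) \<subseteq> (\<Union>i. N i)"
      using B(3) by blast
    ultimately show "\<exists>B\<in>nat_filt_plus M X t. \<exists>N\<in>null_sets (P x). (\<Union>i. A i) - B \<union> (B - (\<Union>i. A i)) \<subseteq> N"
      by blast
  qed
qed

text \<open>One raw event \<open>B\<close> serves all starting points at once; only the exceptional
  null set depends on \<open>x\<close>. Measurability of \<open>A\<close> itself comes from the
  completeness of \<open>M\<close>.\<close>

lemma null_difference_in_filt:
  assumes "A \<subseteq> space M" "B \<in> nat_filt_plus M X t" 
    and "\<And>x. AE w in P x. w \<in> A \<longleftrightarrow> w \<in> B"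
  shows "A \<in> filt M P X t"
proof -
  have B: "B \<in> sets M" using assms nat_filt_plus_subset by blast
  have N: "\<exists>N\<in>null_sets (P x). (A - B) \<union> (B - A) \<subseteq> N" for x
  proof -
    from AE_E3[OF assms(3)[of x]] obtain N where "N \<in> null_sets (P x)"
      "\<And>w. w \<in> space (P x) - N \<Longrightarrow> w \<in> A \<longleftrightarrow> w \<in> B" by blast
    then show ?thesis using assms(1) sets.sets_into_space[OF B] by (intro bexI[of _ N]) auto
  qed
  have "A \<in> sets M"
    by (rule complete_M[OF assms(1)], rule bexI[OF _ B], rule N)
  then show ?thesis
    unfolding filt_def by (intro CollectI conjI allI bexI[OF _ assms(2)] N)
qed

text \<open>For fixed \<open>x\<close>, replace \<open>A\<close> by raw events \<open>B n\<close>
  from the times \<open>t + 1 / (n + 1)\<close>. Their limit superior does not depend on finitely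
  many of them, so it belongs to \<open>nat_filt M X u\<close> for every \<open>u > t\<close>, and
  it still differs from \<open>A\<close> by a null set.\<close>

lemma filt_right_continuous:
  assumes "\<And>u. u > t \<Longrightarrow> A \<in> filt M P X u"
  shows "A \<in> filt M P X t"
proof -
  have A: "A \<in> sets M" using assms[of "t + 1"] subsetD[OF filt_subset] by simp
  have "\<exists>B\<in>nat_filt_plus M X t. \<exists>N\<in>null_sets (P x). (A - B) \<union> (B - A) \<subseteq> N" for x
  proof -
    have "\<forall>n. \<exists>B N. B \<in> nat_filt_plus M X (t + inverse (real (Suc n))) \<and> N \<in> null_sets (P x)
        \<and> (A - B) \<union> (B - A) \<subseteq> N"
    proof
      fix n
      have "t + inverse (real (Suc n)) > t" by simp
      from filtE[OF assms[OF this], of x] show "\<exists>B N. B \<in> nat_filt_plus M X (t + inverse (real (Suc n))) \<and>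
        N \<in> null_sets (P x) \<and> (A - B) \<union> (B - A) \<subseteq> N" by blast
    qed
    from choice[OF this] obtain B where
      "\<forall>n. \<exists>N. B n \<in> nat_filt_plus M X (t + inverse (real (Suc n))) \<and> N \<in> null_sets (P x)
        \<and> (A - B n) \<union> (B n - A) \<subseteq> N" ..
    from choice[OF this] obtain N where B: "\<And>n. B n \<in> nat_filt_plus M X (t + inverse (real (Suc n)))"
      and N: "\<And>n. N n \<in> null_sets (P x)" "\<And>n. (A - B n) \<union> (B n - A) \<subseteq> N n" by blast
    define C where "C m = (\<Union>n. B (n + m))" for m
    have C_anti: "C m \<subseteq> C k" if "k \<le> m" for k m
    proof
      fix w assume "w \<in> C m"
      then obtain n where "w \<in> B (n + m)" by (auto simp: C_def)
      then have "w \<in> B ((n + m - k) + k)" using that by simp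
      then show "w \<in> C k" unfolding C_def by blast
    qed
    have "(\<Inter>m. C m) \<in> nat_filt_plus M X t"
      unfolding nat_filt_plus_def
    proof (rule INT_I)
      fix u assume "u \<in> {t<..}"
      then obtain m0 where m0: "inverse (real (Suc m0)) < u - t"
        using reals_Archimedean[of "u - t"] by auto
      interpret N: sigma_algebra "space M" "nat_filt M X u"
        unfolding nat_filt_def by (rule sigma_algebra_sigma_sets) auto
      have Bu: "B n \<in> nat_filt M X u" if "n \<ge> m0" for n
      proof -
        have "inverse (real (Suc n)) \<le> inverse (real (Suc m0))"
          using that by (intro le_imp_inverse_le) auto
        then have "u \<in> {t + inverse (real (Suc n))<..}" using m0 unfolding greaterThan_iff by linarith
        then show ?thesis using B[of n] unfolding nat_filt_plus_def by (rule INT_D[rotated])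
      qed
      have "C (m + m0) \<in> nat_filt M X u" for m
        unfolding C_def using Bu by (intro N.countable_nat_UN image_subsetI) simp
      then have "(\<Inter>m. C (m + m0)) \<in> nat_filt M X u"
        by (intro N.countable_INT image_subsetI) auto
      moreover have "(\<Inter>m. C (m + m0)) = (\<Inter>m. C m)"
        using C_anti[of m "m + m0" for m] by auto
      ultimately show "(\<Inter>m. C m) \<in> nat_filt M X u" by simp
    qed
    moreover have "(\<Union>n. N n) \<in> null_sets (P x)" by (intro null_sets_UN N)
    moreover have "(A - (\<Inter>m. C m)) \<union> ((\<Inter>m. C m) - A) \<subseteq> (\<Union>n. N n)"
    proof -
      have "A - C m \<subseteq> N (0 + m)" for m using N(2)[of "0+m"] unfolding C_def by blast
      moreover have "C 0 - A \<subseteq> (\<Union>n. N n)" using N(2) unfolding C_def by blast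
      ultimately show ?thesis by blast
    qed
    ultimately show ?thesis by blast
  qed
  then show ?thesis using A unfolding filt_def by (intro CollectI conjI allI)
qed

subsection \<open>Bounded stopping times\<close>

text \<open>Real values and a bound on \<open>space M\<close> make integrability automatic and avoid
  conversions from \<open>ennreal\<close>; a general stopping time is reached through its
  truncations.\<close>

definition bstop :: "real \<Rightarrow> ('w \<Rightarrow> real) \<Rightarrow> bool" where
  "bstop C r \<longleftrightarrow> (\<forall>w\<in>space M. 0 \<le> r w \<and> r w \<le> C) \<and> (\<forall>t\<ge>0. {w \<in> space M. r w \<le> t} \<in> filt M P X t)"

definition past :: "('w \<Rightarrow> real) \<Rightarrow> 'w set set" where
  "past r = {B \<in> sets M. \<forall>t\<ge>0. B \<inter> {w \<in> space M. r w \<le> t} \<in> filt M P X t}"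

lemma bstop_stopping: "bstop C r \<Longrightarrow> stopping M P X (\<lambda>w. ennreal (r w))"
  by (simp add: bstop_def stopping_def)

lemma past_stopped_sets: "past r = stopped_sets M P X (\<lambda>w. ennreal (r w))"
  by (simp add: past_def stopped_sets_def)

lemma bstop_nonneg: "bstop C r \<Longrightarrow> w \<in> space M \<Longrightarrow> 0 \<le> r w"
  and bstop_bound: "bstop C r \<Longrightarrow> w \<in> space M \<Longrightarrow> r w \<le> C"
  and bstop_filt: "bstop C r \<Longrightarrow> t \<ge> 0 \<Longrightarrow> {w \<in> space M. r w \<le> t} \<in> filt M P X t"
  by (auto simp: bstop_def)

lemma bstop_measurable: "bstop C r \<Longrightarrow> r \<in> borel_measurable M"
  unfolding borel_measurable_iff_le
proof
  fix a assume r: "bstop C r"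
  show "{w \<in> space M. r w \<le> a} \<in> sets M"
  proof (cases "a \<ge> 0")
    case True then show ?thesis using bstop_filt[OF r] filt_subset by blast
  next
    case False
    then have "{w \<in> space M. r w \<le> a} = {}" using order_trans[OF bstop_nonneg[OF r]] by blast
    then show ?thesis by (simp only: sets.empty_sets)
  qed
qed

lemma bstop_const: "0 \<le> c \<Longrightarrow> bstop c (\<lambda>_. c)"
proof -
  assume c: "0 \<le> c"
  interpret sigma_algebra "space M" "filt M P X t" for t by (rule sigma_algebra_filt)
  have "{w \<in> space M. c \<le> t} \<in> filt M P X t" for t by (cases "c \<le> t") auto
  then show ?thesis using c by (simp add: bstop_def)
qed

lemma stopping_min:
  assumes "stopping M P X \<sigma>" "stopping M P X \<tau>"
  shows "stopping M P X (\<lambda>w. min (\<sigma> w) (\<tau> w))"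
  unfolding stopping_def
proof (intro allI impI)
  fix t :: real assume t: "t \<ge> 0"
  interpret sigma_algebra "space M" "filt M P X t" by (rule sigma_algebra_filt)
  have "{w \<in> space M. min (\<sigma> w) (\<tau> w) \<le> ennreal t} =
    {w \<in> space M. \<sigma> w \<le> ennreal t} \<union> {w \<in> space M. \<tau> w \<le> ennreal t}"
    by (auto simp: min_le_iff_disj)
  also have "\<dots> \<in> filt M P X t"
    using assms t unfolding stopping_def by (intro Un) auto
  finally show "{w \<in> space M. min (\<sigma> w) (\<tau> w) \<le> ennreal t} \<in> filt M P X t" .
qed

lemma bstop_min_stopping:
  assumes "bstop C r" "stopping M P X \<tau>"
  shows "bstop C (\<lambda>w. enn2real (min (\<tau> w) (ennreal (r w))))"
proof -
  have *: "enn2real (min (\<tau> w) (ennreal (r w))) \<le> t \<longleftrightarrow> min (\<tau> w) (ennreal (r w)) \<le> ennreal t" if "t \<ge> 0" for t w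
  proof -
    \<comment> \<open>Finiteness excludes the default \<open>enn2real top = 0\<close>, for which the
      equivalence would fail.\<close>
    have "min (\<tau> w) (ennreal (r w)) < top" by (simp add: min_less_iff_disj)
    then show ?thesis using that by (metis enn2real_leI ennreal_enn2real ennreal_leI)
  qed
  have "min (\<tau> w) (ennreal (r w)) \<le> ennreal C" if "w \<in> space M" for w
    using bstop_bound[OF assms(1) that] by (intro min.coboundedI2 ennreal_leI)
  moreover have "0 \<le> C" if "w \<in> space M" for w
    using bstop_nonneg[OF assms(1) that] bstop_bound[OF assms(1) that] by linarith
  ultimately show ?thesis
    using stopping_min[OF assms(2) bstop_stopping[OF assms(1)]]
    unfolding bstop_def stopping_def by (simp add: *)
qed

lemma bstop_add:
  assumes r: "bstop C r" and c: "c \<ge> 0"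
  shows "bstop (C + c) (\<lambda>w. r w + c)"
  unfolding bstop_def
proof (intro conjI ballI allI impI)
  fix t :: real assume t: "t \<ge> 0"
  interpret sigma_algebra "space M" "filt M P X t" by (rule sigma_algebra_filt)
  show "{w \<in> space M. r w + c \<le> t} \<in> filt M P X t"
  proof (cases "t \<ge> c")
    case True
    have "{w \<in> space M. r w + c \<le> t} = {w \<in> space M. r w \<le> t - c}" by auto
    then show ?thesis using bstop_filt[OF r, of "t - c"] True c filt_mono[of "t-c" t] by auto
  next
    case False
    have "{w \<in> space M. r w + c \<le> t} = {}" using bstop_nonneg[OF r] False by force
    then show ?thesis by (simp only: empty_sets)
  qed
qed (use bstop_nonneg[OF r] bstop_bound[OF r] c in \<open>auto simp: add_nonneg_nonneg\<close>)

section \<open>Events known at a bounded stopping time\<close>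

lemma past_sets: "B \<in> past r \<Longrightarrow> B \<in> sets M"
  by (simp add: past_def)

lemma past_filt: "B \<in> past r \<Longrightarrow> t \<ge> 0 \<Longrightarrow> B \<inter> {w \<in> space M. r w \<le> t} \<in> filt M P X t"
  by (simp add: past_def)

lemma past_space: "bstop C r \<Longrightarrow> space M \<in> past r"
  unfolding past_def by (auto simp: Int_absorb1 bstop_filt)

lemma past_Int:
  assumes "A \<in> past r" "B \<in> past r" shows "A \<inter> B \<in> past r"
  unfolding past_def
proof (intro CollectI conjI allI impI)
  show "A \<inter> B \<in> sets M" using assms past_sets by blast
  fix t :: real assume t: "t \<ge> 0"
  interpret sigma_algebra "space M" "filt M P X t" by (rule sigma_algebra_filt)
  have "(A \<inter> {w \<in> space M. r w \<le> t}) \<inter> (B \<inter> {w \<in> space M. r w \<le> t}) \<in> filt M P X t"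
    by (rule Int[OF past_filt[OF assms(1) t] past_filt[OF assms(2) t]])
  then show "A \<inter> B \<inter> {w \<in> space M. r w \<le> t} \<in> filt M P X t"
    by (rule back_subst[of "\<lambda>S. S \<in> filt M P X t"]) blast
qed

lemma past_compl:
  assumes r: "bstop C r" and A: "A \<in> past r" shows "space M - A \<in> past r"
  unfolding past_def
proof (intro CollectI conjI allI impI)
  show "space M - A \<in> sets M" using A past_sets by blast
  fix t :: real assume t: "t \<ge> 0"
  interpret sigma_algebra "space M" "filt M P X t" by (rule sigma_algebra_filt)
  have "{w \<in> space M. r w \<le> t} - A \<inter> {w \<in> space M. r w \<le> t} \<in> filt M P X t"
    by (rule Diff[OF bstop_filt[OF r t] past_filt[OF A t]])
  then show "(space M - A) \<inter> {w \<in> space M. r w \<le> t} \<in> filt M P X t"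
    by (rule back_subst[of "\<lambda>S. S \<in> filt M P X t"]) blast
qed

lemma past_mono:
  assumes s: "bstop C s" and le: "\<And>w. w \<in> space M \<Longrightarrow> r w \<le> s w" and B: "B \<in> past r"
  shows "B \<in> past s"
  unfolding past_def
proof (intro CollectI conjI allI impI)
  show "B \<in> sets M" using B past_sets by blast
  fix t :: real assume t: "t \<ge> 0"
  interpret sigma_algebra "space M" "filt M P X t" by (rule sigma_algebra_filt)
  have "(B \<inter> {w \<in> space M. r w \<le> t}) \<inter> {w \<in> space M. s w \<le> t} \<in> filt M P X t"
    by (rule Int[OF past_filt[OF B t] bstop_filt[OF s t]])
  also have "(B \<inter> {w \<in> space M. r w \<le> t}) \<inter> {w \<in> space M. s w \<le> t} = B \<inter> {w \<in> space M. s w \<le> t}"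
    using le by force
  finally show "B \<inter> {w \<in> space M. s w \<le> t} \<in> filt M P X t" .
qed

lemma past_less:
  assumes r: "bstop C r" and s: "bstop D s"
  shows "{w \<in> space M. r w < s w} \<in> past r"
  unfolding past_def
proof (intro CollectI conjI allI impI)
  have [measurable]: "r \<in> borel_measurable M" "s \<in> borel_measurable M"
    using r s by (auto intro: bstop_measurable)
  show "{w \<in> space M. r w < s w} \<in> sets M" by measurable
  fix t :: real assume t: "t \<ge> 0"
  interpret sigma_algebra "space M" "filt M P X t" by (rule sigma_algebra_filt)
  \<comment> \<open>If \<open>r w = t\<close>, there may be no rational \<open>q \<le> t\<close>
    with \<open>r w \<le> q\<close>; the added point \<open>t\<close> covers the case
    \<open>t < s w\<close>.\<close>
  define Q where "Q = insert t (\<rat> \<inter> {0..t})"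
  have "countable Q" unfolding Q_def by (simp add: countable_rat countable_Int1)
  have eq: "{w \<in> space M. r w < s w} \<inter> {w \<in> space M. r w \<le> t} =
     (\<Union>q\<in>Q. {w \<in> space M. r w \<le> q} - {w \<in> space M. s w \<le> q})"
  proof (intro equalityI subsetI)
    fix w assume w: "w \<in> {w \<in> space M. r w < s w} \<inter> {w \<in> space M. r w \<le> t}"
    show "w \<in> (\<Union>q\<in>Q. {w \<in> space M. r w \<le> q} - {w \<in> space M. s w \<le> q})"
    proof (cases "t < s w")
      case True
      then show ?thesis using w by (auto simp: Q_def)
    next
      case False
      obtain q where q: "q \<in> \<rat>" "r w < q" "q < s w" using w Rats_dense_in_real by blast
      then have "q \<in> Q" using w False bstop_nonneg[OF r, of w] by (auto simp: Q_def)
      moreover have "r w \<le> q" "\<not> s w \<le> q" using q by auto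
      ultimately show ?thesis using w by blast
    qed
  qed (auto simp: Q_def)
  have "{w \<in> space M. r w \<le> q} - {w \<in> space M. s w \<le> q} \<in> filt M P X t" if "q \<in> Q" for q
  proof -
    have "0 \<le> q" "q \<le> t" using that t by (auto simp: Q_def)
    then show ?thesis
      using bstop_filt[OF r, of q] bstop_filt[OF s, of q] filt_mono[of q t] by (blast intro: Diff)
  qed
  then show "{w \<in> space M. r w < s w} \<inter> {w \<in> space M. r w \<le> t} \<in> filt M P X t"
    unfolding eq by (intro countable_UN' \<open>countable Q\<close>) auto
qed

text \<open>Progressive measurability: the path frozen after \<open>u\<close> is right-continuous
  and known at \<open>u\<close>, hence jointly measurable in time and \<open>w\<close>. Inserting
  the time \<open>min (r w) t\<close> gives \<open>X (r w) w\<close> on \<open>{r \<le> t}\<close>,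
  and right-continuity of the filtration lets \<open>u\<close> decrease to \<open>t\<close>.\<close>

lemma past_X:
  assumes r: "bstop C r" and A: "A \<in> sets borel"
  shows "{w \<in> space M. X (r w) w \<in> A} \<in> past r"
  unfolding past_def
proof (intro CollectI conjI allI impI)
  have [measurable]: "(\<lambda>w. X (r w) w) \<in> borel_measurable M"
    using bstop_measurable[OF r] bstop_nonneg[OF r] by (rule measurable_X_at)
  show "{w \<in> space M. X (r w) w \<in> A} \<in> sets M" using A by measurable
  fix t :: real assume t: "t \<ge> 0"
  show "{w \<in> space M. X (r w) w \<in> A} \<inter> {w \<in> space M. r w \<le> t} \<in> filt M P X t"
  proof (rule filt_right_continuous)
    fix u assume u: "u > t"
    \<comment> \<open>The zero measure merely carries the sigma-algebra \<open>filt M P X u\<close>,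
      so that measurability with respect to it can be stated for functions.\<close>
    define N where "N = measure_of (space M) (filt M P X u) (\<lambda>_. 0)"
    interpret F: sigma_algebra "space M" "filt M P X u" by (rule sigma_algebra_filt)
    have sN: "sets N = filt M P X u" and spN: "space N = space M"
      unfolding N_def by (simp_all add: F.sets_measure_of_eq F.space_measure_of_eq)
    have "(\<lambda>p. X (min u (max 0 (fst p))) (snd p)) \<in> borel_measurable (borel \<Otimes>\<^sub>M N)"
      (is "?pair \<in> _")
    proof (rule borel_measurable_right_continuous_pair[of "\<lambda>s. X (min u s)"])
      fix s :: real assume s: "s \<ge> 0"
      show "X (min u s) \<in> borel_measurable N"
      proof (rule measurableI)
        fix S :: "'a set" assume S: "S \<in> sets borel"
        have "X (min u s) -` S \<inter> space M \<in> nat_filt M X v" if "v > u" for v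
          unfolding nat_filt_def using S s t u that
          by (intro sigma_sets.Basic) (auto intro!: exI[of _ "min u s"] exI[of _ S])
        then have "X (min u s) -` S \<inter> space M \<in> nat_filt_plus M X u"
          unfolding nat_filt_plus_def by blast
        then show "X (min u s) -` S \<inter> space N \<in> sets N"
          unfolding sN spN using nat_filt_plus_subset_filt by blast
      qed simp
      fix w assume w: "w \<in> space N"
      show "((\<lambda>s. X (min u s) w) \<longlongrightarrow> X (min u s) w) (at_right s)"
      proof (cases "s < u")
        case True
        have "eventually (\<lambda>s'. X s' w = X (min u s') w) (at_right s)"
          using eventually_at_right_real[OF True] by eventually_elim auto
        moreover have "((\<lambda>s. X s w) \<longlongrightarrow> X (min u s) w) (at_right s)"
          using True s w right_continuous_X[of w s] by (simp add: spN)
        ultimately show ?thesis by (rule Lim_transform_eventually[rotated])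
      next
        case False
        have "eventually (\<lambda>s'. X u w = X (min u s') w) (at_right s)"
          using eventually_at_right_less[of s] by eventually_elim (use False in auto)
        moreover have "X (min u s) w = X u w" using False by (simp add: min_def)
        ultimately show ?thesis using Lim_transform_eventually[OF tendsto_const] by simp
      qed
    qed
    moreover have "(\<lambda>w. min (r w) t) \<in> borel_measurable N"
      unfolding borel_measurable_iff_le spN sN
    proof
      fix a
      consider "a < 0" | "0 \<le> a" "a < t" | "t \<le> a" by linarith
      then show "{w \<in> space M. min (r w) t \<le> a} \<in> filt M P X u"
      proof cases
        case 1
        then have "{w \<in> space M. min (r w) t \<le> a} = {}" 
          using bstop_nonneg[OF r] t by (force simp: min_le_iff_disj)
        then show ?thesis by (simp only: F.empty_sets)
      next
        case 2
        then have "{w \<in> space M. min (r w) t \<le> a} = {w \<in> space M. r w \<le> a}" 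
          by (auto simp: min_le_iff_disj)
        then show ?thesis using bstop_filt[OF r, of a] filt_mono[of a u] 2 u by auto
      next
        case 3
        then have "{w \<in> space M. min (r w) t \<le> a} = space M" by auto
        then show ?thesis by simp
      qed
    qed
    ultimately have "(\<lambda>w. X (min u (max 0 (min (r w) t))) w) \<in> borel_measurable N"
      using measurable_compose[OF measurable_Pair[OF _ measurable_ident], where g = ?pair] by simp
    then have "(\<lambda>w. X (min u (max 0 (min (r w) t))) w) -` A \<inter> space N \<in> sets N"
      using A by (rule measurable_sets)
    moreover have "{w \<in> space M. r w \<le> t} \<in> filt M P X u"
      using bstop_filt[OF r t] filt_mono[of t u] u by auto
    ultimately have "((\<lambda>w. X (min u (max 0 (min (r w) t))) w) -` A \<inter> space N) \<inter> {w \<in> space M. r w \<le> t} \<in> filt M P X u"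
      unfolding sN by (rule F.Int)
    also have "((\<lambda>w. X (min u (max 0 (min (r w) t))) w) -` A \<inter> space N) \<inter> {w \<in> space M. r w \<le> t}
        = {w \<in> space M. X (r w) w \<in> A} \<inter> {w \<in> space M. r w \<le> t}"
      using u bstop_nonneg[OF r] by (auto simp: spN)
    finally show "{w \<in> space M. X (r w) w \<in> A} \<inter> {w \<in> space M. r w \<le> t} \<in> filt M P X u" .
  qed
qed

end

subsection \<open>Feller semigroup and Markov property\<close>

text \<open>The Feller property speaks of \<open>C0\<close>, but \<open>f\<close> and
  \<open>g\<close> need not vanish at infinity; all later arguments run in this larger
  class.\<close>

definition bcontinuous :: "('a::topological_space \<Rightarrow> real) \<Rightarrow> bool" where
  "bcontinuous \<phi> \<longleftrightarrow> continuous_on UNIV \<phi> \<and> bounded (range \<phi>)"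

lemma bcontinuousI: "continuous_on UNIV \<phi> \<Longrightarrow> (\<And>y. \<bar>\<phi> y\<bar> \<le> c) \<Longrightarrow> bcontinuous \<phi>"
  by (auto simp: bcontinuous_def bounded_iff)

lemma bcontinuous_bound:
  assumes "bcontinuous \<phi>" obtains c where "c \<ge> 0" "\<And>y. \<bar>\<phi> y\<bar> \<le> c"
proof -
  obtain c where "\<And>y. \<bar>\<phi> y\<bar> \<le> c" using assms by (auto simp: bcontinuous_def bounded_iff)
  then show ?thesis using that[of c] abs_ge_zero order_trans by blast
qed

lemma bcontinuous_measurable: "bcontinuous \<phi> \<Longrightarrow> \<phi> \<in> borel_measurable borel"
  by (simp add: bcontinuous_def borel_measurable_continuous_onI)

lemma bcontinuous_max: "bcontinuous \<phi> \<Longrightarrow> bcontinuous \<psi> \<Longrightarrow> bcontinuous (\<lambda>y. max (\<phi> y) (\<psi> y))"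
proof -
  assume *: "bcontinuous \<phi>" "bcontinuous \<psi>"
  obtain c d where "\<And>y. \<bar>\<phi> y\<bar> \<le> c" "\<And>y. \<bar>\<psi> y\<bar> \<le> d"
    using bcontinuous_bound *  by metis
  then have "\<bar>max (\<phi> y) (\<psi> y)\<bar> \<le> max c d" for y
    by (smt (verit))
  then show ?thesis using * unfolding bcontinuous_def
    by (intro conjI continuous_on_max) (auto simp: bounded_iff)
qed

lemma bcontinuous_add: "bcontinuous \<phi> \<Longrightarrow> bcontinuous \<psi> \<Longrightarrow> bcontinuous (\<lambda>y. \<phi> y + \<psi> y)"
proof -
  assume *: "bcontinuous \<phi>" "bcontinuous \<psi>"
  obtain c d where "\<And>y. \<bar>\<phi> y\<bar> \<le> c" "\<And>y. \<bar>\<psi> y\<bar> \<le> d"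
    using bcontinuous_bound *  by metis
  then have "\<bar>\<phi> y + \<psi> y\<bar> \<le> c + d" for y
    by (intro order_trans[OF abs_triangle_ineq] add_mono)
  then show ?thesis using * unfolding bcontinuous_def
    by (intro conjI continuous_on_add) (auto simp: bounded_iff)
qed

context feller_process
begin

lemma measure_P_space [simp]: "measure (P x) (space M) = 1"
  using prob_space.prob_space[OF prob_space_P[of x]] by simp

lemma integrable_bounded:
  fixes h :: "'w \<Rightarrow> real"
  assumes "h \<in> borel_measurable M" "\<And>w. w \<in> space M \<Longrightarrow> \<bar>h w\<bar> \<le> c"
  shows "integrable (P x) h"
proof -
  interpret prob_space "P x" by (rule prob_space_P)
  show ?thesis using assms by (intro integrable_const_bound[of _ c]) auto
qed

lemma integral_bounded:
  fixes h :: "'w \<Rightarrow> real"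
  assumes "\<And>w. w \<in> space M \<Longrightarrow> \<bar>h w\<bar> \<le> c" "0 \<le> c"
  shows "\<bar>\<integral>w. h w \<partial>P x\<bar> \<le> c"
proof -
  interpret prob_space "P x" by (rule prob_space_P)
  have "\<bar>\<integral>w. h w \<partial>P x\<bar> \<le> (\<integral>w. \<bar>h w\<bar> \<partial>P x)" by (rule integral_abs_bound)
  also have "\<dots> \<le> (\<integral>w. c \<partial>P x)"
    using assms by (intro integral_mono') auto
  finally show ?thesis by (simp add: prob_space)
qed

lemma bcontinuous_X:
  assumes "bcontinuous \<phi>" "r \<in> borel_measurable M" "\<And>w. w \<in> space M \<Longrightarrow> 0 \<le> r w"
  shows "(\<lambda>w. \<phi> (X (r w) w)) \<in> borel_measurable M"
  by (rule measurable_compose[OF measurable_X_at[OF assms(2,3)] bcontinuous_measurable[OF assms(1)]])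

lemma semigroup_bound:
  assumes "0 \<le> c" "\<And>y. \<bar>\<phi> y\<bar> \<le> c"
  shows "\<bar>semigroup P X t \<phi> y\<bar> \<le> c"
  unfolding semigroup_def by (rule integral_bounded) (use assms in auto)

text \<open>Since the Feller property covers \<open>C0\<close> only, \<phi> is multiplied by a
  cut-off \<open>\<psi> m\<close>. The error at \<open>y\<close> is at most
  \<open>c * (1 - semigroup P X t (\<psi> m) y)\<close>; this bound is continuous in
  \<open>y\<close> and small at \<open>x\<close> for large \<open>m\<close>, hence small near
  \<open>x\<close>.\<close>

lemma continuous_semigroup:
  assumes \<phi>: "bcontinuous \<phi>" and t: "t \<ge> 0"
  shows "continuous_on UNIV (semigroup P X t \<phi>)"
  unfolding continuous_on_def
proof
  fix x :: 'a
  let ?S = "semigroup P X t"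
  obtain c where c: "c \<ge> 0" "\<And>y. \<bar>\<phi> y\<bar> \<le> c" using bcontinuous_bound[OF \<phi>] by blast
  \<comment> \<open>Equal to 1 on the ball of radius \<open>m\<close> about \<open>x\<close> and to
    0 outside radius \<open>m + 1\<close>. Closed balls being compact, it lies in
    \<open>C0\<close>.\<close>
  define \<psi> where "\<psi> m y = max 0 (min 1 (real m + 1 - dist x y))" for m and y :: 'a
  have \<psi>: "0 \<le> \<psi> m y" "\<psi> m y \<le> 1" for m y by (auto simp: \<psi>_def)
  have \<psi>_cont: "continuous_on UNIV (\<psi> m)" for m
    unfolding \<psi>_def by (intro continuous_intros)
  have \<psi>_out: "\<psi> m y = 0" if "y \<notin> cball x (real m + 1)" for m y
    using that by (auto simp: \<psi>_def)
  have \<psi>_C0: "\<psi> m \<in> C0" "(\<lambda>y. \<phi> y * \<psi> m y) \<in> C0" for m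
  proof -
    have *: "h \<in> C0" if "continuous_on UNIV h" "\<And>y. \<bar>h y\<bar> \<le> k" "\<And>y. y \<notin> cball x (real m + 1) \<Longrightarrow> h y = 0"
      for h :: "'a \<Rightarrow> real" and k
      unfolding C0_def
    proof (intro CollectI conjI allI impI)
      show "bounded (range h)" using that(2) by (auto simp: bounded_iff)
      show "\<exists>K. compact K \<and> (\<forall>y. y \<notin> K \<longrightarrow> \<bar>h y\<bar> < e)" if "e > 0" for e
        using \<open>e > 0\<close> \<open>\<And>y. y \<notin> cball x (real m + 1) \<Longrightarrow> h y = 0\<close>
        by (intro exI[of _ "cball x (real m + 1)"]) auto
    qed fact
    show "\<psi> m \<in> C0" using \<psi>[of m] by (intro *[OF \<psi>_cont, of _ 1] \<psi>_out) auto
    show "(\<lambda>y. \<phi> y * \<psi> m y) \<in> C0"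
    proof (rule *[of _ c])
      show "continuous_on UNIV (\<lambda>y. \<phi> y * \<psi> m y)"
        using \<phi> \<psi>_cont by (intro continuous_on_mult) (auto simp: bcontinuous_def)
      show "\<bar>\<phi> y * \<psi> m y\<bar> \<le> c" for y
        using mult_mono[OF c(2)[of y] \<psi>(2)[of m y]] \<psi>(1)[of m y] c by (simp add: abs_mult)
    qed (simp add: \<psi>_out)
  qed
  have S_cont: "continuous_on UNIV (?S (\<psi> m))" "continuous_on UNIV (?S (\<lambda>y. \<phi> y * \<psi> m y))" for m
    using feller t \<psi>_C0[of m] by (auto simp: weak_feller_def C0_def)
  have mX: "X t \<in> borel_measurable M" using t by (rule measurable_X)
  have [measurable]: "(\<lambda>w. \<psi> m (X t w)) \<in> borel_measurable M" "(\<lambda>w. \<phi> (X t w)) \<in> borel_measurable M" for m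
    using borel_measurable_continuous_onI[OF \<psi>_cont] bcontinuous_measurable[OF \<phi>]
    by (auto intro: measurable_compose[OF mX])
  have cut: "\<bar>?S \<phi> y - ?S (\<lambda>y. \<phi> y * \<psi> m y) y\<bar> \<le> c * (1 - ?S (\<psi> m) y)" for m y
  proof -
    interpret prob_space "P y" by (rule prob_space_P)
    have i\<psi>: "integrable (P y) (\<lambda>w. \<psi> m (X t w))"
      using \<psi>[of m] by (intro integrable_bounded[where c = 1]) auto
    have i\<phi>: "integrable (P y) (\<lambda>w. \<phi> (X t w))"
      using c by (intro integrable_bounded[where c = c]) auto
    have i\<phi>\<psi>: "integrable (P y) (\<lambda>w. \<phi> (X t w) * \<psi> m (X t w))"
    proof (rule integrable_bounded[where c = c])
      show "\<bar>\<phi> (X t w) * \<psi> m (X t w)\<bar> \<le> c" for w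
        using mult_mono[OF c(2)[of "X t w"] \<psi>(2)[of m "X t w"]] \<psi>(1)[of m "X t w"] c by (simp add: abs_mult)
    qed measurable
    have "?S \<phi> y - ?S (\<lambda>y. \<phi> y * \<psi> m y) y = (\<integral>w. \<phi> (X t w) - \<phi> (X t w) * \<psi> m (X t w) \<partial>P y)"
      unfolding semigroup_def using i\<phi> i\<phi>\<psi> by simp
    also have "\<bar>\<dots>\<bar> \<le> (\<integral>w. \<bar>\<phi> (X t w) - \<phi> (X t w) * \<psi> m (X t w)\<bar> \<partial>P y)" by (rule integral_abs_bound)
    also have "\<dots> \<le> (\<integral>w. c * (1 - \<psi> m (X t w)) \<partial>P y)"
    proof (rule integral_mono)
      fix w
      have "\<phi> (X t w) - \<phi> (X t w) * \<psi> m (X t w) = \<phi> (X t w) * (1 - \<psi> m (X t w))" by (simp add: algebra_simps)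
      then show "\<bar>\<phi> (X t w) - \<phi> (X t w) * \<psi> m (X t w)\<bar> \<le> c * (1 - \<psi> m (X t w))"
        using c(2)[of "X t w"] \<psi>(2)[of m "X t w"] by (simp add: abs_mult mult_right_mono)
    qed (use i\<psi> i\<phi> i\<phi>\<psi> in auto)
    also have "\<dots> = c * (1 - ?S (\<psi> m) y)"
      unfolding semigroup_def using i\<psi> by (simp add: prob_space)
    finally show ?thesis .
  qed
  have lim: "(\<lambda>m. ?S (\<psi> m) x) \<longlonglongrightarrow> 1"
  proof -
    interpret prob_space "P x" by (rule prob_space_P)
    have "(\<lambda>m. \<integral>w. \<psi> m (X t w) \<partial>P x) \<longlonglongrightarrow> (\<integral>w. 1 \<partial>P x)"
    proof (rule integral_dominated_convergence[where w = "\<lambda>_. 1"])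
      show "AE w in P x. (\<lambda>m. \<psi> m (X t w)) \<longlonglongrightarrow> 1"
      proof (rule always_eventually, rule allI)
        fix w
        obtain m0 :: nat where "real m0 \<ge> dist x (X t w)" using real_arch_simple by blast
        then have "\<psi> m (X t w) = 1" if "m \<ge> m0" for m
          using that by (auto simp: \<psi>_def)
        then show "(\<lambda>m. \<psi> m (X t w)) \<longlonglongrightarrow> 1"
          by (intro tendsto_eventually) (auto simp: eventually_sequentially)
      qed
    qed (use \<psi> in auto)
    then show ?thesis by (simp add: semigroup_def prob_space)
  qed
  show "(?S \<phi> \<longlongrightarrow> ?S \<phi> x) (at x within UNIV)"
  proof (rule tendstoI)
    fix e :: real assume e: "e > 0"
    \<comment> \<open>Chosen so that two cut-off errors \<open>c * \<epsilon>\<close>, at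
      \<open>x\<close> and at \<open>y\<close>, and one variation \<epsilon> of the cut-off
      function's semigroup add up to \<open>e\<close>.\<close>
    define \<epsilon> where "\<epsilon> = e / (2 * c + 1)"
    have \<epsilon>: "\<epsilon> > 0" using e c by (simp add: \<epsilon>_def)
    obtain m where m: "?S (\<psi> m) x > 1 - \<epsilon>"
      using order_tendstoD(1)[OF lim, of "1 - \<epsilon>"] \<epsilon> by (auto simp: eventually_sequentially)
    have "eventually (\<lambda>y. ?S (\<psi> m) y > 1 - \<epsilon>) (at x)"
      using S_cont(1)[of m] m by (intro order_tendstoD(1)) (auto simp: continuous_on_def)
    moreover have "eventually (\<lambda>y. dist (?S (\<lambda>y. \<phi> y * \<psi> m y) y) (?S (\<lambda>y. \<phi> y * \<psi> m y) x) < \<epsilon>) (at x)"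
      using S_cont(2)[of m] \<epsilon> by (intro tendstoD) (auto simp: continuous_on_def)
    ultimately show "eventually (\<lambda>y. dist (?S \<phi> y) (?S \<phi> x) < e) (at x within UNIV)"
    proof eventually_elim
      case (elim y)
      have "c * (1 - ?S (\<psi> m) y) \<le> c * \<epsilon>" "c * (1 - ?S (\<psi> m) x) \<le> c * \<epsilon>"
        using elim m c by (auto intro!: mult_left_mono)
      then have "dist (?S \<phi> y) (?S \<phi> x) < c * \<epsilon> + c * \<epsilon> + \<epsilon>"
        using order_trans[OF cut[of y m]] order_trans[OF cut[of x m]] elim(2)
        unfolding dist_real_def by (smt (verit))
      also have "\<dots> = (2 * c + 1) * \<epsilon>" by (simp add: algebra_simps)
      also have "\<dots> = e" using c by (simp add: \<epsilon>_def)
      finally show ?case .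
    qed
  qed
qed

lemma bcontinuous_semigroup:
  assumes \<phi>: "bcontinuous \<phi>" and t: "t \<ge> 0"
  shows "bcontinuous (semigroup P X t \<phi>)"
proof -
  obtain c where "c \<ge> 0" "\<And>y. \<bar>\<phi> y\<bar> \<le> c" using bcontinuous_bound[OF \<phi>] by blast
  then show ?thesis
    by (intro bcontinuousI[of _ c] continuous_semigroup[OF assms] semigroup_bound)
qed

text \<open>The strong Markov property is given for indicators and extends by induction over
  nonnegative Borel functions. Measurability of the inner integral in \<open>y\<close> is carried
  along because the cases of multiples, sums and suprema rely on it.\<close>

lemma markov_nn:
  fixes \<phi> :: "'a \<Rightarrow> ennreal"
  assumes r: "bstop C r" and B: "B \<in> past r" and s: "s \<ge> 0" and \<phi>: "\<phi> \<in> borel_measurable borel"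
  shows "(\<lambda>y. \<integral>\<^sup>+v. \<phi> (X s v) \<partial>P y) \<in> borel_measurable borel \<and>
    (\<integral>\<^sup>+w. indicator B w * \<phi> (X (r w + s) w) \<partial>P x) =
    (\<integral>\<^sup>+w. indicator B w * (\<integral>\<^sup>+v. \<phi> (X s v) \<partial>P (X (r w) w)) \<partial>P x)"
proof -
  have X_s [measurable]: "X s \<in> borel_measurable M" using s by (rule measurable_X)
  note r0 = bstop_nonneg[OF r] and rm[measurable] = bstop_measurable[OF r]
  have [measurable]: "B \<in> sets M" using B by (rule past_sets)
  have X_rs [measurable]: "(\<lambda>w. X (r w + s) w) \<in> borel_measurable M"
    using r0 s by (intro measurable_X_at) auto
  have X_r [measurable]: "(\<lambda>w. X (r w) w) \<in> borel_measurable M"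
    using r0 by (intro measurable_X_at) auto
  show ?thesis
    using \<phi>
  proof (induct \<phi> rule: borel_measurable_induct)
    case (cong f g)
    then have "f = g" by auto
    then show ?case using cong by simp
  next
    case (set A)
    interpret prob_space "P y" for y by (rule prob_space_P)
    have BM: "B \<subseteq> space M" by (rule sets.sets_into_space) measurable
    define k where "k y = measure (P y) {v \<in> space M. X s v \<in> A}" for y
    have [measurable]: "k \<in> borel_measurable borel"
      unfolding k_def using s set by (rule measurable_P_X_in)
    have inner: "(\<integral>\<^sup>+v. indicator A (X s v) \<partial>P y) = ennreal (k y)" for y
    proof -
      have "(\<integral>\<^sup>+v. indicator A (X s v) \<partial>P y) = (\<integral>\<^sup>+v. indicator {v \<in> space M. X s v \<in> A} v \<partial>P y)"
        by (intro nn_integral_cong) (auto simp: indicator_def)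
      also have "\<dots> = emeasure (P y) {v \<in> space M. X s v \<in> A}"
        using measurable_sets[OF X_s set] by (intro nn_integral_indicator) (simp add: vimage_def Int_def conj_commute)
      finally show ?thesis by (simp add: k_def emeasure_eq_measure)
    qed
    have "(\<integral>\<^sup>+w. indicator B w * indicator A (X (r w + s) w) \<partial>P x)
        = (\<integral>\<^sup>+w. indicator {w \<in> B. X (r w + s) w \<in> A} w \<partial>P x)"
      by (intro nn_integral_cong) (auto simp: indicator_def)
    also have "\<dots> = emeasure (P x) {w \<in> B. X (r w + s) w \<in> A}"
    proof (rule nn_integral_indicator)
      have "{w \<in> B. X (r w + s) w \<in> A} = B \<inter> {w \<in> space M. X (r w + s) w \<in> A}" using BM by auto
      also have "\<dots> \<in> sets M" using set by measurable
      finally show "{w \<in> B. X (r w + s) w \<in> A} \<in> sets (P x)" by simp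
    qed
    also have "\<dots> = ennreal (measure (P x) {w \<in> B. X (r w + s) w \<in> A})"
      by (rule emeasure_eq_measure)
    also have "measure (P x) {w \<in> B. X (r w + s) w \<in> A} = 
      measure (P x) {w \<in> B. ennreal (r w) < \<infinity> \<and> X (enn2real (ennreal (r w)) + s) w \<in> A}"
      using r0 BM by (intro arg_cong[where f = "measure (P x)"]) auto
    also have "\<dots> = (\<integral>w. indicator {w \<in> B. ennreal (r w) < \<infinity>} w * k (Xat X (\<lambda>w. ennreal (r w)) w) \<partial>P x)"
      unfolding k_def using strong_markov[OF bstop_stopping[OF r] s set] B by (simp add: past_stopped_sets)
    also have "\<dots> = (\<integral>w. indicator B w * k (X (r w) w) \<partial>P x)"
      using r0 by (intro Bochner_Integration.integral_cong) (auto simp: Xat_def indicator_def)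
    also have "ennreal \<dots> = (\<integral>\<^sup>+w. ennreal (indicator B w * k (X (r w) w)) \<partial>P x)"
    proof (rule nn_integral_eq_integral[symmetric])
      show "integrable (P x) (\<lambda>w. indicator B w * k (X (r w) w))"
      proof (rule integrable_bounded[where c = 1])
        show "\<bar>indicator B w * k (X (r w) w)\<bar> \<le> 1" for w
          by (auto simp: k_def indicator_def)
      qed measurable
    qed (auto simp: k_def)
    also have "\<dots> = (\<integral>\<^sup>+w. indicator B w * ennreal (k (X (r w) w)) \<partial>P x)"
      by (intro nn_integral_cong) (auto simp: indicator_def)
    finally show ?case unfolding inner by simp
  next
    case (mult u c)
    note [measurable] = mult(2) mult(4)[THEN conjunct1]
    have *: "(\<integral>\<^sup>+v. c * u (X s v) \<partial>P y) = c * (\<integral>\<^sup>+v. u (X s v) \<partial>P y)" for y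
      by (rule nn_integral_cmult) measurable
    show ?case unfolding * using mult(4)
      by (simp add: mult.left_commute[of _ c] nn_integral_cmult)
  next
    case (add u v)
    note [measurable] = add(1) add(4) add(3)[THEN conjunct1] add(7)[THEN conjunct1]
    have *: "(\<integral>\<^sup>+w. v (X s w) + u (X s w) \<partial>P y) = (\<integral>\<^sup>+w. v (X s w) \<partial>P y) + (\<integral>\<^sup>+w. u (X s w) \<partial>P y)" for y
      by (rule nn_integral_add) measurable
    show ?case unfolding * using add(3,7)
      by (simp add: distrib_left nn_integral_add)
  next
    case (seq U)
    note [measurable] = seq(1) seq(3)[THEN conjunct1]
    have inc: "incseq (\<lambda>i. U i y)" for y using seq(4) by (simp add: incseq_def le_fun_def)
    have *: "(\<integral>\<^sup>+v. (SUP i. U i) (X s v) \<partial>P y) = (SUP i. \<integral>\<^sup>+v. U i (X s v) \<partial>P y)" for y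
      unfolding SUP_apply using inc
      by (intro nn_integral_monotone_convergence_SUP) (auto simp: incseq_def le_fun_def)
    have inc2: "incseq (\<lambda>i. \<integral>\<^sup>+v. U i (X s v) \<partial>P y)" for y
      using inc by (auto simp: incseq_def intro!: nn_integral_mono)
    have "(\<integral>\<^sup>+w. indicator B w * (SUP i. U i) (X (r w + s) w) \<partial>P x) =
      (\<integral>\<^sup>+w. (SUP i. indicator B w * U i (X (r w + s) w)) \<partial>P x)"
      by (simp add: SUP_mult_left_ennreal image_comp)
    also have "\<dots> = (SUP i. \<integral>\<^sup>+w. indicator B w * U i (X (r w + s) w) \<partial>P x)"
      using inc by (intro nn_integral_monotone_convergence_SUP) (auto simp: incseq_def le_fun_def intro!: mult_left_mono)
    also have "\<dots> = (SUP i. \<integral>\<^sup>+w. indicator B w * (\<integral>\<^sup>+v. U i (X s v) \<partial>P (X (r w) w)) \<partial>P x)"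
      using seq(3) by simp
    also have "\<dots> = (\<integral>\<^sup>+w. (SUP i. indicator B w * (\<integral>\<^sup>+v. U i (X s v) \<partial>P (X (r w) w))) \<partial>P x)"
      using inc2 by (intro nn_integral_monotone_convergence_SUP[symmetric]) (auto simp: incseq_def le_fun_def intro!: mult_left_mono)
    also have "\<dots> = (\<integral>\<^sup>+w. indicator B w * (SUP i. \<integral>\<^sup>+v. U i (X s v) \<partial>P (X (r w) w)) \<partial>P x)"
      by (simp add: SUP_mult_left_ennreal)
    finally show ?case unfolding * by (intro conjI borel_measurable_SUP) auto
  qed
qed

lemma markov_bcontinuous:
  assumes r: "bstop C r" and B: "B \<in> past r" and s: "s \<ge> 0" and \<phi>: "bcontinuous \<phi>"
  shows "(\<integral>w. indicator B w * \<phi> (X (r w + s) w) \<partial>P x) =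
    (\<integral>w. indicator B w * semigroup P X s \<phi> (X (r w) w) \<partial>P x)"
proof -
  note r0 = bstop_nonneg[OF r] and rm[measurable] = bstop_measurable[OF r]
  have [measurable]: "B \<in> sets M" using B by (rule past_sets)
  have X_rs [measurable]: "(\<lambda>w. X (r w + s) w) \<in> borel_measurable M"
    using r0 s by (intro measurable_X_at) auto
  have X_r [measurable]: "(\<lambda>w. X (r w) w) \<in> borel_measurable M"
    using r0 by (intro measurable_X_at) auto
  have X_s [measurable]: "X s \<in> borel_measurable M" using s by (rule measurable_X)
  have nonneg: "(\<integral>w. indicator B w * \<psi> (X (r w + s) w) \<partial>P x) =
    (\<integral>w. indicator B w * semigroup P X s \<psi> (X (r w) w) \<partial>P x)"
    if \<psi>: "bcontinuous \<psi>" "\<And>y. 0 \<le> \<psi> y" for \<psi>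
  proof -
    obtain c where c: "c \<ge> 0" "\<And>y. \<bar>\<psi> y\<bar> \<le> c" using bcontinuous_bound[OF \<psi>(1)] by blast
    have [measurable]: "\<psi> \<in> borel_measurable borel" using \<psi>(1) by (rule bcontinuous_measurable)
    have [measurable]: "semigroup P X s \<psi> \<in> borel_measurable borel"
      using bcontinuous_semigroup[OF \<psi>(1) s] by (rule bcontinuous_measurable)
    have S0: "0 \<le> semigroup P X s \<psi> y" for y
      unfolding semigroup_def using \<psi>(2) by simp
    have inner: "ennreal (semigroup P X s \<psi> y) = (\<integral>\<^sup>+v. ennreal (\<psi> (X s v)) \<partial>P y)" for y
      unfolding semigroup_def using \<psi>(2) c
      by (intro nn_integral_eq_integral[symmetric] integrable_bounded[where c = c]) auto
    have "(\<integral>\<^sup>+w. ennreal (indicator B w * \<psi> (X (r w + s) w)) \<partial>P x)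
      = (\<integral>\<^sup>+w. indicator B w * ennreal (\<psi> (X (r w + s) w)) \<partial>P x)"
      by (intro nn_integral_cong) (auto simp: indicator_def)
    also have "\<dots> = (\<integral>\<^sup>+w. indicator B w * ennreal (semigroup P X s \<psi> (X (r w) w)) \<partial>P x)"
      unfolding inner by (rule markov_nn[OF r B s, THEN conjunct2]) measurable
    also have "\<dots> = (\<integral>\<^sup>+w. ennreal (indicator B w * semigroup P X s \<psi> (X (r w) w)) \<partial>P x)"
      by (intro nn_integral_cong) (auto simp: indicator_def)
    finally show ?thesis
      using \<psi>(2) S0 by (simp add: integral_eq_nn_integral)
  qed
  obtain c where c: "c \<ge> 0" "\<And>y. \<bar>\<phi> y\<bar> \<le> c" using bcontinuous_bound[OF \<phi>] by blast
  have [measurable]: "\<phi> \<in> borel_measurable borel" using \<phi> by (rule bcontinuous_measurable)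
  have [measurable]: "semigroup P X s \<phi> \<in> borel_measurable borel"
    using bcontinuous_semigroup[OF \<phi> s] by (rule bcontinuous_measurable)
  \<comment> \<open>Adding the bound \<open>c\<close> reduces to the nonnegative case; the extra
    term \<open>indicator B w * c\<close> is the same on both sides and cancels.\<close>
  have \<psi>: "bcontinuous (\<lambda>y. \<phi> y + c)"
    using \<phi> c by (intro bcontinuous_add) (auto intro: bcontinuousI[of _ c])
  have 1: "0 \<le> \<phi> y + c" for y using c(2)[of y] by linarith
  have 2: "semigroup P X s (\<lambda>y. \<phi> y + c) y = semigroup P X s \<phi> y + c" for y
  proof -
    interpret prob_space "P y" by (rule prob_space_P)
    have "integrable (P y) (\<lambda>w. \<phi> (X s w))" using c by (intro integrable_bounded[where c = c]) auto
    then show ?thesis by (simp add: semigroup_def)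
  qed
  have i1: "integrable (P x) (\<lambda>w. indicator B w * \<phi> (X (r w + s) w))"
    using c by (intro integrable_bounded[where c = c]) (auto simp: indicator_def)
  have i2: "integrable (P x) (\<lambda>w. indicator B w * semigroup P X s \<phi> (X (r w) w))"
    using c semigroup_bound[OF c] by (intro integrable_bounded[where c = c]) (auto simp: indicator_def)
  have i3: "integrable (P x) (\<lambda>w. indicator B w * c)"
    using c by (intro integrable_bounded[where c = c]) (auto simp: indicator_def)
  have "(\<integral>w. indicator B w * \<phi> (X (r w + s) w) + indicator B w * c \<partial>P x) =
    (\<integral>w. indicator B w * semigroup P X s \<phi> (X (r w) w) + indicator B w * c \<partial>P x)"
    using nonneg[OF \<psi> 1] unfolding 2 by (simp add: distrib_left)
  then show ?thesis using i1 i2 i3 by (simp del: integral_mult_left_zero integral_mult_right_zero)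
qed

subsection \<open>Running rewards\<close>

definition area :: "('a \<Rightarrow> real) \<Rightarrow> real \<Rightarrow> 'w \<Rightarrow> real" where
  "area h t w = (\<integral>s. indicator {0..t} s * h (X s w) \<partial>lborel)"

text \<open>The expected running reward over a period \<delta> started at \<open>y\<close>, with
  expectation and time integral already interchanged: in this order continuity in \<open>y\<close>
  follows from that of each \<open>semigroup P X s h\<close>. The half-open interval matches the
  increments in \<open>area_diff\<close>.\<close>

definition step :: "('a \<Rightarrow> real) \<Rightarrow> real \<Rightarrow> 'a \<Rightarrow> real" where
  "step h \<delta> y = (\<integral>s. indicator {0<..\<delta>} s * semigroup P X s h y \<partial>lborel)"

lemma integrable_lborel_bounded:
  fixes k :: "real \<Rightarrow> real"
  assumes "k \<in> borel_measurable borel" "\<And>s. a \<le> s \<Longrightarrow> s \<le> b \<Longrightarrow> \<bar>k s\<bar> \<le> c"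
    and "\<And>s. \<not> (a \<le> s \<and> s \<le> b) \<Longrightarrow> k s = 0"
  shows "integrable lborel k"
proof (rule integrableI_bounded_set[where A = "{a..b}" and B = c])
  show "emeasure lborel {a..b} < \<infinity>" by (cases "a \<le> b") auto
qed (use assms in auto)

lemma integrable_indicator_const: "integrable lborel (\<lambda>s. indicator {0<..b::real} s * (c::real))"
  by (rule integrable_lborel_bounded[of _ 0 b "\<bar>c\<bar>"]) (auto simp: indicator_def)

lemma measurable_path:
  assumes h: "bcontinuous h" and w: "w \<in> space M"
  shows "(\<lambda>s. h (X (max 0 s) w)) \<in> borel_measurable borel"
proof -
  have "(\<lambda>s. (s, w)) \<in> measurable borel (borel \<Otimes>\<^sub>M M)" using w by measurable
  from measurable_compose[OF this measurable_X_pair]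
  have "(\<lambda>s. X (max 0 s) w) \<in> borel_measurable borel" by simp
  then show ?thesis by (rule measurable_compose) (rule bcontinuous_measurable[OF h])
qed

lemma integrable_path:
  assumes h: "bcontinuous h" and w: "w \<in> space M" and "0 \<le> a"
  shows "integrable lborel (\<lambda>s. indicator {a..b} s * h (X s w))"
    and "integrable lborel (\<lambda>s. indicator {a<..b} s * h (X s w))"
proof -
  obtain c where c: "c \<ge> 0" "\<And>y. \<bar>h y\<bar> \<le> c" using bcontinuous_bound[OF h] by blast
  note [measurable] = measurable_path[OF h w]
  have "integrable lborel (\<lambda>s. indicator {a..b} s * h (X (max 0 s) w))"
    using c by (intro integrable_lborel_bounded[of _ a b c]) (auto simp: indicator_def)
  also have "(\<lambda>s. indicator {a..b} s * h (X (max 0 s) w)) = (\<lambda>s. indicator {a..b} s * h (X s w))"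
    using assms by (auto simp: indicator_def fun_eq_iff)
  finally show "integrable lborel (\<lambda>s. indicator {a..b} s * h (X s w))" .
  have "integrable lborel (\<lambda>s. indicator {a<..b} s * h (X (max 0 s) w))"
    using c by (intro integrable_lborel_bounded[of _ a b c]) (auto simp: indicator_def)
  also have "(\<lambda>s. indicator {a<..b} s * h (X (max 0 s) w)) = (\<lambda>s. indicator {a<..b} s * h (X s w))"
    using assms by (auto simp: indicator_def fun_eq_iff)
  finally show "integrable lborel (\<lambda>s. indicator {a<..b} s * h (X s w))" .
qed

lemma area_diff:
  assumes h: "bcontinuous h" and w: "w \<in> space M" and a: "0 \<le> a" "0 \<le> \<delta>"
  shows "area h (a + \<delta>) w - area h a w = (\<integral>s. indicator {0<..\<delta>} s * h (X (a + s) w) \<partial>lborel)"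
proof -
  have "area h (a + \<delta>) w - area h a w =
    (\<integral>s. indicator {0..a + \<delta>} s * h (X s w) - indicator {0..a} s * h (X s w) \<partial>lborel)"
    unfolding area_def by (intro Bochner_Integration.integral_diff[symmetric] integrable_path h w) auto
  also have "\<dots> = (\<integral>s. indicator {a<..a + \<delta>} s * h (X s w) \<partial>lborel)"
    using a by (intro Bochner_Integration.integral_cong) (auto simp: indicator_def)
  also have "\<dots> = (\<integral>s. indicator {a<..a + \<delta>} (a + 1 * s) * h (X (a + 1 * s) w) \<partial>lborel)"
    by (subst lborel_integral_real_affine[of 1 _ a]) auto
  also have "\<dots> = (\<integral>s. indicator {0<..\<delta>} s * h (X (a + s) w) \<partial>lborel)"
    by (intro Bochner_Integration.integral_cong) (auto simp: indicator_def)
  finally show ?thesis .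
qed

lemma area_0: "area h 0 w = 0"
proof -
  have "area h 0 w = (\<integral>s. indicator {0::real} s * h (X 0 w) \<partial>lborel)"
    unfolding area_def by (intro Bochner_Integration.integral_cong) (auto simp: indicator_def)
  also have "\<dots> = 0" by simp
  finally show ?thesis .
qed

lemma area_increment_bound:
  assumes h: "bcontinuous h" "\<And>y. \<bar>h y\<bar> \<le> c" and w: "w \<in> space M" and a: "0 \<le> a" "a \<le> b"
  shows "\<bar>area h b w - area h a w\<bar> \<le> c * (b - a)"
proof -
  note [measurable] = measurable_path[OF h(1) w]
  have "\<bar>area h b w - area h a w\<bar> = \<bar>\<integral>s. indicator {0<..b - a} s * h (X (a + s) w) \<partial>lborel\<bar>"
    using area_diff[OF h(1) w, of a "b - a"] a by simp
  also have "\<dots> \<le> (\<integral>s. \<bar>indicator {0<..b - a} s * h (X (a + s) w)\<bar> \<partial>lborel)" by (rule integral_abs_bound)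
  also have "\<dots> \<le> (\<integral>s. indicator {0<..b - a} s * c \<partial>lborel)"
  proof (rule integral_mono')
    show "integrable lborel (\<lambda>s. indicator {0<..b - a} s * c)" by (rule integrable_indicator_const)
  qed (use h(2) order_trans[OF abs_ge_zero h(2)] in \<open>auto simp: indicator_def\<close>)
  also have "\<dots> = c * (b - a)" using a by simp
  finally show ?thesis .
qed

lemma area_bound:
  assumes "bcontinuous h" "\<And>y. \<bar>h y\<bar> \<le> c" "w \<in> space M" "0 \<le> t"
  shows "\<bar>area h t w\<bar> \<le> c * t"
  using area_increment_bound[OF assms(1-3), of 0 t] assms(4) by (simp add: area_0)

lemma measurable_area:
  assumes h: "bcontinuous h" and [measurable]: "r \<in> borel_measurable M"
  shows "(\<lambda>w. area h (r w) w) \<in> borel_measurable M"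
proof -
  have [measurable]: "h \<in> borel_measurable borel" using h by (rule bcontinuous_measurable)
  have "(\<lambda>q. (snd q, fst q)) \<in> measurable (M \<Otimes>\<^sub>M lborel) (borel \<Otimes>\<^sub>M M)" by measurable
  from measurable_compose[OF this measurable_X_pair]
  have [measurable]: "(\<lambda>q. X (max 0 (snd q)) (fst q)) \<in> borel_measurable (M \<Otimes>\<^sub>M lborel)" by simp
  \<comment> \<open>Only the jointly measurable version \<open>X (max 0 s)\<close> occurs here; it
    agrees with the integrand of \<open>area\<close> because the condition excludes negative
    times.\<close>
  have "(\<lambda>w. \<integral>s. (if 0 \<le> s \<and> s \<le> r w then h (X (max 0 s) w) else 0) \<partial>lborel) \<in> borel_measurable M"
  proof (rule lborel.borel_measurable_lebesgue_integral)
    have "(\<lambda>q. if 0 \<le> snd q \<and> snd q \<le> r (fst q) then h (X (max 0 (snd q)) (fst q)) else 0)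
      \<in> borel_measurable (M \<Otimes>\<^sub>M lborel)" by measurable
    then show "(\<lambda>(w, s). if 0 \<le> s \<and> s \<le> r w then h (X (max 0 s) w) else 0) \<in> borel_measurable (M \<Otimes>\<^sub>M lborel)"
      by (simp add: case_prod_beta)
  qed
  also have "(\<lambda>w. \<integral>s. (if 0 \<le> s \<and> s \<le> r w then h (X (max 0 s) w) else 0) \<partial>lborel) = (\<lambda>w. area h (r w) w)"
    unfolding area_def by (intro ext Bochner_Integration.integral_cong) (auto simp: indicator_def)
  finally show ?thesis .
qed

text \<open>Together with continuity in the starting point, this makes the semigroup jointly
  measurable in time and space, as the Fubini argument in \<open>markov_area\<close>
  requires.\<close>

lemma right_continuous_semigroup:
  assumes h: "bcontinuous h" and t: "t \<ge> 0"
  shows "((\<lambda>s. semigroup P X s h y) \<longlongrightarrow> semigroup P X t h y) (at_right t)"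
  unfolding tendsto_at_iff_sequentially
proof (intro allI impI)
  obtain c where c: "c \<ge> 0" "\<And>y. \<bar>h y\<bar> \<le> c" using bcontinuous_bound[OF h] by blast
  have hm[measurable]: "h \<in> borel_measurable borel" using h by (rule bcontinuous_measurable)
  interpret prob_space "P y" by (rule prob_space_P)
  fix \<sigma> :: "nat \<Rightarrow> real" assume \<sigma>: "\<forall>i. \<sigma> i \<in> {t<..} - {t}" "\<sigma> \<longlonglongrightarrow> t"
  have "(\<lambda>i. \<integral>w. h (X (\<sigma> i) w) \<partial>P y) \<longlonglongrightarrow> (\<integral>w. h (X t w) \<partial>P y)"
  proof (rule integral_dominated_convergence[where w = "\<lambda>_. c"])
    show "(\<lambda>w. h (X t w)) \<in> borel_measurable (P y)"
      using measurable_compose[OF measurable_X[OF t] hm] by simp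
    show "(\<lambda>w. h (X (\<sigma> i) w)) \<in> borel_measurable (P y)" for i
    proof -
      have "\<sigma> i \<ge> 0" using \<sigma>(1)[rule_format, of i] t by simp
      then show ?thesis using measurable_compose[OF measurable_X hm] by simp
    qed
    show "AE w in P y. (\<lambda>i. h (X (\<sigma> i) w)) \<longlonglongrightarrow> h (X t w)"
    proof (rule AE_I2)
      fix w assume "w \<in> space (P y)"
      then have "((\<lambda>s. X s w) \<longlongrightarrow> X t w) (at_right t)" using right_continuous_X t by simp
      then have "(\<lambda>i. X (\<sigma> i) w) \<longlonglongrightarrow> X t w"
        using \<sigma> unfolding tendsto_at_iff_sequentially by (simp add: comp_def)
      then show "(\<lambda>i. h (X (\<sigma> i) w)) \<longlonglongrightarrow> h (X t w)"
        using h by (intro continuous_on_tendsto_compose[where f = h and s = UNIV]) (auto simp: bcontinuous_def)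
    qed
  qed (use c in auto)
  then show "((\<lambda>s. semigroup P X s h y) \<circ> \<sigma>) \<longlonglongrightarrow> semigroup P X t h y"
    by (simp add: semigroup_def comp_def)
qed

text \<open>The criterion for right-continuous paths is reused with the state space in the role of
  the sample space.\<close>

lemma measurable_semigroup_pair:
  assumes h: "bcontinuous h"
  shows "(\<lambda>p. semigroup P X (max 0 (fst p)) h (snd p)) \<in> borel_measurable (borel \<Otimes>\<^sub>M borel)"
  by (rule borel_measurable_right_continuous_pair[of "\<lambda>s. semigroup P X s h"])
     (auto intro: right_continuous_semigroup bcontinuous_measurable bcontinuous_semigroup h)

lemma measurable_semigroup_time:
  assumes h: "bcontinuous h"
  shows "(\<lambda>s. indicator {0<..\<delta>} s * semigroup P X s h y) \<in> borel_measurable borel"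
proof -
  have "(\<lambda>s. (s, y)) \<in> measurable borel (borel \<Otimes>\<^sub>M borel)" by measurable
  from measurable_compose[OF this measurable_semigroup_pair[OF h]]
  have [measurable]: "(\<lambda>s. semigroup P X (max 0 s) h y) \<in> borel_measurable borel" by simp
  have "(\<lambda>s. indicator {0<..\<delta>} s * semigroup P X (max 0 s) h y) \<in> borel_measurable borel" by measurable
  also have "(\<lambda>s. indicator {0<..\<delta>} s * semigroup P X (max 0 s) h y) = (\<lambda>s. indicator {0<..\<delta>} s * semigroup P X s h y)"
    by (auto simp: indicator_def fun_eq_iff)
  finally show ?thesis .
qed

lemma bcontinuous_step:
  assumes h: "bcontinuous h" and \<delta>: "\<delta> \<ge> 0"
  shows "bcontinuous (step h \<delta>)"
proof -
  obtain c where c: "c \<ge> 0" "\<And>y. \<bar>h y\<bar> \<le> c" using bcontinuous_bound[OF h] by blast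
  have bd: "\<bar>indicator {0<..\<delta>} s * semigroup P X s h y\<bar> \<le> indicator {0<..\<delta>} s * c" for s y
    using semigroup_bound[of c h s y] c by (auto simp: indicator_def)
  have int: "integrable lborel (\<lambda>s. indicator {0<..\<delta>} s * c)" by (rule integrable_indicator_const)
  have "\<bar>step h \<delta> y\<bar> \<le> c * \<delta>" for y
  proof -
    have "\<bar>step h \<delta> y\<bar> \<le> (\<integral>s. \<bar>indicator {0<..\<delta>} s * semigroup P X s h y\<bar> \<partial>lborel)"
      unfolding step_def by (rule integral_abs_bound)
    also have "\<dots> \<le> (\<integral>s. indicator {0<..\<delta>} s * c \<partial>lborel)"
      using c by (intro integral_mono' int bd) auto
    finally show ?thesis using \<delta> by (simp add: mult.commute)
  qed
  moreover have "continuous_on UNIV (step h \<delta>)"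
    unfolding continuous_on_sequentially
  proof (intro allI ballI impI)
    fix \<sigma> and y :: 'a assume "(\<forall>n::nat. \<sigma> n \<in> UNIV) \<and> \<sigma> \<longlonglongrightarrow> y"
    then have \<sigma>: "\<sigma> \<longlonglongrightarrow> y" by simp
    have "(\<lambda>i. \<integral>s. indicator {0<..\<delta>} s * semigroup P X s h (\<sigma> i) \<partial>lborel) \<longlonglongrightarrow>
      (\<integral>s. indicator {0<..\<delta>} s * semigroup P X s h y \<partial>lborel)"
    proof (rule integral_dominated_convergence[OF _ _ int])
      show "AE s in lborel. (\<lambda>i. indicator {0<..\<delta>} s * semigroup P X s h (\<sigma> i)) \<longlonglongrightarrow>
        indicator {0<..\<delta>} s * semigroup P X s h y"
      proof (rule AE_I2)
        fix s :: real
        show "(\<lambda>i. indicator {0<..\<delta>} s * semigroup P X s h (\<sigma> i)) \<longlonglongrightarrow> indicator {0<..\<delta>} s * semigroup P X s h y"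
        proof (cases "s > 0")
          case True
          then have "(\<lambda>i. semigroup P X s h (\<sigma> i)) \<longlonglongrightarrow> semigroup P X s h y"
            using continuous_semigroup[OF h, of s] \<sigma>
            by (intro continuous_on_tendsto_compose[where f = "semigroup P X s h" and s = UNIV]) auto
          then show ?thesis by (rule tendsto_mult_left)
        qed simp
      qed
    qed (use bd measurable_semigroup_time[OF h] in auto)
    then show "(step h \<delta> \<circ> \<sigma>) \<longlonglongrightarrow> step h \<delta> y" by (simp add: step_def comp_def)
  qed
  ultimately show ?thesis by (intro bcontinuousI)
qed

text \<open>The integrand is bounded and lives on \<open>space M\<close> times a bounded interval, a
  set of finite product measure.\<close>

lemma fubini_bounded:
  fixes k :: "'w \<Rightarrow> real \<Rightarrow> real"
  assumes meas: "case_prod k \<in> borel_measurable (M \<Otimes>\<^sub>M borel)" and bd: "\<And>w s. \<bar>k w s\<bar> \<le> c"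
  shows "(\<integral>w. (\<integral>s. indicator {0<..\<delta>} s * k w s \<partial>lborel) \<partial>P x) =
    (\<integral>s. indicator {0<..\<delta>} s * (\<integral>w. k w s \<partial>P x) \<partial>lborel)"
proof -
  interpret prob_space "P x" by (rule prob_space_P)
  interpret pair_sigma_finite "P x" lborel ..
  have m: "case_prod k \<in> borel_measurable (P x \<Otimes>\<^sub>M lborel)"
    using meas by (simp add: measurable_cong_sets[OF sets_pair_measure_cong[OF sets_P sets_lborel] refl])
  have "integrable (P x \<Otimes>\<^sub>M lborel) (\<lambda>q. indicator (space M \<times> {0<..\<delta>}) q *\<^sub>R case_prod k q)"
  proof (rule integrableI_bounded_set_indicator[where B = c])
    show S: "space M \<times> {0<..\<delta>} \<in> sets (P x \<Otimes>\<^sub>M lborel)" by (intro pair_measureI) auto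
    have "emeasure (P x \<Otimes>\<^sub>M lborel) (space M \<times> {0<..\<delta>}) = emeasure (P x) (space M) * emeasure lborel {0<..\<delta>}"
      by (intro lborel.emeasure_pair_measure_Times) auto
    also have "\<dots> < \<infinity>" by (cases "0 \<le> \<delta>") (auto simp: ennreal_mult_less_top emeasure_eq_measure)
    finally show "emeasure (P x \<Otimes>\<^sub>M lborel) (space M \<times> {0<..\<delta>}) < \<infinity>" .
  qed (use m bd in auto)
  also have "?this \<longleftrightarrow> integrable (P x \<Otimes>\<^sub>M lborel) (case_prod (\<lambda>w s. indicator {0<..\<delta>} s * k w s))"
    by (intro Bochner_Integration.integrable_cong) (auto simp: space_pair_measure indicator_def)
  finally have "(\<integral>s. (\<integral>w. indicator {0<..\<delta>} s * k w s \<partial>P x) \<partial>lborel) = 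
      (\<integral>w. (\<integral>s. indicator {0<..\<delta>} s * k w s \<partial>lborel) \<partial>P x)"
    by (rule Fubini_integral)
  then show ?thesis by simp
qed

text \<open>Interchanging expectation and time integral leaves the Markov property at each fixed lag
  \<open>s\<close>; interchanging back assembles the semigroup into \<open>step\<close>. The
  truncations \<open>max 0\<close> secure joint measurability and disappear where the indicator is
  nonzero.\<close>

lemma markov_area:
  assumes r: "bstop C r" and B: "B \<in> past r" and \<delta>: "\<delta> \<ge> 0" and h: "bcontinuous h"
  shows "(\<integral>w. indicator B w * (area h (r w + \<delta>) w - area h (r w) w) \<partial>P x) =
    (\<integral>w. indicator B w * step h \<delta> (X (r w) w) \<partial>P x)"
proof -
  note r0 = bstop_nonneg[OF r] and rm[measurable] = bstop_measurable[OF r]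
  have [measurable]: "B \<in> sets M" using B by (rule past_sets)
  have [measurable]: "h \<in> borel_measurable borel" using h by (rule bcontinuous_measurable)
  have X_r [measurable]: "(\<lambda>w. X (r w) w) \<in> borel_measurable M"
    using r0 by (intro measurable_X_at) auto
  obtain c where c: "c \<ge> 0" "\<And>y. \<bar>h y\<bar> \<le> c" using bcontinuous_bound[OF h] by blast
  have "(\<lambda>q. (r (fst q) + snd q, fst q)) \<in> measurable (M \<Otimes>\<^sub>M borel) (borel \<Otimes>\<^sub>M M)" by measurable
  from measurable_compose[OF this measurable_X_pair]
  have m1 [measurable]: "(\<lambda>q. X (max 0 (r (fst q) + snd q)) (fst q)) \<in> borel_measurable (M \<Otimes>\<^sub>M borel)" by simp
  have "(\<lambda>q. (snd q, X (r (fst q)) (fst q))) \<in> measurable (M \<Otimes>\<^sub>M borel) (borel \<Otimes>\<^sub>M borel)"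
    using measurable_compose[OF measurable_fst X_r] by (intro measurable_Pair) auto
  from measurable_compose[OF this measurable_semigroup_pair[OF h]]
  have m2 [measurable]: "(\<lambda>q. semigroup P X (max 0 (snd q)) h (X (r (fst q)) (fst q))) \<in> borel_measurable (M \<Otimes>\<^sub>M borel)"
    by simp
  have "(\<integral>w. indicator B w * (area h (r w + \<delta>) w - area h (r w) w) \<partial>P x)
    = (\<integral>w. (\<integral>s. indicator {0<..\<delta>} s * (indicator B w * h (X (max 0 (r w + s)) w)) \<partial>lborel) \<partial>P x)"
  proof (intro Bochner_Integration.integral_cong refl)
    fix w assume "w \<in> space (P x)"
    then have w: "w \<in> space M" by simp
    have "indicator B w * (area h (r w + \<delta>) w - area h (r w) w) =
      (\<integral>s. indicator B w * (indicator {0<..\<delta>} s * h (X (r w + s) w)) \<partial>lborel)"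
      using area_diff[OF h w r0[OF w] \<delta>] by simp
    also have "\<dots> = (\<integral>s. indicator {0<..\<delta>} s * (indicator B w * h (X (max 0 (r w + s)) w)) \<partial>lborel)"
      using r0[OF w] by (intro Bochner_Integration.integral_cong) (auto simp: indicator_def)
    finally show "indicator B w * (area h (r w + \<delta>) w - area h (r w) w) =
      (\<integral>s. indicator {0<..\<delta>} s * (indicator B w * h (X (max 0 (r w + s)) w)) \<partial>lborel)" .
  qed
  also have "\<dots> = (\<integral>s. indicator {0<..\<delta>} s * (\<integral>w. indicator B w * h (X (max 0 (r w + s)) w) \<partial>P x) \<partial>lborel)"
  proof (rule fubini_bounded[where c = c])
    show "\<bar>indicator B w * h (X (max 0 (r w + s)) w)\<bar> \<le> c" for w s
      using c by (auto simp: indicator_def)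
    have "(\<lambda>q. indicator B (fst q) * h (X (max 0 (r (fst q) + snd q)) (fst q))) \<in> borel_measurable (M \<Otimes>\<^sub>M borel)"
      by measurable
    then show "(\<lambda>(w, s). indicator B w * h (X (max 0 (r w + s)) w)) \<in> borel_measurable (M \<Otimes>\<^sub>M borel)"
      by (simp add: case_prod_beta)
  qed
  also have "\<dots> = (\<integral>s. indicator {0<..\<delta>} s * (\<integral>w. indicator B w * semigroup P X (max 0 s) h (X (r w) w) \<partial>P x) \<partial>lborel)"
  proof (intro Bochner_Integration.integral_cong refl)
    fix s :: real
    show "indicator {0<..\<delta>} s * (\<integral>w. indicator B w * h (X (max 0 (r w + s)) w) \<partial>P x) =
      indicator {0<..\<delta>} s * (\<integral>w. indicator B w * semigroup P X (max 0 s) h (X (r w) w) \<partial>P x)"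
    proof (cases "s \<in> {0<..\<delta>}")
      case True
      have "(\<integral>w. indicator B w * h (X (max 0 (r w + s)) w) \<partial>P x) = (\<integral>w. indicator B w * h (X (r w + s) w) \<partial>P x)"
        using True r0 by (intro Bochner_Integration.integral_cong) (auto simp: max_def add_nonneg_nonneg)
      then show ?thesis using markov_bcontinuous[OF r B, of s h x] True h by simp
    qed simp
  qed
  also have "\<dots> = (\<integral>w. (\<integral>s. indicator {0<..\<delta>} s * (indicator B w * semigroup P X (max 0 s) h (X (r w) w)) \<partial>lborel) \<partial>P x)"
  proof (rule fubini_bounded[where c = c, symmetric])
    show "\<bar>indicator B w * semigroup P X (max 0 s) h (X (r w) w)\<bar> \<le> c" for w s
      using c semigroup_bound[OF c] by (auto simp: indicator_def)
    have "(\<lambda>q. indicator B (fst q) * semigroup P X (max 0 (snd q)) h (X (r (fst q)) (fst q))) \<in> borel_measurable (M \<Otimes>\<^sub>M borel)"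
      by measurable
    then show "(\<lambda>(w, s). indicator B w * semigroup P X (max 0 s) h (X (r w) w)) \<in> borel_measurable (M \<Otimes>\<^sub>M borel)"
      by (simp add: case_prod_beta)
  qed
  also have "\<dots> = (\<integral>w. indicator B w * step h \<delta> (X (r w) w) \<partial>P x)"
  proof (intro Bochner_Integration.integral_cong refl)
    fix w
    have "(\<integral>s. indicator {0<..\<delta>} s * (indicator B w * semigroup P X (max 0 s) h (X (r w) w)) \<partial>lborel) =
      (\<integral>s. indicator B w * (indicator {0<..\<delta>} s * semigroup P X s h (X (r w) w)) \<partial>lborel)"
      by (intro Bochner_Integration.integral_cong) (auto simp: indicator_def)
    then show "(\<integral>s. indicator {0<..\<delta>} s * (indicator B w * semigroup P X (max 0 s) h (X (r w) w)) \<partial>lborel) =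
      indicator B w * step h \<delta> (X (r w) w)" by (simp add: step_def)
  qed
  finally show ?thesis .
qed

text \<open>Equality \<open>\<sigma> n = t\<close> has to be allowed, since an approximating grid
  may hit the limit time exactly.\<close>

lemma right_continuous_X_sequentially:
  assumes w: "w \<in> space M" and t: "0 \<le> t" "\<And>n. t \<le> \<sigma> n" "\<sigma> \<longlonglongrightarrow> t"
  shows "(\<lambda>n. X (\<sigma> n) w) \<longlonglongrightarrow> X t w"
proof -
  have "continuous (at t within {t..}) (\<lambda>s. X s w)"
    using right_continuous_X[OF w t(1)] by (simp add: continuous_within at_within_Ici_at_right)
  then show ?thesis
    unfolding continuous_within_sequentially using t by (auto simp: comp_def)
qed

lemma measurable_gain:
  assumes h: "bcontinuous h" and \<phi>: "bcontinuous \<phi>" and [measurable]: "r \<in> borel_measurable M" "s \<in> borel_measurable M"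
    and "\<And>w. w \<in> space M \<Longrightarrow> 0 \<le> s w"
  shows "(\<lambda>w. area h (s w) w - area h (r w) w + \<phi> (X (s w) w)) \<in> borel_measurable M"
  using measurable_area[OF h, of r] measurable_area[OF h, of s] bcontinuous_X[OF \<phi>, of s] assms by simp

lemma gain_bound:
  assumes h: "bcontinuous h" "\<And>y. \<bar>h y\<bar> \<le> a" and \<phi>: "\<And>y. \<bar>\<phi> y\<bar> \<le> c"
    and w: "w \<in> space M" "0 \<le> r" "r \<le> s" "s \<le> D"
  shows "\<bar>area h s w - area h r w + \<phi> (X s w)\<bar> \<le> a * D + c"
proof -
  have "0 \<le> a" using h(2) abs_ge_zero order_trans by blast
  then have "a * (s - r) \<le> a * D" using w by (intro mult_left_mono) auto
  then show ?thesis using area_increment_bound[OF h w(1,2,3)] \<phi>[of "X s w"] by linarith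
qed

lemma integrable_gain:
  assumes h: "bcontinuous h" and \<phi>: "bcontinuous \<phi>" and r: "bstop C r" and s: "bstop D s"
    and le: "\<And>w. w \<in> space M \<Longrightarrow> r w \<le> s w" and B: "B \<in> sets M"
  shows "integrable (P x) (\<lambda>w. indicator B w * (area h (s w) w - area h (r w) w + \<phi> (X (s w) w)))"
proof -
  obtain a where a: "\<And>y. \<bar>h y\<bar> \<le> a" using bcontinuous_bound[OF h] by blast
  obtain c where c: "\<And>y. \<bar>\<phi> y\<bar> \<le> c" using bcontinuous_bound[OF \<phi>] by blast
  have [measurable]: "(\<lambda>w. area h (s w) w - area h (r w) w + \<phi> (X (s w) w)) \<in> borel_measurable M"
    using bstop_measurable[OF r] bstop_measurable[OF s] bstop_nonneg[OF s] by (intro measurable_gain h \<phi>)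
  show ?thesis
  proof (rule integrable_bounded[where c = "\<bar>a * D + c\<bar>"])
    show "\<bar>indicator B w * (area h (s w) w - area h (r w) w + \<phi> (X (s w) w))\<bar> \<le> \<bar>a * D + c\<bar>"
      if w: "w \<in> space M" for w
    proof -
      have "\<bar>area h (s w) w - area h (r w) w + \<phi> (X (s w) w)\<bar> \<le> a * D + c"
        by (rule gain_bound) (use h a c w bstop_nonneg[OF r w] le[OF w] bstop_bound[OF s w] in auto)
      then show ?thesis by (auto simp: indicator_def)
    qed
  qed (use B in measurable)
qed

lemma integrable_at:
  assumes \<phi>: "bcontinuous \<phi>" and r: "bstop C r" and B: "B \<in> sets M"
  shows "integrable (P x) (\<lambda>w. indicator B w * \<phi> (X (r w) w))"
  \<comment> \<open>With both times equal to \<open>r\<close> the areas cancel; \<phi> merely fills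
    the place of the running reward.\<close>
  using integrable_gain[OF \<phi> \<phi> r r _ B] by simp

end

subsection \<open>Approximations of the value function\<close>

locale stopping_problem = feller_process M P X
  for M :: "'w measure" and P :: "'a::{heine_borel, second_countable_topology} \<Rightarrow> 'w measure"
    and X :: "real \<Rightarrow> 'w \<Rightarrow> 'a" +
  fixes f g :: "'a \<Rightarrow> real"
  assumes f: "bcontinuous f" and g: "bcontinuous g"
begin

text \<open>Localising to every \<open>B \<in> past r\<close> is what allows optimal times to be pasted together in
  \<open>attainable_max\<close>.\<close>
definition attains :: "('a \<Rightarrow> real) \<Rightarrow> ('w \<Rightarrow> real) \<Rightarrow> real \<Rightarrow> ('w \<Rightarrow> real) \<Rightarrow> bool" where
  "attains \<phi> r D s \<longleftrightarrow> bstop D s \<and> (\<forall>w\<in>space M. r w \<le> s w) \<and>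
     (\<forall>x. \<forall>B\<in>past r. (\<integral>w. indicator B w * \<phi> (X (r w) w) \<partial>P x) \<le>
        (\<integral>w. indicator B w * (area f (s w) w - area f (r w) w + g (X (s w) w)) \<partial>P x))"

lemma attainsD:
  assumes "attains \<phi> r D s"
  shows "bstop D s" "\<And>w. w \<in> space M \<Longrightarrow> r w \<le> s w"
    "\<And>x B. B \<in> past r \<Longrightarrow> (\<integral>w. indicator B w * \<phi> (X (r w) w) \<partial>P x) \<le>
        (\<integral>w. indicator B w * (area f (s w) w - area f (r w) w + g (X (s w) w)) \<partial>P x)"
  using assms unfolding attains_def by simp_all

text \<open>Quantifying over all starting times \<open>r\<close> lets a time that attains \<phi>
  from \<open>r + \<delta>\<close> be used in building one from \<open>r\<close>.\<close>

definition attainable :: "('a \<Rightarrow> real) \<Rightarrow> bool" where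
  "attainable \<phi> \<longleftrightarrow> bcontinuous \<phi> \<and> (\<forall>C r. bstop C r \<longrightarrow> (\<exists>D s. attains \<phi> r D s))"

lemma attainableE:
  assumes "attainable \<phi>" "bstop C r"
  obtains D s where "attains \<phi> r D s"
  using assms unfolding attainable_def by blast

lemma attainable_g: "attainable g"
  unfolding attainable_def
proof (intro conjI allI impI g)
  fix C r assume "bstop C r"
  then show "\<exists>D s. attains g r D s"
    unfolding attains_def by (intro exI[of _ C] exI[of _ r]) simp
qed

text \<open>Follow the time for \<psi> where \<open>\<phi> < \<psi>\<close> at the position at time
  \<open>r\<close>, and the time for \<phi> elsewhere. This event \<open>E\<close> is known at
  \<open>r\<close> and both times are at least \<open>r\<close>, so the pasted time is a stopping
  time; the inequalities on \<open>B \<inter> E\<close> and on \<open>B - E\<close> add up.\<close>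

lemma attainable_max:
  assumes \<phi>: "attainable \<phi>" and \<psi>: "attainable \<psi>"
  shows "attainable (\<lambda>y. max (\<phi> y) (\<psi> y))"
  unfolding attainable_def
proof (intro conjI allI impI)
  have b\<phi>: "bcontinuous \<phi>" and b\<psi>: "bcontinuous \<psi>" using assms by (auto simp: attainable_def)
  show "bcontinuous (\<lambda>y. max (\<phi> y) (\<psi> y))" by (intro bcontinuous_max b\<phi> b\<psi>)
  fix C r assume r: "bstop C r"
  obtain D1 s1 where ats1: "attains \<phi> r D1 s1" by (rule attainableE[OF \<phi> r])
  note s1 = attainsD[OF ats1]
  obtain D2 s2 where ats2: "attains \<psi> r D2 s2" by (rule attainableE[OF \<psi> r])
  note s2 = attainsD[OF ats2]
  define E where "E = {w \<in> space M. X (r w) w \<in> {y. \<phi> y < \<psi> y}}"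
  have "{y. \<phi> y < \<psi> y} \<in> sets borel"
    using b\<phi> b\<psi> by (intro borel_open open_Collect_less) (auto simp: bcontinuous_def)
  then have E: "E \<in> past r" unfolding E_def by (rule past_X[OF r])
  have E': "space M - E \<in> past r" by (rule past_compl[OF r E])
  define s where "s w = (if w \<in> E then s2 w else s1 w)" for w
  have s: "bstop (max D1 D2) s"
    unfolding bstop_def
  proof (intro conjI ballI allI impI)
    fix w assume w: "w \<in> space M"
    show "0 \<le> s w" using bstop_nonneg[OF s1(1) w] bstop_nonneg[OF s2(1) w] by (simp add: s_def)
    show "s w \<le> max D1 D2" using bstop_bound[OF s1(1) w] bstop_bound[OF s2(1) w] by (auto simp: s_def)
  next
    fix t :: real assume t: "t \<ge> 0"
    interpret sigma_algebra "space M" "filt M P X t" by (rule sigma_algebra_filt)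
    have "E \<inter> {w \<in> space M. s2 w \<le> t} \<union> (space M - E) \<inter> {w \<in> space M. s1 w \<le> t} \<in> filt M P X t"
      using past_filt[OF past_mono[OF s2(1,2) E] t] past_filt[OF past_mono[OF s1(1,2) E'] t] by (rule Un)
    also have "E \<inter> {w \<in> space M. s2 w \<le> t} \<union> (space M - E) \<inter> {w \<in> space M. s1 w \<le> t} = {w \<in> space M. s w \<le> t}"
      by (auto simp: s_def)
    finally show "{w \<in> space M. s w \<le> t} \<in> filt M P X t" .
  qed
  have rs: "r w \<le> s w" if "w \<in> space M" for w using s1(2) s2(2) that by (simp add: s_def)
  show "\<exists>D s. attains (\<lambda>y. max (\<phi> y) (\<psi> y)) r D s"
  unfolding attains_def
  proof (intro exI conjI allI ballI)
    show "bstop (max D1 D2) s" by (rule s)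
    show "r w \<le> s w" if "w \<in> space M" for w using that by (rule rs)
    fix x B assume B: "B \<in> past r"
    have BE: "B \<inter> E \<in> past r" "B \<inter> (space M - E) \<in> past r" by (rule past_Int[OF B E]) (rule past_Int[OF B E'])
    have "(\<integral>w. indicator B w * max (\<phi> (X (r w) w)) (\<psi> (X (r w) w)) \<partial>P x)
      = (\<integral>w. indicator (B \<inter> E) w * \<psi> (X (r w) w) + indicator (B \<inter> (space M - E)) w * \<phi> (X (r w) w) \<partial>P x)"
      by (intro Bochner_Integration.integral_cong) (auto simp: E_def indicator_def)
    also have "\<dots> = (\<integral>w. indicator (B \<inter> E) w * \<psi> (X (r w) w) \<partial>P x) +
        (\<integral>w. indicator (B \<inter> (space M - E)) w * \<phi> (X (r w) w) \<partial>P x)"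
      by (rule Bochner_Integration.integral_add[OF integrable_at[OF b\<psi> r past_sets[OF BE(1)]]
            integrable_at[OF b\<phi> r past_sets[OF BE(2)]]])
    also have "\<dots> \<le> (\<integral>w. indicator (B \<inter> E) w * (area f (s2 w) w - area f (r w) w + g (X (s2 w) w)) \<partial>P x)
      + (\<integral>w. indicator (B \<inter> (space M - E)) w * (area f (s1 w) w - area f (r w) w + g (X (s1 w) w)) \<partial>P x)"
      by (rule add_mono[OF s2(3)[OF BE(1)] s1(3)[OF BE(2)]])
    also have "\<dots> = (\<integral>w. indicator (B \<inter> E) w * (area f (s2 w) w - area f (r w) w + g (X (s2 w) w))
      + indicator (B \<inter> (space M - E)) w * (area f (s1 w) w - area f (r w) w + g (X (s1 w) w)) \<partial>P x)"
      by (rule Bochner_Integration.integral_add[OF integrable_gain[OF f g r s2(1,2) past_sets[OF BE(1)]]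
            integrable_gain[OF f g r s1(1,2) past_sets[OF BE(2)]], symmetric])
    also have "\<dots> = (\<integral>w. indicator B w * (area f (s w) w - area f (r w) w + g (X (s w) w)) \<partial>P x)"
      by (intro Bochner_Integration.integral_cong) (auto simp: s_def indicator_def)
    finally show "(\<integral>w. indicator B w * max (\<phi> (X (r w) w)) (\<psi> (X (r w) w)) \<partial>P x) \<le>
        (\<integral>w. indicator B w * (area f (s w) w - area f (r w) w + g (X (s w) w)) \<partial>P x)" .
  qed
qed

text \<open>Wait for \<delta>, then follow a time that attains \<phi> from
  \<open>r + \<delta>\<close>. The Markov property identifies the reward of the waiting period with
  \<open>step f \<delta>\<close> and the mean of \<phi> after it with the semigroup.\<close>

lemma attainable_step:
  assumes \<phi>: "attainable \<phi>" and \<delta>: "\<delta> \<ge> 0"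
  shows "attainable (\<lambda>y. step f \<delta> y + semigroup P X \<delta> \<phi> y)"
  unfolding attainable_def
proof (intro conjI allI impI)
  have b\<phi>: "bcontinuous \<phi>" using assms by (auto simp: attainable_def)
  have bf: "bcontinuous (step f \<delta>)" by (rule bcontinuous_step[OF f \<delta>])
  have bs: "bcontinuous (semigroup P X \<delta> \<phi>)" by (rule bcontinuous_semigroup[OF b\<phi> \<delta>])
  show "bcontinuous (\<lambda>y. step f \<delta> y + semigroup P X \<delta> \<phi> y)" by (intro bcontinuous_add bf bs)
  fix C r assume r: "bstop C r"
  let ?r = "\<lambda>w. r w + \<delta>"
  have r': "bstop (C + \<delta>) ?r" by (rule bstop_add[OF r \<delta>])
  obtain D s where ats: "attains \<phi> ?r D s" by (rule attainableE[OF \<phi> r'])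
  note s = attainsD[OF ats]
  have rs: "r w \<le> s w" if "w \<in> space M" for w using s(2)[OF that] \<delta> by linarith
  show "\<exists>D s. attains (\<lambda>y. step f \<delta> y + semigroup P X \<delta> \<phi> y) r D s"
  unfolding attains_def
  proof (intro exI conjI allI ballI)
    show "bstop D s" by (rule s)
    show "r w \<le> s w" if "w \<in> space M" for w using that by (rule rs)
    fix x B assume B: "B \<in> past r"
    have B': "B \<in> past ?r" using \<delta> by (intro past_mono[OF r' _ B]) auto
    have BM: "B \<in> sets M" by (rule past_sets[OF B])
    \<comment> \<open>The zero terminal reward turns \<open>integrable_gain\<close> into
      integrability of a bare increment of \<open>area\<close>.\<close>
    have z: "bcontinuous (\<lambda>_::'a. 0)" by (rule bcontinuousI[of _ 0]) auto
    have i1: "integrable (P x) (\<lambda>w. indicator B w * (area f (r w + \<delta>) w - area f (r w) w))"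
      using integrable_gain[OF f z r r' _ BM] \<delta> by simp
    have "(\<integral>w. indicator B w * (step f \<delta> (X (r w) w) + semigroup P X \<delta> \<phi> (X (r w) w)) \<partial>P x)
      = (\<integral>w. indicator B w * step f \<delta> (X (r w) w) + indicator B w * semigroup P X \<delta> \<phi> (X (r w) w) \<partial>P x)"
      by (simp add: distrib_left)
    also have "\<dots> = (\<integral>w. indicator B w * step f \<delta> (X (r w) w) \<partial>P x) +
        (\<integral>w. indicator B w * semigroup P X \<delta> \<phi> (X (r w) w) \<partial>P x)"
      by (intro Bochner_Integration.integral_add integrable_at[OF bf r BM] integrable_at[OF bs r BM])
    also have "\<dots> = (\<integral>w. indicator B w * (area f (r w + \<delta>) w - area f (r w) w) \<partial>P x) +
        (\<integral>w. indicator B w * \<phi> (X (r w + \<delta>) w) \<partial>P x)"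
      using markov_area[OF r B \<delta> f, of x] markov_bcontinuous[OF r B \<delta> b\<phi>, of x] by simp
    also have "\<dots> \<le> (\<integral>w. indicator B w * (area f (r w + \<delta>) w - area f (r w) w) \<partial>P x) +
        (\<integral>w. indicator B w * (area f (s w) w - area f (r w + \<delta>) w + g (X (s w) w)) \<partial>P x)"
      by (intro add_left_mono s(3) B')
    also have "\<dots> = (\<integral>w. indicator B w * (area f (r w + \<delta>) w - area f (r w) w) +
        indicator B w * (area f (s w) w - area f (r w + \<delta>) w + g (X (s w) w)) \<partial>P x)"
      by (intro Bochner_Integration.integral_add[symmetric] i1 integrable_gain[OF f g r' s(1,2) BM])
    also have "\<dots> = (\<integral>w. indicator B w * (area f (s w) w - area f (r w) w + g (X (s w) w)) \<partial>P x)"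
      by (intro Bochner_Integration.integral_cong refl) (simp add: algebra_simps)
    finally show "(\<integral>w. indicator B w * (step f \<delta> (X (r w) w) + semigroup P X \<delta> \<phi> (X (r w) w)) \<partial>P x) \<le>
        (\<integral>w. indicator B w * (area f (s w) w - area f (r w) w + g (X (s w) w)) \<partial>P x)" .
  qed
qed

text \<open>Every alternative continues with the same \<phi> rather than with
  \<open>refine \<phi> k\<close>: the step lengths compete in parallel, so each of the one-step
  inequalities has \<phi> itself under the semigroup.\<close>

primrec refine :: "('a \<Rightarrow> real) \<Rightarrow> nat \<Rightarrow> 'a \<Rightarrow> real" where
  "refine \<phi> 0 = \<phi>"
| "refine \<phi> (Suc k) = (\<lambda>y. max (refine \<phi> k y)
    (step f (inverse (real (Suc k))) y + semigroup P X (inverse (real (Suc k))) \<phi> y))"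

text \<open>Stage \<open>n\<close> uses all step lengths \<open>1, 1/2, \<dots>, 1/n\<close>, so a single increasing sequence eventually
  dominates the dynamic programming recursion on every grid of mesh \<open>1/k\<close>.\<close>
primrec approx_value :: "nat \<Rightarrow> 'a \<Rightarrow> real" where
  "approx_value 0 = g"
| "approx_value (Suc n) = refine (approx_value n) (Suc n)"

lemma refine_ge: "\<phi> y \<le> refine \<phi> k y"
  by (induction k) auto

lemma refine_ge_step:
  "k < m \<Longrightarrow> step f (inverse (real (Suc k))) y + semigroup P X (inverse (real (Suc k))) \<phi> y \<le> refine \<phi> m y"
  by (induction m) (auto simp: less_Suc_eq)

lemma attainable_approx_value: "attainable (approx_value n)"
proof (induction n)
  case (Suc n)
  have "attainable (refine (approx_value n) k)" for k
  proof (induction k)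
    case (Suc k)
    have "attainable (\<lambda>y. step f (inverse (real (Suc k))) y + semigroup P X (inverse (real (Suc k))) (approx_value n) y)"
      by (intro attainable_step \<open>attainable (approx_value n)\<close>) simp
    from attainable_max[OF Suc this] show ?case by (simp only: refine.simps)
  qed (use Suc in simp)
  then show ?case by (simp only: approx_value.simps)
qed (simp add: attainable_g)

lemma bcontinuous_approx_value: "bcontinuous (approx_value n)"
  using attainable_approx_value by (simp add: attainable_def)

lemma approx_value_mono: "m \<le> n \<Longrightarrow> approx_value m y \<le> approx_value n y"
  by (rule lift_Suc_mono_le[of "\<lambda>n. approx_value n y"])
     (simp_all only: approx_value.simps refine_ge)

lemma approx_value_ge_g: "g y \<le> approx_value n y"
  using approx_value_mono[of 0 n y] by simp

text \<open>A fixed step length is available at all sufficiently late stages, and each step then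
  costs one stage.\<close>

lemma approx_value_ge_step:
  assumes "k \<le> n"
  shows "step f (inverse (real (Suc k))) y + semigroup P X (inverse (real (Suc k))) (approx_value n) y
    \<le> approx_value (Suc n) y"
  unfolding approx_value.simps(2) using assms by (intro refine_ge_step) simp

text \<open>The grid \<open>r + j * \<delta>\<close> starts at the random time \<open>r\<close>, and \<open>r + J * \<delta>\<close> is its first point at or
  after \<open>s\<close>.\<close>
lemma chain_supermartingale:
  assumes \<delta>: "\<delta> > 0" and u: "\<And>j. bcontinuous (u j)"
    and u_step: "\<And>j y. j < N \<Longrightarrow> step f \<delta> y + semigroup P X \<delta> (u (Suc j)) y \<le> u j y"
    and r: "bstop C r" and s: "bstop D s" and D: "D \<le> real N * \<delta>" and B: "B \<in> past r"
  defines "J \<equiv> \<lambda>w. nat \<lceil>(s w - r w) / \<delta>\<rceil>"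
  shows "integrable (P x) (\<lambda>w. indicator B w * (area f (r w + real (J w) * \<delta>) w - area f (r w) w
      + u (J w) (X (r w + real (J w) * \<delta>) w)))" (is "integrable _ (\<lambda>w. ?Z w)")
    and "(\<integral>w. indicator B w * (area f (r w + real (J w) * \<delta>) w - area f (r w) w
      + u (J w) (X (r w + real (J w) * \<delta>) w)) \<partial>P x) \<le> (\<integral>w. indicator B w * u 0 (X (r w) w) \<partial>P x)"
proof -
  \<comment> \<open>Stopping the index at \<open>J\<close> makes \<open>Y\<close> the reward process
    along the grid, frozen at the first grid point at or after \<open>s\<close>.\<close>
  define K where "K n w = min n (J w)" for n w
  define Y where "Y n w = indicator B w * (area f (r w + real (K n w) * \<delta>) w - area f (r w) w
      + u (K n w) (X (r w + real (K n w) * \<delta>) w))" for n w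
  have BM: "B \<in> sets M" by (rule past_sets[OF B])
  have Y_le: "integrable (P x) (Y n) \<and> (\<integral>w. Y n w \<partial>P x) \<le> (\<integral>w. indicator B w * u 0 (X (r w) w) \<partial>P x)"
    if "n \<le> N" for n
    using that
  proof (induction n)
    case 0
    have "Y 0 = (\<lambda>w. indicator B w * u 0 (X (r w) w))" by (simp add: Y_def K_def fun_eq_iff)
    then show ?case using integrable_at[OF u r BM] by simp
  next
    case (Suc n)
    let ?r = "\<lambda>w. r w + real n * \<delta>"
    have nd: "0 \<le> real n * \<delta>" using \<delta> by simp
    have r': "bstop (C + real n * \<delta>) ?r" by (rule bstop_add[OF r nd])
    have r'': "bstop (C + real n * \<delta> + \<delta>) (\<lambda>w. ?r w + \<delta>)" using \<delta> by (intro bstop_add[OF r']) simp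
    \<comment> \<open>Within \<open>B\<close>, \<open>Y\<close> moves at step \<open>n\<close> only
      on this event. It is known at the current grid time, so the Markov property may be localised
      to it.\<close>
    define A where "A = B \<inter> {w \<in> space M. ?r w < s w}"
    have A: "A \<in> past ?r"
      unfolding A_def using nd by (intro past_Int past_less[OF r' s] past_mono[OF r' _ B]) auto
    have AM: "A \<in> sets M" by (rule past_sets[OF A])
    \<comment> \<open>Rounding up in \<open>J\<close> makes the grid continue precisely while it is
      strictly before \<open>s\<close>.\<close>
    have J_gt: "n < J w \<longleftrightarrow> ?r w < s w" for w
      unfolding J_def using \<delta> by (simp add: zless_nat_eq_int_zless less_ceiling_iff pos_less_divide_eq algebra_simps)
    define Z where "Z w = indicator A w * (area f (?r w + \<delta>) w - area f (?r w) w + u (Suc n) (X (?r w + \<delta>) w))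
        - indicator A w * u n (X (?r w) w)" for w
    have Y_Suc: "Y (Suc n) w = Y n w + Z w" if "w \<in> space M" for w
    proof (cases "w \<in> A")
      case True
      then have "w \<in> B" "K n w = n" "K (Suc n) w = Suc n" using J_gt[of w] by (auto simp: A_def K_def)
      then show ?thesis using True by (simp add: Y_def Z_def algebra_simps)
    next
      case False
      then have "w \<notin> B \<or> K n w = K (Suc n) w" using J_gt[of w] that by (auto simp: A_def K_def min_def)
      then show ?thesis using False by (auto simp: Y_def Z_def)
    qed
    have i1: "integrable (P x) (\<lambda>w. indicator A w * (area f (?r w + \<delta>) w - area f (?r w) w + u (Suc n) (X (?r w + \<delta>) w)))"
      using \<delta> by (intro integrable_gain[OF f u r' r'' _ AM]) simp
    have i2: "integrable (P x) (\<lambda>w. indicator A w * u n (X (?r w) w))"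
      by (rule integrable_at[OF u r' AM])
    have iZ: "integrable (P x) Z" unfolding Z_def by (intro Bochner_Integration.integrable_diff i1 i2)
    have z: "bcontinuous (\<lambda>_::'a. 0)" by (rule bcontinuousI[of _ 0]) auto
    have i3: "integrable (P x) (\<lambda>w. indicator A w * (area f (?r w + \<delta>) w - area f (?r w) w))"
      using integrable_gain[OF f z r' r'' _ AM] \<delta> by simp
    have i4: "integrable (P x) (\<lambda>w. indicator A w * u (Suc n) (X (?r w + \<delta>) w))"
      by (rule integrable_at[OF u r'' AM])
    have bf: "bcontinuous (step f \<delta>)" and bs: "bcontinuous (semigroup P X \<delta> (u (Suc n)))"
      using \<delta> f u by (auto intro: bcontinuous_step bcontinuous_semigroup)
    have i5: "integrable (P x) (\<lambda>w. indicator A w * step f \<delta> (X (?r w) w))"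
      and i6: "integrable (P x) (\<lambda>w. indicator A w * semigroup P X \<delta> (u (Suc n)) (X (?r w) w))"
      by (intro integrable_at[OF _ r' AM] bf bs)+
    have "(\<integral>w. indicator A w * (area f (?r w + \<delta>) w - area f (?r w) w + u (Suc n) (X (?r w + \<delta>) w)) \<partial>P x)
      = (\<integral>w. indicator A w * (area f (?r w + \<delta>) w - area f (?r w) w) \<partial>P x) +
        (\<integral>w. indicator A w * u (Suc n) (X (?r w + \<delta>) w) \<partial>P x)"
      unfolding distrib_left by (intro Bochner_Integration.integral_add i3 i4)
    also have "\<dots> = (\<integral>w. indicator A w * step f \<delta> (X (?r w) w) \<partial>P x) +
        (\<integral>w. indicator A w * semigroup P X \<delta> (u (Suc n)) (X (?r w) w) \<partial>P x)"
      using markov_area[OF r' A _ f] markov_bcontinuous[OF r' A _ u] \<delta> by simp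
    also have "\<dots> = (\<integral>w. indicator A w * step f \<delta> (X (?r w) w) +
        indicator A w * semigroup P X \<delta> (u (Suc n)) (X (?r w) w) \<partial>P x)"
      by (intro Bochner_Integration.integral_add[symmetric] i5 i6)
    also have "\<dots> \<le> (\<integral>w. indicator A w * u n (X (?r w) w) \<partial>P x)"
    proof (rule integral_mono)
      show "indicator A w * step f \<delta> (X (?r w) w) + indicator A w * semigroup P X \<delta> (u (Suc n)) (X (?r w) w)
        \<le> indicator A w * u n (X (?r w) w)" for w
        using u_step[of n "X (?r w) w"] Suc.prems by (auto simp: indicator_def)
    qed (intro Bochner_Integration.integrable_add i2 i5 i6)+
    finally have "(\<integral>w. Z w \<partial>P x) \<le> 0"
      unfolding Z_def using i1 i2 by (simp add: Bochner_Integration.integral_diff)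
    moreover have IH: "integrable (P x) (Y n)" "(\<integral>w. Y n w \<partial>P x) \<le> (\<integral>w. indicator B w * u 0 (X (r w) w) \<partial>P x)"
      using Suc by auto
    moreover have "(\<integral>w. Y (Suc n) w \<partial>P x) = (\<integral>w. Y n w \<partial>P x) + (\<integral>w. Z w \<partial>P x)"
    proof -
      have "(\<integral>w. Y (Suc n) w \<partial>P x) = (\<integral>w. Y n w + Z w \<partial>P x)"
        by (intro Bochner_Integration.integral_cong refl) (simp add: Y_Suc)
      then show ?thesis using Bochner_Integration.integral_add[OF IH(1) iZ] by simp
    qed
    moreover have "integrable (P x) (Y (Suc n))"
    proof -
      have "integrable (P x) (Y (Suc n)) \<longleftrightarrow> integrable (P x) (\<lambda>w. Y n w + Z w)"
        by (intro Bochner_Integration.integrable_cong refl) (simp add: Y_Suc)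
      then show ?thesis using Bochner_Integration.integrable_add[OF IH(1) iZ] by simp
    qed
    ultimately show ?case by simp
  qed
  \<comment> \<open>The hypothesis \<open>D \<le> real N * \<delta>\<close> ensures that
    \<open>N\<close> steps reach \<open>s\<close>, so \<open>Y N\<close> is completely
    stopped.\<close>
  have "J w \<le> N" if w: "w \<in> space M" for w
  proof -
    have "(s w - r w) / \<delta> \<le> real N"
      using bstop_bound[OF s w] bstop_nonneg[OF r w] D \<delta> by (simp add: pos_divide_le_eq)
    then show ?thesis unfolding J_def by (simp add: ceiling_le_iff nat_le_iff)
  qed
  then have Y_N: "Y N w = ?Z w" if "w \<in> space M" for w
    using that by (simp add: Y_def K_def min_absorb2)
  have "integrable (P x) ?Z \<longleftrightarrow> integrable (P x) (Y N)"
    by (intro Bochner_Integration.integrable_cong refl) (simp add: Y_N)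
  then show "integrable (P x) ?Z" using Y_le[of N] by simp
  have "(\<integral>w. ?Z w \<partial>P x) = (\<integral>w. Y N w \<partial>P x)"
    by (intro Bochner_Integration.integral_cong refl) (simp add: Y_N)
  then show "(\<integral>w. ?Z w \<partial>P x) \<le> (\<integral>w. indicator B w * u 0 (X (r w) w) \<partial>P x)"
    using Y_le[of N] by simp
qed

text \<open>Bounding the initial expectations by a constant \<open>c\<close> avoids any integrability question for the
  supremum of the approximations, which may be unbounded.\<close>
lemma approx_value_supermartingale:
  assumes r: "bstop C r" and s: "bstop D s" and le: "\<And>w. w \<in> space M \<Longrightarrow> r w \<le> s w" and B: "B \<in> past r"
    and c: "\<And>m. (\<integral>w. indicator B w * approx_value m (X (r w) w) \<partial>P x) \<le> c"
  shows "(\<integral>w. indicator B w * (area f (s w) w - area f (r w) w + approx_value n (X (s w) w)) \<partial>P x) \<le> c"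
proof -
  note \<Phi> = bcontinuous_approx_value
  define \<delta> where "\<delta> m = inverse (real (Suc m))" for m
  have \<delta>: "0 < \<delta> m" "\<delta> m \<le> 1" for m by (simp_all add: \<delta>_def inverse_le_1_iff)
  define J where "J m w = nat \<lceil>(s w - r w) / \<delta> m\<rceil>" for m w
  define \<sigma> where "\<sigma> m w = r w + real (J m w) * \<delta> m" for m w
  have BM [measurable]: "B \<in> sets M" by (rule past_sets[OF B])
  note [measurable] = bstop_measurable[OF r] bstop_measurable[OF s]
  have \<sigma>_meas [measurable]: "\<sigma> m \<in> borel_measurable M" for m
    unfolding \<sigma>_def J_def by measurable
  have \<sigma>_ge: "s w \<le> \<sigma> m w" for m w
  proof -
    have "(s w - r w) / \<delta> m \<le> real (J m w)" unfolding J_def by (rule real_nat_ceiling_ge)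
    then show ?thesis using \<delta>(1)[of m] by (simp add: \<sigma>_def pos_divide_le_eq)
  qed
  have \<sigma>_le: "\<sigma> m w \<le> s w + \<delta> m" if "w \<in> space M" for m w
  proof -
    have "0 \<le> (s w - r w) / \<delta> m" using le[OF that] \<delta>(1)[of m] by simp
    then have "real (J m w) \<le> (s w - r w) / \<delta> m + 1" unfolding J_def by linarith
    then have "real (J m w) * \<delta> m \<le> ((s w - r w) / \<delta> m + 1) * \<delta> m"
      using \<delta>(1)[of m] by (intro mult_right_mono) auto
    also have "\<dots> = s w - r w + \<delta> m" using \<delta>(1)[of m] by (simp add: distrib_right)
    finally show ?thesis by (simp add: \<sigma>_def)
  qed
  obtain a where a: "\<And>y. \<bar>f y\<bar> \<le> a" using bcontinuous_bound[OF f] by blast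
  have a0: "0 \<le> a" using a abs_ge_zero order_trans by blast
  obtain b where b: "\<And>y. \<bar>approx_value n y\<bar> \<le> b" using bcontinuous_bound[OF \<Phi>] by blast
  have G_meas: "(\<lambda>w. area f (\<sigma> m w) w - area f (r w) w + approx_value n (X (\<sigma> m w) w)) \<in> borel_measurable M" for m
    using order_trans[OF bstop_nonneg[OF s] \<sigma>_ge] by (intro measurable_gain f \<Phi>) simp_all
  have G_bound: "\<bar>indicator B w * (area f (\<sigma> m w) w - area f (r w) w + approx_value n (X (\<sigma> m w) w))\<bar> \<le> \<bar>a * (D + 1) + b\<bar>"
    if w: "w \<in> space M" for m w
  proof -
    have "\<bar>area f (\<sigma> m w) w - area f (r w) w + approx_value n (X (\<sigma> m w) w)\<bar> \<le> a * (D + 1) + b"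
      by (rule gain_bound)
        (use f a b w bstop_nonneg[OF r w] order_trans[OF le[OF w] \<sigma>_ge[of w m]] \<sigma>_le[OF w, of m] \<delta>(2)[of m] bstop_bound[OF s w] in auto)
    then show ?thesis by (auto simp: indicator_def)
  qed
  \<comment> \<open>As the mesh tends to 0, the grid times tend to \<open>s\<close> from above, so
    right-continuity of paths suffices for the terminal term; the areas are Lipschitz in
    time.\<close>
  have "(\<lambda>m. \<integral>w. indicator B w * (area f (\<sigma> m w) w - area f (r w) w + approx_value n (X (\<sigma> m w) w)) \<partial>P x)
    \<longlonglongrightarrow> (\<integral>w. indicator B w * (area f (s w) w - area f (r w) w + approx_value n (X (s w) w)) \<partial>P x)"
  proof (rule integral_dominated_convergence[where w = "\<lambda>_. \<bar>a * (D + 1) + b\<bar>"])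
    show "integrable (P x) (\<lambda>_. \<bar>a * (D + 1) + b\<bar>)" by (rule integrable_bounded[where c = "\<bar>a * (D + 1) + b\<bar>"]) auto
    show "(\<lambda>w. indicator B w * (area f (s w) w - area f (r w) w + approx_value n (X (s w) w))) \<in> borel_measurable (P x)"
      using integrable_gain[OF f \<Phi> r s le BM, of x n] by (rule borel_measurable_integrable)
    show "(\<lambda>w. indicator B w * (area f (\<sigma> m w) w - area f (r w) w + approx_value n (X (\<sigma> m w) w))) \<in> borel_measurable (P x)" for m
      using G_meas[of m] BM by simp
    show "AE w in P x. norm (indicator B w * (area f (\<sigma> m w) w - area f (r w) w + approx_value n (X (\<sigma> m w) w))) \<le> \<bar>a * (D + 1) + b\<bar>" for m
      using G_bound[of _ m] by (intro AE_I2) simp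
    show "AE w in P x. (\<lambda>m. indicator B w * (area f (\<sigma> m w) w - area f (r w) w + approx_value n (X (\<sigma> m w) w)))
      \<longlonglongrightarrow> indicator B w * (area f (s w) w - area f (r w) w + approx_value n (X (s w) w))"
    proof (rule AE_I2)
      fix w assume "w \<in> space (P x)"
      then have w: "w \<in> space M" by simp
      have lim\<delta>: "\<delta> \<longlonglongrightarrow> 0" unfolding \<delta>_def by (rule LIMSEQ_inverse_real_of_nat)
      have lim\<sigma>: "(\<lambda>m. \<sigma> m w) \<longlonglongrightarrow> s w"
      proof (rule tendsto_sandwich[where f = "\<lambda>_. s w" and h = "\<lambda>m. s w + \<delta> m"])
        show "(\<lambda>m. s w + \<delta> m) \<longlonglongrightarrow> s w" using tendsto_add[OF tendsto_const lim\<delta>, of "s w"] by simp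
      qed (use \<sigma>_ge \<sigma>_le[OF w] in \<open>simp_all add: always_eventually\<close>)
      have "(\<lambda>m. area f (\<sigma> m w) w) \<longlonglongrightarrow> area f (s w) w"
      proof (rule LIM_zero_cancel, rule Lim_null_comparison)
        show "eventually (\<lambda>m. norm (area f (\<sigma> m w) w - area f (s w) w) \<le> a * (\<sigma> m w - s w)) sequentially"
          using area_increment_bound[OF f a w bstop_nonneg[OF s w] \<sigma>_ge] by (simp add: always_eventually)
        show "(\<lambda>m. a * (\<sigma> m w - s w)) \<longlonglongrightarrow> 0"
          using tendsto_mult[OF tendsto_const[of a] LIM_zero[OF lim\<sigma>]] by simp
      qed
      moreover have "(\<lambda>m. approx_value n (X (\<sigma> m w) w)) \<longlonglongrightarrow> approx_value n (X (s w) w)"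
        using \<Phi>[of n] right_continuous_X_sequentially[OF w bstop_nonneg[OF s w] \<sigma>_ge lim\<sigma>]
        by (intro continuous_on_tendsto_compose[where f = "approx_value n" and s = UNIV]) (auto simp: bcontinuous_def)
      ultimately show "(\<lambda>m. indicator B w * (area f (\<sigma> m w) w - area f (r w) w + approx_value n (X (\<sigma> m w) w)))
        \<longlonglongrightarrow> indicator B w * (area f (s w) w - area f (r w) w + approx_value n (X (s w) w))"
        by (intro tendsto_mult tendsto_add tendsto_diff tendsto_const)
    qed
  qed
  moreover have "(\<integral>w. indicator B w * (area f (\<sigma> m w) w - area f (r w) w + approx_value n (X (\<sigma> m w) w)) \<partial>P x) \<le> c" for m
  proof -
    obtain N :: nat where N: "D / \<delta> m \<le> real N" using real_arch_simple by blast
    then have D: "D \<le> real N * \<delta> m" using \<delta>(1)[of m] by (simp add: pos_divide_le_eq)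
    \<comment> \<open>\<open>K \<ge> m\<close> makes the step length \<open>\<delta> m\<close>
      available at every stage used, and \<open>K \<ge> n\<close> makes each \<open>u j\<close>
      dominate \<open>approx_value n\<close>.\<close>
    define K where "K = max n m"
    \<comment> \<open>One stage is spent per step: \<open>u\<close> starts at stage
      \<open>K + N\<close> and is down to stage \<open>K\<close> after \<open>N\<close>
      steps.\<close>
    define u where "u j = approx_value (K + (N - j))" for j
    have u_step: "step f (\<delta> m) y + semigroup P X (\<delta> m) (u (Suc j)) y \<le> u j y" if "j < N" for j y
    proof -
      have "K + (N - j) = Suc (K + (N - Suc j))" using that by simp
      then show ?thesis unfolding u_def \<delta>_def
        by (simp only:) (rule approx_value_ge_step, simp add: K_def)
    qed
    have bu: "bcontinuous (u j)" for j unfolding u_def by (rule \<Phi>)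
    have J_eq: "nat \<lceil>(s w - r w) / \<delta> m\<rceil> = J m w" for w by (simp add: J_def)
    note ch = chain_supermartingale[where \<delta> = "\<delta> m" and u = u and N = N and r = r and C = C and s = s
        and D = D and B = B and x = x, OF \<delta>(1) bu u_step r s D B, unfolded J_eq \<sigma>_def[symmetric]]
    have "(\<integral>w. indicator B w * (area f (\<sigma> m w) w - area f (r w) w + approx_value n (X (\<sigma> m w) w)) \<partial>P x)
      \<le> (\<integral>w. indicator B w * (area f (\<sigma> m w) w - area f (r w) w + u (J m w) (X (\<sigma> m w) w)) \<partial>P x)"
    proof (rule integral_mono)
      show "integrable (P x) (\<lambda>w. indicator B w * (area f (\<sigma> m w) w - area f (r w) w + approx_value n (X (\<sigma> m w) w)))"
        by (rule integrable_bounded[OF _ G_bound]) (use G_meas[of m] BM in simp)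
      show "integrable (P x) (\<lambda>w. indicator B w * (area f (\<sigma> m w) w - area f (r w) w + u (J m w) (X (\<sigma> m w) w)))"
        by (rule ch(1))
      show "indicator B w * (area f (\<sigma> m w) w - area f (r w) w + approx_value n (X (\<sigma> m w) w))
        \<le> indicator B w * (area f (\<sigma> m w) w - area f (r w) w + u (J m w) (X (\<sigma> m w) w))" for w
        unfolding u_def using approx_value_mono[of n "K + (N - J m w)" "X (\<sigma> m w) w"]
        by (auto simp: indicator_def K_def)
    qed
    also have "\<dots> \<le> (\<integral>w. indicator B w * u 0 (X (r w) w) \<partial>P x)" by (rule ch(2))
    \<comment> \<open>The initial stage \<open>K + N\<close> varies with the mesh, which is why
      \<open>c\<close> has to bound the expectations of all stages.\<close>
    also have "\<dots> \<le> c" unfolding u_def by (rule c)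
    finally show ?thesis .
  qed
  ultimately show ?thesis by (intro LIMSEQ_le_const2) auto
qed

end

subsection \<open>Hitting times\<close>

context feller_process
begin

definition hit :: "'a set \<Rightarrow> 'w \<Rightarrow> ennreal" where
  "hit A w = Inf (ennreal ` {t. t \<ge> 0 \<and> X t w \<in> A})"

lemma hit_le: "0 \<le> t \<Longrightarrow> X t w \<in> A \<Longrightarrow> hit A w \<le> ennreal t"
  unfolding hit_def by (rule Inf_lower) auto

lemma hit_antimono: "A \<subseteq> B \<Longrightarrow> hit B w \<le> hit A w"
  unfolding hit_def by (rule Inf_superset_mono) auto

lemma hit_lessE:
  assumes "hit A w < ennreal b"
  obtains t where "0 \<le> t" "t < b" "X t w \<in> A"
proof -
  obtain t where "0 \<le> t" "X t w \<in> A" "ennreal t < ennreal b"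
    using assms unfolding hit_def Inf_less_iff by auto
  then show ?thesis using that by (simp add: ennreal_less_iff)
qed

text \<open>There are visits to \<open>A\<close> at times tending to the entry time from the right,
  so right-continuity makes the position at the entry time a limit of points of \<open>A\<close>.
  For closed \<open>A\<close> the infimum is thus attained.\<close>

lemma X_hit_in_closure:
  assumes w: "w \<in> space M" and fin: "hit A w < top"
  shows "X (enn2real (hit A w)) w \<in> closure A"
proof -
  define t where "t = enn2real (hit A w)"
  have t: "0 \<le> t" "hit A w = ennreal t" using fin by (simp_all add: t_def)
  have "\<exists>s. t \<le> s \<and> s < t + inverse (real (Suc n)) \<and> X s w \<in> A" for n
  proof -
    have "hit A w < ennreal (t + inverse (real (Suc n)))"
      unfolding t(2) using t(1) by (simp add: ennreal_less_iff)
    then obtain s where s: "0 \<le> s" "s < t + inverse (real (Suc n))" "X s w \<in> A" by (rule hit_lessE)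
    then have "t \<le> s" using hit_le[of s w A] t by simp
    then show ?thesis using s by blast
  qed
  then obtain \<sigma> where \<sigma>: "\<And>n. t \<le> \<sigma> n" "\<And>n. \<sigma> n < t + inverse (real (Suc n))" "\<And>n. X (\<sigma> n) w \<in> A" by metis
  have "\<sigma> \<longlonglongrightarrow> t"
  proof (rule tendsto_sandwich[where f = "\<lambda>_. t" and h = "\<lambda>n. t + inverse (real (Suc n))"])
    show "(\<lambda>n. t + inverse (real (Suc n))) \<longlonglongrightarrow> t" by (rule LIMSEQ_inverse_real_of_nat_add)
  qed (use \<sigma> in \<open>simp_all add: always_eventually less_imp_le\<close>)
  then have "(\<lambda>n. X (\<sigma> n) w) \<longlonglongrightarrow> X t w" by (rule right_continuous_X_sequentially[OF w t(1) \<sigma>(1)])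
  then show ?thesis unfolding t_def[symmetric] closure_sequential
    using \<sigma>(3) by (intro exI[of _ "\<lambda>n. X (\<sigma> n) w"]) simp
qed

text \<open>By right-continuity a visit to an open set lasts for a while and is detected at a
  rational time. Entry before \<open>b\<close> is therefore visible from times below
  \<open>b\<close>; entry by time \<open>t\<close> is entry before every \<open>b > t\<close>, which
  is known immediately after \<open>t\<close>.\<close>

lemma hit_open_nat_filt_plus:
  assumes U: "open U" and t: "0 \<le> t"
  shows "{w \<in> space M. hit U w \<le> ennreal t} \<in> nat_filt_plus M X t"
  unfolding nat_filt_plus_def
proof (rule INT_I)
  fix u assume "u \<in> {t<..}"
  then have u: "t < u" by simp
  \<comment> \<open>\<open>b k\<close> decreases to \<open>t\<close> inside \<open>(t, u]\<close>,
    so all rational times used lie before \<open>u\<close>.\<close>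
  define b where "b k = t + (u - t) * inverse (real (Suc k))" for k
  have b: "t < b k" "b k \<le> u" for k
  proof -
    show "t < b k" using u by (simp add: b_def)
    have "(u - t) * inverse (real (Suc k)) \<le> (u - t) * 1"
      using u by (intro mult_left_mono) (simp_all add: inverse_le_1_iff)
    then show "b k \<le> u" by (simp add: b_def)
  qed
  have b_lim: "b \<longlonglongrightarrow> t"
    unfolding b_def using tendsto_add[OF tendsto_const tendsto_mult[OF tendsto_const LIMSEQ_inverse_real_of_nat], of t "u - t"]
    by simp
  interpret sigma_algebra "space M" "nat_filt M X u"
    unfolding nat_filt_def by (rule sigma_algebra_sigma_sets) auto
  have "{w \<in> space M. hit U w \<le> ennreal t} = (\<Inter>k. \<Union>q\<in>\<rat> \<inter> {0..<b k}. {w \<in> space M. X q w \<in> U})"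
  proof (intro equalityI subsetI)
    fix w assume "w \<in> {w \<in> space M. hit U w \<le> ennreal t}"
    then have w: "w \<in> space M" "hit U w \<le> ennreal t" by auto
    show "w \<in> (\<Inter>k. \<Union>q\<in>\<rat> \<inter> {0..<b k}. {w \<in> space M. X q w \<in> U})"
    proof (rule INT_I)
      fix k
      have "hit U w < ennreal (b k)"
        using w(2) b(1)[of k] t by (auto intro: le_less_trans simp: ennreal_less_iff)
      then obtain s where s: "0 \<le> s" "s < b k" "X s w \<in> U" by (rule hit_lessE)
      have "eventually (\<lambda>s. X s w \<in> U) (at_right s)"
        using right_continuous_X[OF w(1) s(1)] U s(3) by (rule topological_tendstoD)
      then obtain e where e: "e > s" "\<And>s'. s < s' \<Longrightarrow> s' < e \<Longrightarrow> X s' w \<in> U"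
        unfolding eventually_at_right_field by blast
      obtain q where q: "q \<in> \<rat>" "s < q" "q < min e (b k)"
        using Rats_dense_in_real[of s "min e (b k)"] e s by auto
      then show "w \<in> (\<Union>q\<in>\<rat> \<inter> {0..<b k}. {w \<in> space M. X q w \<in> U})"
        using w s e(2)[of q] by (intro UN_I[of q]) auto
    qed
  next
    fix w assume *: "w \<in> (\<Inter>k. \<Union>q\<in>\<rat> \<inter> {0..<b k}. {w \<in> space M. X q w \<in> U})"
    then have w: "w \<in> space M" by blast
    have "hit U w \<le> ennreal (b k)" for k
    proof -
      obtain q where "0 \<le> q" "q < b k" "X q w \<in> U" using * by fastforce
      then show ?thesis using hit_le[of q w U] by (auto intro: order_trans ennreal_leI)
    qed
    then have "hit U w \<le> ennreal t"
      using tendsto_ennrealI[OF b_lim] by (intro LIMSEQ_le_const) auto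
    then show "w \<in> {w \<in> space M. hit U w \<le> ennreal t}" using w by simp
  qed
  also have "\<dots> \<in> nat_filt M X u"
  proof (intro countable_INT image_subsetI countable_UN')
    fix k
    show "{w \<in> space M. X q w \<in> U} \<in> nat_filt M X u" if "q \<in> \<rat> \<inter> {0..<b k}" for q
      unfolding nat_filt_def using that b(2)[of k] U
      by (intro sigma_sets.Basic) (auto intro!: exI[of _ q] exI[of _ U])
  qed (auto simp: countable_rat countable_Int1)
  finally show "{w \<in> space M. hit U w \<le> ennreal t} \<in> nat_filt M X u" .
qed

lemma stopping_hit_open: "open U \<Longrightarrow> stopping M P X (hit U)"
  unfolding stopping_def using hit_open_nat_filt_plus nat_filt_plus_subset_filt by blast

text \<open>Let \<open>S\<close> be the supremum of the entry times; it is at most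
  \<open>hit D\<close>. If \<open>S\<close> is finite, quasi-left-continuity makes the positions at
  these times converge to the position at \<open>S\<close>. From index \<open>m\<close> on they lie
  in \<open>closure (A m)\<close>, so the limit lies in all these closures, hence in
  \<open>D\<close>, and \<open>hit D \<le> S\<close>. Used for neighbourhoods of a closed set and
  for the levels shrinking to \<open>level 0\<close>.\<close>

lemma hit_decreasing_limit:
  assumes A: "antimono A" and st: "\<And>n::nat. stopping M P X (hit (A n))"
    and D: "(\<Inter>n. closure (A n)) \<subseteq> D" "\<And>n. D \<subseteq> A n"
  shows "AE w in P x. hit D w = (SUP n. hit (A n) w) \<and>
    (hit D w < top \<longrightarrow> (\<lambda>n. X (enn2real (hit (A n) w)) w) \<longlonglongrightarrow> X (enn2real (hit D w)) w)"
proof -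
  have inc: "incseq (\<lambda>n. hit (A n) w)" for w
    using A by (auto simp: incseq_def antimono_def intro!: hit_antimono)
  have "AE w in P x. w \<in> space M" using AE_space[of "P x"] by simp
  then show ?thesis using quasi_left_continuous[of "\<lambda>n. hit (A n)" x, OF st inc]
  proof eventually_elim
    case (elim w)
    let ?S = "SUP n. hit (A n) w"
    have le: "?S \<le> hit D w" by (intro SUP_least hit_antimono D(2))
    show ?case
    proof (cases "?S < top")
      case False
      then have S: "?S = top" using less_top by blast
      then have "hit D w = top" using le top_unique by metis
      then show ?thesis unfolding S by simp
    next
      case True
      then have lim: "(\<lambda>n. X (enn2real (hit (A n) w)) w) \<longlonglongrightarrow> X (enn2real ?S) w"
        using elim(2) by (simp add: Xat_def)
      have "X (enn2real ?S) w \<in> closure (A m)" for m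
      proof (rule Lim_in_closed_set[OF closed_closure _ sequentially_bot lim])
        have "X (enn2real (hit (A n) w)) w \<in> closure (A m)" if "m \<le> n" for n
        proof -
          have "hit (A n) w < top" using True by (rule le_less_trans[rotated]) (rule SUP_upper, simp)
          then have "X (enn2real (hit (A n) w)) w \<in> closure (A n)" using elim(1) by (intro X_hit_in_closure)
          then show ?thesis using closure_mono[of "A n" "A m"] A that by (auto simp: antimono_def)
        qed
        then show "eventually (\<lambda>n. X (enn2real (hit (A n) w)) w \<in> closure (A m)) sequentially"
          by (auto simp: eventually_sequentially)
      qed
      then have "X (enn2real ?S) w \<in> D" using D(1) by blast
      then have "hit D w \<le> ennreal (enn2real ?S)" by (intro hit_le) auto
      then have "hit D w \<le> ?S" using True by simp
      then have "hit D w = ?S" using le by simp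
      then show ?thesis using lim by simp
    qed
  qed
qed

text \<open>Almost surely \<open>hit D\<close> is the supremum of the entry times of shrinking open
  neighbourhoods. The exceptional event is null under every \<open>P x\<close>, and the augmentation
  of the filtration absorbs it.\<close>

lemma stopping_hit_closed:
  assumes D: "closed D"
  shows "stopping M P X (hit D)"
proof (cases "D = {}") \<comment> \<open>\<open>infdist y {} = 0\<close>, so the neighbourhoods below would not shrink to the empty set\<close>
  case True
  have "{w \<in> space M. hit D w \<le> ennreal t} = {}" for t
    using True by (simp add: hit_def top_unique)
  moreover have "{} \<in> filt M P X t" for t
    using sigma_algebra_filt[of t] unfolding sigma_algebra_iff2 by (elim conjE)
  ultimately show ?thesis unfolding stopping_def by presburger
next
  case False
  define U where "U n = {y. infdist y D < inverse (real (Suc n))}" for n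
  have opU: "open (U n)" for n
    unfolding U_def by (intro open_Collect_less continuous_intros)
  have "antimono U"
  proof (rule antimonoI, rule subsetI)
    fix m n y assume "m \<le> n" "y \<in> U n"
    moreover have "inverse (real (Suc n)) \<le> inverse (real (Suc m))"
      using \<open>m \<le> n\<close> by (intro le_imp_inverse_le) auto
    ultimately show "y \<in> U m" unfolding U_def mem_Collect_eq by linarith
  qed
  moreover have "(\<Inter>n. closure (U n)) \<subseteq> D"
  proof
    fix y assume y: "y \<in> (\<Inter>n. closure (U n))"
    have "infdist y D \<le> inverse (real (Suc n))" for n
    proof -
      have "closed {y. infdist y D \<le> inverse (real (Suc n))}"
        by (intro closed_Collect_le continuous_intros)
      then have "closure (U n) \<subseteq> {y. infdist y D \<le> inverse (real (Suc n))}"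
        by (intro closure_minimal) (auto simp: U_def)
      then show ?thesis using y by blast
    qed
    then have "infdist y D \<le> 0"
      using LIMSEQ_inverse_real_of_nat by (intro LIMSEQ_le_const) auto
    then have "infdist y D = 0" using infdist_nonneg[of y D] by linarith
    then show "y \<in> D" using in_closed_iff_infdist_zero[OF D False] by simp
  qed
  moreover have DU: "D \<subseteq> U n" for n by (auto simp: U_def)
  ultimately have ae: "AE w in P x. hit D w = (SUP n. hit (U n) w)" for x
    using hit_decreasing_limit[of U D x, OF _ stopping_hit_open[OF opU]] by auto
  show ?thesis
    unfolding stopping_def
  proof (intro allI impI)
    fix t :: real assume t: "0 \<le> t"
    interpret sigma_algebra "space M" "nat_filt_plus M X t" by (rule sigma_algebra_nat_filt_plus)
    show "{w \<in> space M. hit D w \<le> ennreal t} \<in> filt M P X t"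
    proof (rule null_difference_in_filt[where B = "\<Inter>n. {w \<in> space M. hit (U n) w \<le> ennreal t}"])
      show "(\<Inter>n. {w \<in> space M. hit (U n) w \<le> ennreal t}) \<in> nat_filt_plus M X t"
        by (intro countable_INT image_subsetI hit_open_nat_filt_plus opU t) auto
      show "AE w in P x. w \<in> {w \<in> space M. hit D w \<le> ennreal t} \<longleftrightarrow>
          w \<in> (\<Inter>n. {w \<in> space M. hit (U n) w \<le> ennreal t})" for x
        using ae[of x] by eventually_elim (auto simp: SUP_le_iff)
    qed auto
  qed
qed

end

subsection \<open>The value function\<close>

context stopping_problem
begin

lemma stopping_measurable:
  assumes "stopping M P X \<tau>" shows "\<tau> \<in> borel_measurable M"
proof (rule borel_measurableI_le)
  fix a :: ennreal
  show "{w \<in> space M. \<tau> w \<le> a} \<in> sets M"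
  proof (cases a)
    case (real t)
    then show ?thesis using assms filt_subset[of t] unfolding stopping_def by auto
  qed simp
qed

lemma run_int_eq_area:
  "run_int X h \<tau> T w = area h (enn2real (min (\<tau> w) (ennreal T))) w"
  by (simp add: run_int_def area_def set_lebesgue_integral_def)

lemma payoff_eq:
  "payoff P X f g x \<tau> T = (\<integral>w. area f (enn2real (min (\<tau> w) (ennreal T))) w
     + g (X (enn2real (min (\<tau> w) (ennreal T))) w) \<partial>P x)"
  by (simp add: payoff_def run_int_eq_area Xat_def)

lemma Limsup_eventually_const:
  fixes F :: "real \<Rightarrow> real"
  assumes "\<And>T. T \<ge> D \<Longrightarrow> F T = c"
  shows "Limsup at_top (\<lambda>T. ereal (F T)) = ereal c"
proof (rule lim_imp_Limsup)
  have "eventually (\<lambda>T. ereal (F T) = ereal c) at_top"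
    using eventually_ge_at_top[of D] by eventually_elim (simp add: assms)
  then show "((\<lambda>T. ereal (F T)) \<longlongrightarrow> ereal c) at_top" by (rule tendsto_eventually)
qed simp

lemma enn2real_min_bstop:
  assumes "bstop D s" "w \<in> space M" "D \<le> T"
  shows "enn2real (min (ennreal (s w)) (ennreal T)) = s w"
  using bstop_nonneg[OF assms(1,2)] bstop_bound[OF assms(1,2)] assms(3)
  by (simp add: min_def ennreal_leI)

text \<open>Truncation at a horizon \<open>T \<ge> D\<close> changes nothing, so the payoff is
  eventually constant in \<open>T\<close>.\<close>

lemma lim_payoff_bstop:
  assumes s: "bstop D s"
  shows "lim_payoff P X f g x (\<lambda>w. ennreal (s w)) = ereal (\<integral>w. area f (s w) w + g (X (s w) w) \<partial>P x)"
  unfolding lim_payoff_def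
proof (rule Limsup_eventually_const[of D])
  show "payoff P X f g x (\<lambda>w. ennreal (s w)) T = (\<integral>w. area f (s w) w + g (X (s w) w) \<partial>P x)" if "D \<le> T" for T
    unfolding payoff_eq using enn2real_min_bstop[OF s _ that]
    by (intro Bochner_Integration.integral_cong) simp_all
qed

lemma value_fn_ge_bstop:
  assumes s: "bstop D s"
  shows "ereal (\<integral>w. area f (s w) w + g (X (s w) w) \<partial>P x) \<le> value_fn M P X f g x"
  unfolding value_fn_def lim_payoff_bstop[OF s, symmetric]
  by (rule SUP_upper) (simp add: bstop_stopping[OF s])

lemma gamma_fn_ge_bstop:
  assumes s: "bstop D s"
  shows "ereal (\<integral>w. area f (s w) w - c * s w \<partial>P x) \<le> gamma_fn M P X f c x"
proof -
  have "area (\<lambda>y. f y - c) (s w) w = area f (s w) w - c * s w" if w: "w \<in> space M" for w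
  proof -
    have "area (\<lambda>y. f y - c) (s w) w = (\<integral>t. indicator {0..s w} t * f (X t w) - indicator {0..s w} t * c \<partial>lborel)"
      unfolding area_def by (intro Bochner_Integration.integral_cong) (auto simp: right_diff_distrib)
    also have "\<dots> = area f (s w) w - (\<integral>t. indicator {0..s w} t * c \<partial>lborel)"
      unfolding area_def
    proof (rule Bochner_Integration.integral_diff)
      show "integrable lborel (\<lambda>t. indicator {0..s w} t * f (X t w))" by (rule integrable_path[OF f w]) simp
      show "integrable lborel (\<lambda>t. indicator {0..s w} t * c)"
        by (rule integrable_lborel_bounded[of _ 0 "s w" "\<bar>c\<bar>"]) (auto simp: indicator_def)
    qed
    also have "(\<integral>t. indicator {0..s w} t * c \<partial>lborel) = c * s w"
      using bstop_nonneg[OF s w] by simp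
    finally show ?thesis .
  qed
  then have "(\<integral>w. run_int X (\<lambda>y. f y - c) (\<lambda>w. ennreal (s w)) T w \<partial>P x) = (\<integral>w. area f (s w) w - c * s w \<partial>P x)"
    if "D \<le> T" for T
    unfolding run_int_eq_area using enn2real_min_bstop[OF s _ that]
    by (intro Bochner_Integration.integral_cong) simp_all
  then have "Limsup at_top (\<lambda>T. ereal (\<integral>w. run_int X (\<lambda>y. f y - c) (\<lambda>w. ennreal (s w)) T w \<partial>P x)) =
      ereal (\<integral>w. area f (s w) w - c * s w \<partial>P x)"
    by (rule Limsup_eventually_const)
  then show ?thesis
    unfolding gamma_fn_def by (intro SUP_upper2[of "\<lambda>w. ennreal (s w)"]) (simp_all add: bstop_stopping[OF s])
qed

text \<open>The indicator of \<open>space M\<close> gives the initial value the localised form used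
  in \<open>attains\<close> and in the supermartingale inequality, with
  \<open>B = space M\<close>.\<close>

lemma integral_start: "(\<integral>w. indicator (space M) w * \<phi> (X 0 w) \<partial>P x) = (\<phi> x :: real)"
  if \<phi>: "bcontinuous \<phi>"
proof -
  have "(\<integral>w. indicator (space M) w * \<phi> (X 0 w) \<partial>P x) = (\<integral>w. \<phi> x \<partial>P x)"
  proof (rule integral_cong_AE)
    show "(\<lambda>w. indicator (space M) w * \<phi> (X 0 w)) \<in> borel_measurable (P x)"
      using integrable_at[OF \<phi> bstop_const[of 0] sets.top, of x] by (simp add: borel_measurable_integrable)
    show "AE w in P x. indicator (space M) w * \<phi> (X 0 w) = \<phi> x"
      using AE_X_0[of x] AE_space[of "P x"] by eventually_elim simp
  qed simp
  then show ?thesis by simp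
qed

lemma integrable_payoff:
  assumes s: "bstop D s" and \<phi>: "bcontinuous \<phi>"
  shows "integrable (P x) (\<lambda>w. area f (s w) w + \<phi> (X (s w) w))"
proof -
  have "integrable (P x) (\<lambda>w. indicator (space M) w * (area f (s w) w - area f 0 w + \<phi> (X (s w) w)))"
    using bstop_nonneg[OF s] by (intro integrable_gain[OF f \<phi> bstop_const[OF order_refl] s]) auto
  also have "?this \<longleftrightarrow> ?thesis"
    by (intro Bochner_Integration.integrable_cong) (auto simp: area_0)
  finally show ?thesis .
qed

text \<open>The supermartingale inequality started at time 0. Stage 0 bounds the payoffs; the higher
  stages are used in \<open>measure_not_in_level\<close> to compare the value with \<open>g\<close>
  at the time \<open>s\<close>.\<close>

lemma payoff_le:
  assumes s: "bstop D s" and c: "\<And>m. approx_value m x \<le> c"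
  shows "(\<integral>w. area f (s w) w + approx_value n (X (s w) w) \<partial>P x) \<le> c"
proof -
  have "(\<integral>w. indicator (space M) w * (area f (s w) w - area f 0 w + approx_value n (X (s w) w)) \<partial>P x) \<le> c"
  proof (rule approx_value_supermartingale[OF bstop_const[OF order_refl] s])
    show "(\<integral>w. indicator (space M) w * approx_value m (X 0 w) \<partial>P x) \<le> c" for m
      using integral_start[OF bcontinuous_approx_value, of x m] c by simp
  qed (use bstop_nonneg[OF s] past_space[OF bstop_const[OF order_refl]] in auto)
  also have "(\<integral>w. indicator (space M) w * (area f (s w) w - area f 0 w + approx_value n (X (s w) w)) \<partial>P x) =
      (\<integral>w. area f (s w) w + approx_value n (X (s w) w) \<partial>P x)"
    by (intro Bochner_Integration.integral_cong) (auto simp: area_0)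
  finally show ?thesis .
qed

lemma approx_value_attained:
  obtains D s where "bstop D s" "approx_value n x \<le> (\<integral>w. area f (s w) w + g (X (s w) w) \<partial>P x)"
proof -
  obtain D s where at: "attains (approx_value n) (\<lambda>_. 0) D s"
    by (rule attainableE[OF attainable_approx_value bstop_const[OF order_refl]])
  note s = attainsD[OF at]
  have "approx_value n x = (\<integral>w. indicator (space M) w * approx_value n (X 0 w) \<partial>P x)"
    by (rule integral_start[OF bcontinuous_approx_value, symmetric])
  also have "\<dots> \<le> (\<integral>w. indicator (space M) w * (area f (s w) w - area f 0 w + g (X (s w) w)) \<partial>P x)"
    by (rule s(3)[OF past_space[OF bstop_const[OF order_refl]]])
  also have "\<dots> = (\<integral>w. area f (s w) w + g (X (s w) w) \<partial>P x)"
    by (intro Bochner_Integration.integral_cong) (auto simp: area_0)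
  finally show ?thesis using s(1) that by blast
qed

lemma abs_g_le_supnorm: "\<bar>g y\<bar> \<le> supnorm g"
  unfolding supnorm_def using bcontinuous_bound[OF g]
  by (intro cSUP_upper) (auto simp: bdd_above_def)

text \<open>Dominated convergence with majorant \<open>a * t w + b\<close>, integrable because
  \<open>t\<close> is. It serves three limits: truncation by near-optimal times, levels shrinking to
  \<open>level 0\<close>, and the horizon tending to infinity.\<close>

lemma gain_tendsto:
  assumes t: "integrable (P x) t" "\<And>w. 0 \<le> t w"
    and \<rho>: "\<And>n. \<rho> n \<in> borel_measurable M" "\<And>n w. 0 \<le> \<rho> n w"
    and le: "AE w in P x. \<forall>n. \<rho> n w \<le> t w"
    and lim: "AE w in P x. (\<lambda>n. \<rho> n w) \<longlonglongrightarrow> t w"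
      "AE w in P x. (\<lambda>n. X (\<rho> n w) w) \<longlonglongrightarrow> X (t w) w"
  shows "(\<lambda>n. \<integral>w. area f (\<rho> n w) w + g (X (\<rho> n w) w) \<partial>P x) \<longlonglongrightarrow> (\<integral>w. area f (t w) w + g (X (t w) w) \<partial>P x)"
proof -
  obtain a where a: "\<And>y. \<bar>f y\<bar> \<le> a" using bcontinuous_bound[OF f] by blast
  have a0: "0 \<le> a" using a abs_ge_zero order_trans by blast
  obtain b where b: "\<And>y. \<bar>g y\<bar> \<le> b" using bcontinuous_bound[OF g] by blast
  have tm: "t \<in> borel_measurable M" using borel_measurable_integrable[OF t(1)] by simp
  have space: "AE w in P x. w \<in> space M" using AE_space[of "P x"] by simp
  show ?thesis
  proof (rule integral_dominated_convergence[where w = "\<lambda>w. a * t w + b"])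
    interpret prob_space "P x" by (rule prob_space_P)
    show "integrable (P x) (\<lambda>w. a * t w + b)" using t(1) by simp
    show "(\<lambda>w. area f (t w) w + g (X (t w) w)) \<in> borel_measurable (P x)"
      using measurable_area[OF f tm] bcontinuous_X[OF g tm t(2)] by simp
    show "(\<lambda>w. area f (\<rho> n w) w + g (X (\<rho> n w) w)) \<in> borel_measurable (P x)" for n
      using measurable_area[OF f \<rho>(1)[of n]] bcontinuous_X[OF g \<rho>(1)[of n] \<rho>(2)] by simp
    show "AE w in P x. norm (area f (\<rho> n w) w + g (X (\<rho> n w) w)) \<le> a * t w + b" for n
      using le space
    proof eventually_elim
      case (elim w)
      have "\<bar>area f (\<rho> n w) w\<bar> \<le> a * \<rho> n w" by (rule area_bound) (use f a elim \<rho>(2) in auto)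
      also have "\<dots> \<le> a * t w" using elim a0 by (intro mult_left_mono) auto
      finally show ?case using b[of "X (\<rho> n w) w"] by simp
    qed
    show "AE w in P x. (\<lambda>n. area f (\<rho> n w) w + g (X (\<rho> n w) w)) \<longlonglongrightarrow> area f (t w) w + g (X (t w) w)"
      using le lim space
    proof eventually_elim
      case (elim w)
      have "(\<lambda>n. area f (\<rho> n w) w) \<longlonglongrightarrow> area f (t w) w"
      proof (rule LIM_zero_cancel, rule Lim_null_comparison)
        have "\<bar>area f (\<rho> n w) w - area f (t w) w\<bar> \<le> a * (t w - \<rho> n w)" for n
        proof -
          have "\<bar>area f (t w) w - area f (\<rho> n w) w\<bar> \<le> a * (t w - \<rho> n w)"
            by (rule area_increment_bound) (use f a elim \<rho>(2) in auto)
          then show ?thesis by (simp only: abs_minus_commute)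
        qed
        then show "eventually (\<lambda>n. norm (area f (\<rho> n w) w - area f (t w) w) \<le> a * (t w - \<rho> n w)) sequentially"
          by (simp add: always_eventually)
        show "(\<lambda>n. a * (t w - \<rho> n w)) \<longlonglongrightarrow> 0"
          using tendsto_mult[OF tendsto_const[of a] tendsto_diff[OF tendsto_const elim(2), of "t w"]] by simp
      qed
      moreover have "(\<lambda>n. g (X (\<rho> n w) w)) \<longlonglongrightarrow> g (X (t w) w)"
        using g elim(3)
        by (intro continuous_on_tendsto_compose[where f = g and s = UNIV]) (auto simp: bcontinuous_def)
      ultimately show ?case by (rule tendsto_add)
    qed
  qed
qed

end

section \<open>Consequences of (B1): finiteness of the value and its level sets\<close>

locale finite_stopping_problem = stopping_problem M P X f g
  for M :: "'w measure" and P :: "'a::{heine_borel, second_countable_topology} \<Rightarrow> 'w measure"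
    and X :: "real \<Rightarrow> 'w \<Rightarrow> 'a" and f g :: "'a \<Rightarrow> real" +
  fixes d :: "'a \<Rightarrow> real"
  assumes d_neg: "d x < 0" and gamma_finite: "gamma_fn M P X f (d x) x < \<infinity>"
begin

definition \<gamma> :: "'a \<Rightarrow> real" where
  "\<gamma> x = real_of_ereal (gamma_fn M P X f (d x) x)"

definition value_real :: "'a \<Rightarrow> real" where
  "value_real y = (SUP n. approx_value n y)"

definition level :: "real \<Rightarrow> 'a set" where
  "level e = {y. value_real y \<le> g y + e}"

text \<open>\<open>gamma_fn\<close> is bounded below by the integral at hand and above by (B1), so
  its conversion to a real loses nothing.\<close>

lemma discounted_le_\<gamma>:
  assumes s: "bstop D s"
  shows "(\<integral>w. area f (s w) w - d x * s w \<partial>P x) \<le> \<gamma> x"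
proof -
  have "ereal (\<integral>w. area f (s w) w - d x * s w \<partial>P x) \<le> gamma_fn M P X f (d x) x"
    by (rule gamma_fn_ge_bstop[OF s])
  then show ?thesis using gamma_finite[of x] unfolding \<gamma>_def
    by (cases "gamma_fn M P X f (d x) x") auto
qed

lemma integrable_bstop: "bstop D s \<Longrightarrow> integrable (P x) s"
  using bstop_nonneg bstop_bound bstop_measurable by (intro integrable_bounded[where c = D]) auto

text \<open>The term with the mean of \<open>s\<close> is kept because it has two uses: dropping it
  bounds the approximations, keeping it bounds the duration of near-optimal times.\<close>

lemma payoff_bstop_bound:
  assumes s: "bstop D s"
  shows "(\<integral>w. area f (s w) w + g (X (s w) w) \<partial>P x) \<le> \<gamma> x + supnorm g + d x * (\<integral>w. s w \<partial>P x)"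
proof -
  interpret prob_space "P x" by (rule prob_space_P)
  have z: "bcontinuous (\<lambda>_::'a. 0)" by (rule bcontinuousI[of _ 0]) auto
  have i1: "integrable (P x) (\<lambda>w. area f (s w) w)" using integrable_payoff[OF s z] by simp
  note i2 = integrable_bstop[OF s, of x]
  have "(\<integral>w. area f (s w) w + g (X (s w) w) \<partial>P x) \<le> (\<integral>w. (area f (s w) w - d x * s w) + (supnorm g + d x * s w) \<partial>P x)"
  proof (rule integral_mono[OF integrable_payoff[OF s g]])
    show "area f (s w) w + g (X (s w) w) \<le> (area f (s w) w - d x * s w) + (supnorm g + d x * s w)" for w
      using abs_g_le_supnorm[of "X (s w) w"] by simp
  qed (use i1 i2 in auto)
  also have "\<dots> = (\<integral>w. area f (s w) w - d x * s w \<partial>P x) + (\<integral>w. supnorm g + d x * s w \<partial>P x)"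
    using i1 i2 by (intro Bochner_Integration.integral_add) auto
  also have "(\<integral>w. supnorm g + d x * s w \<partial>P x) = supnorm g + d x * (\<integral>w. s w \<partial>P x)"
    using i2 by simp
  finally show ?thesis using discounted_le_\<gamma>[OF s, of x] by simp
qed

lemma bdd_approx_value: "bdd_above (range (\<lambda>n. approx_value n y))"
proof (rule bdd_aboveI2)
  fix n
  obtain D s where s: "bstop D s" "approx_value n y \<le> (\<integral>w. area f (s w) w + g (X (s w) w) \<partial>P y)"
    by (rule approx_value_attained)
  have "0 \<le> (\<integral>w. s w \<partial>P y)" using bstop_nonneg[OF s(1)] by (intro integral_nonneg_AE AE_I2) simp
  then have "d y * (\<integral>w. s w \<partial>P y) \<le> 0" using d_neg[of y] by (intro mult_nonpos_nonneg) auto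
  then show "approx_value n y \<le> \<gamma> y + supnorm g"
    using payoff_bstop_bound[OF s(1), of y] s(2) by simp
qed

lemma approx_value_le: "approx_value n y \<le> value_real y"
  unfolding value_real_def by (rule cSUP_upper[OF _ bdd_approx_value]) simp

lemma value_real_le_iff: "value_real y \<le> c \<longleftrightarrow> (\<forall>n. approx_value n y \<le> c)"
  unfolding value_real_def by (subst cSUP_le_iff[OF _ bdd_approx_value]) auto

lemma value_real_ge_g: "g y \<le> value_real y"
  using approx_value_le[of 0 y] by simp

lemma value_fn_eq: "value_fn M P X f g x = ereal (value_real x)"
proof (rule antisym)
  show "value_fn M P X f g x \<le> ereal (value_real x)"
    unfolding value_fn_def lim_payoff_def
  proof (intro SUP_least Limsup_bounded)
    fix \<tau> assume "\<tau> \<in> {\<tau>. stopping M P X \<tau>}"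
    then have \<tau>: "stopping M P X \<tau>" by simp
    show "eventually (\<lambda>T. ereal (payoff P X f g x \<tau> T) \<le> ereal (value_real x)) at_top"
      using eventually_ge_at_top[of "0::real"]
    proof eventually_elim
      case (elim T)
      \<comment> \<open>Truncation at \<open>T\<close> makes any stopping time bounded, and stage 0
        is \<open>g\<close>.\<close>
      have "payoff P X f g x \<tau> T \<le> value_real x"
        unfolding payoff_eq
        using payoff_le[OF bstop_min_stopping[OF bstop_const[OF elim] \<tau>] approx_value_le, of x 0] by simp
      then show ?case by simp
    qed
  qed
  show "ereal (value_real x) \<le> value_fn M P X f g x"
  proof -
    have "ereal (approx_value n x) \<le> value_fn M P X f g x" for n
    proof -
      obtain D s where s: "bstop D s" "approx_value n x \<le> (\<integral>w. area f (s w) w + g (X (s w) w) \<partial>P x)"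
        by (rule approx_value_attained)
      show ?thesis
        by (rule order_trans[OF _ value_fn_ge_bstop[OF s(1), of x]]) (use s(2) in simp)
    qed
    then show ?thesis
      by (cases "value_fn M P X f g x") (auto simp: value_real_le_iff)
  qed
qed

lemma closed_level: "closed (level e)"
proof -
  have "level e = (\<Inter>n. {y. approx_value n y \<le> g y + e})"
    by (auto simp: level_def value_real_le_iff)
  also have "closed \<dots>"
    using bcontinuous_approx_value g unfolding bcontinuous_def
    by (intro closed_INT ballI closed_Collect_le continuous_on_add continuous_on_const) auto
  finally show ?thesis .
qed

lemma tau_star_eq_hit: "tau_star M P X f g = hit (level 0)"
  unfolding tau_star_def hit_def level_def value_fn_eq fun_eq_iff by simp

subsection \<open>Optimality of the first entry time\<close>

lemma near_optimal:
  assumes "0 < \<eta>"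
  obtains D s where "bstop D s" "value_real x - \<eta> \<le> (\<integral>w. area f (s w) w + g (X (s w) w) \<partial>P x)"
proof -
  have "\<not> value_real x \<le> value_real x - \<eta>" using assms by simp
  then obtain n where n: "value_real x - \<eta> < approx_value n x" unfolding value_real_le_iff by (auto simp: not_le)
  obtain D s where "bstop D s" "approx_value n x \<le> (\<integral>w. area f (s w) w + g (X (s w) w) \<partial>P x)"
    by (rule approx_value_attained)
  then show ?thesis using n that by (meson less_imp_le order_trans)
qed

lemma expected_near_optimal_time:
  assumes s: "bstop D s" and opt: "value_real x - 1 \<le> (\<integral>w. area f (s w) w + g (X (s w) w) \<partial>P x)"
  shows "(\<integral>w. s w \<partial>P x) \<le> (\<gamma> x + 2 * supnorm g + 1) / (- d x)"
proof -
  have "- supnorm g \<le> value_real x" using abs_g_le_supnorm[of x] value_real_ge_g[of x] by linarith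
  then have "(\<integral>w. s w \<partial>P x) * (- d x) \<le> \<gamma> x + 2 * supnorm g + 1"
    using payoff_bstop_bound[OF s, of x] opt by (simp add: mult.commute)
  then show ?thesis using d_neg[of x] by (subst pos_le_divide_eq) auto
qed

text \<open>Markov's inequality for the nonnegative variable \<open>approx_value k - g\<close> at
  time \<open>s\<close>. Its mean is at most \<eta>: the reward with terminal
  \<open>approx_value k\<close> is at most the value, and the one with terminal \<open>g\<close>
  falls short by at most \<eta>. The events increase with \<open>k\<close> to the complement of
  \<open>level e\<close>.\<close>

lemma measure_not_in_level:
  assumes s: "bstop D s" and opt: "value_real x - \<eta> \<le> (\<integral>w. area f (s w) w + g (X (s w) w) \<partial>P x)"
    and e: "0 < e"
  shows "measure (P x) {w \<in> space M. X (s w) w \<notin> level e} \<le> \<eta> / e"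
proof -
  interpret prob_space "P x" by (rule prob_space_P)
  note sm = bstop_measurable[OF s] and s0 = bstop_nonneg[OF s]
  have [measurable]: "(\<lambda>w. approx_value k (X (s w) w)) \<in> borel_measurable M" "(\<lambda>w. g (X (s w) w)) \<in> borel_measurable M" for k
    by (rule bcontinuous_X[OF bcontinuous_approx_value sm s0] bcontinuous_X[OF g sm s0]; assumption)+
  define A where "A k = {w \<in> space M. g (X (s w) w) + e < approx_value k (X (s w) w)}" for k
  have A_meas: "A k \<in> sets M" for k unfolding A_def by measurable
  have A_le: "measure (P x) (A k) \<le> \<eta> / e" for k
  proof -
    have i1: "integrable (P x) (\<lambda>w. area f (s w) w + approx_value k (X (s w) w))"
      by (rule integrable_payoff[OF s bcontinuous_approx_value])
    have i2: "integrable (P x) (\<lambda>w. area f (s w) w + g (X (s w) w))"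
      by (rule integrable_payoff[OF s g])
    have "e * measure (P x) (A k) = (\<integral>w. indicator (A k) w * e \<partial>P x)"
      using A_meas[of k] by (simp add: mult.commute)
    also have "\<dots> \<le> (\<integral>w. (area f (s w) w + approx_value k (X (s w) w)) - (area f (s w) w + g (X (s w) w)) \<partial>P x)"
    proof (rule integral_mono)
      show "integrable (P x) (\<lambda>w. indicator (A k) w * e)"
        using e A_meas[of k] by (intro integrable_bounded[where c = e]) (auto simp: indicator_def)
      show "indicator (A k) w * e \<le> (area f (s w) w + approx_value k (X (s w) w)) - (area f (s w) w + g (X (s w) w))" for w
        using approx_value_ge_g[of "X (s w) w" k] by (auto simp: indicator_def A_def)
    qed (intro Bochner_Integration.integrable_diff i1 i2)
    also have "\<dots> = (\<integral>w. area f (s w) w + approx_value k (X (s w) w) \<partial>P x) - (\<integral>w. area f (s w) w + g (X (s w) w) \<partial>P x)"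
      by (rule Bochner_Integration.integral_diff[OF i1 i2])
    also have "\<dots> \<le> \<eta>" using payoff_le[OF s approx_value_le, of x k] opt by simp
    finally show ?thesis using e by (simp add: pos_le_divide_eq mult.commute)
  qed
  have "incseq A"
    unfolding incseq_def A_def using approx_value_mono by (auto intro: less_le_trans)
  then have "(\<lambda>k. measure (P x) (A k)) \<longlonglongrightarrow> measure (P x) (\<Union>k. A k)"
    using A_meas by (intro finite_Lim_measure_incseq) auto
  then have "measure (P x) (\<Union>k. A k) \<le> \<eta> / e"
    using A_le by (intro LIMSEQ_le_const2) auto
  also have "(\<Union>k. A k) = {w \<in> space M. X (s w) w \<notin> level e}"
    by (auto simp: A_def level_def value_real_le_iff not_le)
  finally show ?thesis .
qed

lemma hit_level_bounds:
  assumes e: "0 < e"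
  shows "(\<integral>\<^sup>+w. hit (level e) w \<partial>P x) \<le> ennreal ((\<gamma> x + 2 * supnorm g + 1) / (- d x))"
    and "value_real x - e \<le>
      (\<integral>w. area f (enn2real (hit (level e) w)) w + g (X (enn2real (hit (level e) w)) w) \<partial>P x)"
proof -
  interpret prob_space "P x" by (rule prob_space_P)
  let ?\<tau> = "hit (level e)" and ?C = "(\<gamma> x + 2 * supnorm g + 1) / (- d x)"
  have \<tau>: "stopping M P X ?\<tau>" by (rule stopping_hit_closed[OF closed_level])
  have [measurable]: "?\<tau> \<in> borel_measurable M" by (rule stopping_measurable[OF \<tau>])
  \<comment> \<open>Losses \<open>(1/2) ^ n\<close> are summable, as Borel--Cantelli requires, and
    at most 1, as \<open>expected_near_optimal_time\<close> requires.\<close>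
  have "\<forall>n. \<exists>s. \<exists>D. bstop D s \<and> value_real x - (1/2) ^ n \<le> (\<integral>w. area f (s w) w + g (X (s w) w) \<partial>P x)"
  proof
    fix n
    obtain D s where "bstop D s" "value_real x - (1/2) ^ n \<le> (\<integral>w. area f (s w) w + g (X (s w) w) \<partial>P x)"
      by (rule near_optimal[of "(1/2) ^ n" x]) simp
    then show "\<exists>s. \<exists>D. bstop D s \<and> value_real x - (1/2) ^ n \<le> (\<integral>w. area f (s w) w + g (X (s w) w) \<partial>P x)" by blast
  qed
  from choice[OF this] obtain \<sigma> where
    "\<forall>n. \<exists>D. bstop D (\<sigma> n) \<and> value_real x - (1/2) ^ n \<le> (\<integral>w. area f (\<sigma> n w) w + g (X (\<sigma> n w) w) \<partial>P x)" ..
  from choice[OF this] obtain D where \<sigma>: "\<And>n. bstop (D n) (\<sigma> n)"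
    and opt: "\<And>n. value_real x - (1/2) ^ n \<le> (\<integral>w. area f (\<sigma> n w) w + g (X (\<sigma> n w) w) \<partial>P x)" by blast
  note [measurable] = bstop_measurable[OF \<sigma>]
  have ae: "AE w in P x. eventually (\<lambda>n. ?\<tau> w \<le> ennreal (\<sigma> n w)) sequentially"
  proof -
    have "AE w in P x. eventually (\<lambda>n. w \<in> space (P x) - {w \<in> space M. X (\<sigma> n w) w \<notin> level e}) sequentially"
    proof (rule borel_cantelli_AE1)
      show "{w \<in> space M. X (\<sigma> n w) w \<notin> level e} \<in> sets (P x)" for n
      proof -
        have "{w \<in> space M. X (\<sigma> n w) w \<in> - level e} \<in> past (\<sigma> n)"
          using closed_level[of e] by (intro past_X[OF \<sigma>]) auto
        then show ?thesis using past_sets by simp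
      qed
      show "emeasure (P x) {w \<in> space M. X (\<sigma> n w) w \<notin> level e} < \<infinity>" for n
        by (simp add: emeasure_eq_measure)
      show "summable (\<lambda>n. measure (P x) {w \<in> space M. X (\<sigma> n w) w \<notin> level e})"
      proof (rule summable_comparison_test')
        show "summable (\<lambda>n. (1/2::real) ^ n / e)" by (intro summable_divide summable_geometric) simp
        show "norm (measure (P x) {w \<in> space M. X (\<sigma> n w) w \<notin> level e}) \<le> (1/2) ^ n / e" if "0 \<le> n" for n
          using measure_not_in_level[OF \<sigma> opt e] by simp
      qed
    qed
    then show ?thesis
    proof eventually_elim
      case (elim w)
      show ?case using elim
        by eventually_elim (auto intro!: hit_le bstop_nonneg[OF \<sigma>])
    qed
  qed
  have "(\<integral>\<^sup>+w. ?\<tau> w \<partial>P x) \<le> (\<integral>\<^sup>+w. liminf (\<lambda>n. ennreal (\<sigma> n w)) \<partial>P x)"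
    using ae by (intro nn_integral_mono_AE) (auto elim!: eventually_mono intro: Liminf_bounded)
  also have "\<dots> \<le> liminf (\<lambda>n. \<integral>\<^sup>+w. ennreal (\<sigma> n w) \<partial>P x)"
    by (rule nn_integral_liminf) simp
  also have "\<dots> \<le> limsup (\<lambda>n. \<integral>\<^sup>+w. ennreal (\<sigma> n w) \<partial>P x)" by (rule Liminf_le_Limsup) simp
  also have "\<dots> \<le> ennreal ?C"
  proof (rule Limsup_bounded, rule always_eventually, rule allI)
    fix n
    have "(\<integral>\<^sup>+w. ennreal (\<sigma> n w) \<partial>P x) = ennreal (\<integral>w. \<sigma> n w \<partial>P x)"
      using bstop_nonneg[OF \<sigma>] by (intro nn_integral_eq_integral integrable_bstop[OF \<sigma>] AE_I2) simp
    also have "\<dots> \<le> ennreal ?C"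
    proof (intro ennreal_leI expected_near_optimal_time[OF \<sigma>])
      have "(1/2::real) ^ n \<le> 1" by (intro power_le_one) auto
      then show "value_real x - 1 \<le> (\<integral>w. area f (\<sigma> n w) w + g (X (\<sigma> n w) w) \<partial>P x)"
        using opt[of n] by linarith
    qed
    finally show "(\<integral>\<^sup>+w. ennreal (\<sigma> n w) \<partial>P x) \<le> ennreal ?C" .
  qed
  finally show fin: "(\<integral>\<^sup>+w. ?\<tau> w \<partial>P x) \<le> ennreal ?C" .

  define \<rho> where "\<rho> n w = enn2real (min (?\<tau> w) (ennreal (\<sigma> n w)))" for n w
  have \<rho>: "bstop (D n) (\<rho> n)" for n
    unfolding \<rho>_def by (rule bstop_min_stopping[OF \<sigma> \<tau>])
  have \<rho>\<sigma>: "\<rho> n w \<le> \<sigma> n w" if "w \<in> space M" for n w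
    unfolding \<rho>_def using bstop_nonneg[OF \<sigma> that] by (intro enn2real_leI) auto
  have main: "value_real x - (1/2) ^ n - e \<le> (\<integral>w. area f (\<rho> n w) w + g (X (\<rho> n w) w) \<partial>P x)" for n
  proof -
    \<comment> \<open>On \<open>B\<close> the entry time is strictly before
      \<open>\<sigma> n\<close> and equals \<open>\<rho> n\<close>; off \<open>B\<close> the times
      \<open>\<rho> n\<close> and \<open>\<sigma> n\<close> coincide and nothing is lost.\<close>
    define B where "B = {w \<in> space M. \<rho> n w < \<sigma> n w}"
    have B: "B \<in> past (\<rho> n)" unfolding B_def by (rule past_less[OF \<rho> \<sigma>])
    have BM [measurable]: "B \<in> sets M" by (rule past_sets[OF B])
    have B_level: "X (\<rho> n w) w \<in> level e" if "w \<in> B" for w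
    proof -
      have w: "w \<in> space M" "\<rho> n w < \<sigma> n w" using that by (auto simp: B_def)
      have "\<not> ennreal (\<sigma> n w) \<le> ?\<tau> w"
      proof
        assume "ennreal (\<sigma> n w) \<le> ?\<tau> w"
        then have "\<rho> n w = \<sigma> n w" using bstop_nonneg[OF \<sigma> w(1)] by (simp add: \<rho>_def min_absorb2)
        then show False using w(2) by simp
      qed
      then have "?\<tau> w < ennreal (\<sigma> n w)" by simp
      then have "?\<tau> w < top" "\<rho> n w = enn2real (?\<tau> w)"
        by (auto simp: \<rho>_def min_def intro: less_trans[OF _ ennreal_less_top])
      then show ?thesis using X_hit_in_closure[OF w(1), of "level e"] closed_level[of e] by simp
    qed
    have ig: "integrable (P x) (\<lambda>w. indicator B w * g (X (\<rho> n w) w))"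
      by (rule integrable_at[OF g \<rho> BM])
    have ie: "integrable (P x) (\<lambda>w. indicator B w * e)"
      using e by (intro integrable_bounded[where c = e]) (auto simp: indicator_def)
    have ige: "(\<lambda>w. indicator B w * (g (X (\<rho> n w) w) + e)) = (\<lambda>w. indicator B w * g (X (\<rho> n w) w) + indicator B w * e)"
      by (simp add: distrib_left)
    \<comment> \<open>Continuing on \<open>B\<close> from \<open>\<rho> n\<close> to
      \<open>\<sigma> n\<close> is worth at most the value at \<open>\<rho> n\<close>, which exceeds
      \<open>g\<close> there by at most \<open>e\<close>. The right-hand integral plays the part of
      the constant \<open>c\<close>.\<close>
    have stay: "(\<integral>w. indicator B w * (area f (\<sigma> n w) w - area f (\<rho> n w) w + g (X (\<sigma> n w) w)) \<partial>P x)
       \<le> (\<integral>w. indicator B w * (g (X (\<rho> n w) w) + e) \<partial>P x)"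
    proof (rule approx_value_supermartingale[OF \<rho> \<sigma> \<rho>\<sigma> B, where n = 0, unfolded approx_value.simps(1)])
      show "(\<integral>w. indicator B w * approx_value m (X (\<rho> n w) w) \<partial>P x) \<le> (\<integral>w. indicator B w * (g (X (\<rho> n w) w) + e) \<partial>P x)" for m
      proof (rule integral_mono)
        show "integrable (P x) (\<lambda>w. indicator B w * approx_value m (X (\<rho> n w) w))"
          by (rule integrable_at[OF bcontinuous_approx_value \<rho> BM])
        show "integrable (P x) (\<lambda>w. indicator B w * (g (X (\<rho> n w) w) + e))"
          unfolding ige by (rule Bochner_Integration.integrable_add[OF ig ie])
        show "indicator B w * approx_value m (X (\<rho> n w) w) \<le> indicator B w * (g (X (\<rho> n w) w) + e)" for w
          using B_level[of w] by (auto simp: indicator_def level_def value_real_le_iff)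
      qed
    qed
    have i\<sigma>: "integrable (P x) (\<lambda>w. indicator B w * (area f (\<sigma> n w) w - area f (\<rho> n w) w + g (X (\<sigma> n w) w)))"
      by (rule integrable_gain[OF f g \<rho> \<sigma> \<rho>\<sigma> BM])
    have i\<rho>: "integrable (P x) (\<lambda>w. area f (\<rho> n w) w + g (X (\<rho> n w) w))"
      by (rule integrable_payoff[OF \<rho> g])
    have "value_real x - (1/2) ^ n \<le> (\<integral>w. area f (\<sigma> n w) w + g (X (\<sigma> n w) w) \<partial>P x)" by (rule opt)
    \<comment> \<open>On \<open>B\<close> the terminal reward at \<open>\<rho> n\<close> is
      exchanged for what is still earned until \<open>\<sigma> n\<close>.\<close>
    also have "\<dots> = (\<integral>w. indicator B w * (area f (\<sigma> n w) w - area f (\<rho> n w) w + g (X (\<sigma> n w) w))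
      + ((area f (\<rho> n w) w + g (X (\<rho> n w) w)) - indicator B w * g (X (\<rho> n w) w)) \<partial>P x)"
    proof (intro Bochner_Integration.integral_cong refl)
      fix w assume "w \<in> space (P x)"
      then have "w \<in> B \<or> \<rho> n w = \<sigma> n w" using \<rho>\<sigma>[of w n] by (auto simp: B_def)
      then show "area f (\<sigma> n w) w + g (X (\<sigma> n w) w) =
        indicator B w * (area f (\<sigma> n w) w - area f (\<rho> n w) w + g (X (\<sigma> n w) w))
        + ((area f (\<rho> n w) w + g (X (\<rho> n w) w)) - indicator B w * g (X (\<rho> n w) w))"
        by (auto simp: indicator_def)
    qed
    also have "\<dots> = (\<integral>w. indicator B w * (area f (\<sigma> n w) w - area f (\<rho> n w) w + g (X (\<sigma> n w) w)) \<partial>P x)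
      + ((\<integral>w. area f (\<rho> n w) w + g (X (\<rho> n w) w) \<partial>P x) - (\<integral>w. indicator B w * g (X (\<rho> n w) w) \<partial>P x))"
      by (simp only: Bochner_Integration.integral_add Bochner_Integration.integral_diff
          Bochner_Integration.integrable_diff i\<sigma> i\<rho> ig)
    also have "\<dots> \<le> (\<integral>w. indicator B w * (g (X (\<rho> n w) w) + e) \<partial>P x)
      + ((\<integral>w. area f (\<rho> n w) w + g (X (\<rho> n w) w) \<partial>P x) - (\<integral>w. indicator B w * g (X (\<rho> n w) w) \<partial>P x))"
      by (intro add_right_mono stay)
    also have "\<dots> = (\<integral>w. area f (\<rho> n w) w + g (X (\<rho> n w) w) \<partial>P x) + (\<integral>w. indicator B w * e \<partial>P x)"
      unfolding ige using Bochner_Integration.integral_add[OF ig ie] by simp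
    also have "(\<integral>w. indicator B w * e \<partial>P x) \<le> e"
      using integral_bounded[of "\<lambda>w. indicator B w * e" e x] e by (auto simp: indicator_def)
    finally show ?thesis by simp
  qed
  have \<tau>_fin: "AE w in P x. ?\<tau> w \<noteq> top"
    using nn_integral_PInf_AE[of ?\<tau> "P x"] le_less_trans[OF fin ennreal_less_top]
    by (auto simp: less_top)
  have "(\<integral>\<^sup>+w. ennreal (enn2real (?\<tau> w)) \<partial>P x) = (\<integral>\<^sup>+w. ?\<tau> w \<partial>P x)"
    using \<tau>_fin by (intro nn_integral_cong_AE) (auto simp: less_top)
  then have t_int: "integrable (P x) (\<lambda>w. enn2real (?\<tau> w))"
    using fin by (intro integrableI_nonneg) (auto intro: le_less_trans)
  \<comment> \<open>Eventual equality of the times carries over to the positions, which therefore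
    converge although \<open>\<rho> n\<close> approaches from the left.\<close>
  have \<rho>_eq: "AE w in P x. eventually (\<lambda>n. \<rho> n w = enn2real (?\<tau> w)) sequentially"
    using ae by eventually_elim (auto elim!: eventually_mono simp: \<rho>_def min_absorb1)
  have "(\<lambda>n. \<integral>w. area f (\<rho> n w) w + g (X (\<rho> n w) w) \<partial>P x) \<longlonglongrightarrow>
      (\<integral>w. area f (enn2real (?\<tau> w)) w + g (X (enn2real (?\<tau> w)) w) \<partial>P x)"
  proof (rule gain_tendsto[OF t_int])
    show "\<rho> n \<in> borel_measurable M" for n by (rule bstop_measurable[OF \<rho>])
    show "AE w in P x. \<forall>n. \<rho> n w \<le> enn2real (?\<tau> w)"
      using \<tau>_fin by eventually_elim (auto simp: \<rho>_def less_top intro!: enn2real_mono)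
    show "AE w in P x. (\<lambda>n. \<rho> n w) \<longlonglongrightarrow> enn2real (?\<tau> w)"
      using \<rho>_eq by eventually_elim (rule tendsto_eventually)
    show "AE w in P x. (\<lambda>n. X (\<rho> n w) w) \<longlonglongrightarrow> X (enn2real (?\<tau> w)) w"
      using \<rho>_eq by eventually_elim (auto intro!: tendsto_eventually elim!: eventually_mono)
  qed (simp_all add: \<rho>_def)
  moreover have "(\<lambda>n. value_real x - (1/2) ^ n - e) \<longlonglongrightarrow> value_real x - 0 - e"
    by (intro tendsto_diff tendsto_const LIMSEQ_power_zero) simp
  ultimately show "value_real x - e \<le>
      (\<integral>w. area f (enn2real (?\<tau> w)) w + g (X (enn2real (?\<tau> w)) w) \<partial>P x)"
    using main by (intro LIMSEQ_le[of _ "value_real x - e"]) auto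
qed

text \<open>The bound on the mean entry time of \<open>level e\<close> does not depend on
  \<open>e\<close>, so monotone convergence preserves it. It has to come first, because it supplies
  the integrable majorant under which the payoffs converge.\<close>

lemma optimal_hit_level:
  shows "stopping M P X (hit (level 0))"
    and "(\<integral>\<^sup>+w. hit (level 0) w \<partial>P x) \<le> ennreal ((\<gamma> x + 2 * supnorm g + 1) / (- d x))"
    and "lim_payoff P X f g x (hit (level 0)) = value_fn M P X f g x"
proof -
  interpret prob_space "P x" by (rule prob_space_P)
  let ?\<tau> = "hit (level 0)" and ?C = "(\<gamma> x + 2 * supnorm g + 1) / (- d x)"
  show \<tau>: "stopping M P X ?\<tau>" by (rule stopping_hit_closed[OF closed_level])
  have [measurable]: "hit (level e) \<in> borel_measurable M" for e
    by (rule stopping_measurable[OF stopping_hit_closed[OF closed_level]])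
  define L where "L k = level (inverse (real (Suc k)))" for k
  have [measurable]: "hit (L k) \<in> borel_measurable M" for k unfolding L_def by measurable
  have L_anti: "antimono L"
  proof (rule antimonoI, rule subsetI)
    fix m n y assume "m \<le> n" "y \<in> L n"
    moreover have "inverse (real (Suc n)) \<le> inverse (real (Suc m))"
      using \<open>m \<le> n\<close> by (intro le_imp_inverse_le) auto
    ultimately show "y \<in> L m" unfolding L_def level_def mem_Collect_eq by linarith
  qed
  \<comment> \<open>Quasi-left-continuity enters here: the entry times increase to their limit, and
    the positions nevertheless converge.\<close>
  have "AE w in P x. ?\<tau> w = (SUP k. hit (L k) w) \<and>
    (?\<tau> w < top \<longrightarrow> (\<lambda>k. X (enn2real (hit (L k) w)) w) \<longlonglongrightarrow> X (enn2real (?\<tau> w)) w)"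
  proof (rule hit_decreasing_limit[OF L_anti])
    show "stopping M P X (hit (L k))" for k
      unfolding L_def by (rule stopping_hit_closed[OF closed_level])
    show "(\<Inter>k. closure (L k)) \<subseteq> level 0"
    proof
      fix y assume "y \<in> (\<Inter>k. closure (L k))"
      then have "value_real y \<le> g y + inverse (real (Suc k))" for k
        using closed_level by (auto simp: L_def level_def)
      then have "value_real y \<le> g y + 0"
        using tendsto_add[OF tendsto_const LIMSEQ_inverse_real_of_nat, of "g y"]
        by (intro LIMSEQ_le_const) auto
      then show "y \<in> level 0" by (simp add: level_def)
    qed
    show "level 0 \<subseteq> L k" for k by (auto simp: L_def level_def intro: order_trans)
  qed
  then have ae1: "AE w in P x. ?\<tau> w = (SUP k. hit (L k) w)"
    and ae2: "AE w in P x. ?\<tau> w < top \<longrightarrow> (\<lambda>k. X (enn2real (hit (L k) w)) w) \<longlonglongrightarrow> X (enn2real (?\<tau> w)) w"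
    by auto
  have inc: "incseq (\<lambda>k. hit (L k) w)" for w
    using L_anti by (auto simp: incseq_def antimono_def intro!: hit_antimono)
  have "(\<integral>\<^sup>+w. ?\<tau> w \<partial>P x) = (\<integral>\<^sup>+w. (SUP k. hit (L k) w) \<partial>P x)"
    using ae1 by (rule nn_integral_cong_AE)
  also have "\<dots> = (SUP k. \<integral>\<^sup>+w. hit (L k) w \<partial>P x)"
    using inc by (intro nn_integral_monotone_convergence_SUP) (auto simp: incseq_def le_fun_def)
  also have "\<dots> \<le> ennreal ?C"
    unfolding L_def by (intro SUP_least hit_level_bounds(1)) simp
  finally show fin: "(\<integral>\<^sup>+w. ?\<tau> w \<partial>P x) \<le> ennreal ?C" .
  have \<tau>_fin: "AE w in P x. ?\<tau> w \<noteq> top"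
    using nn_integral_PInf_AE[of ?\<tau> "P x"] le_less_trans[OF fin ennreal_less_top]
    by (auto simp: less_top)
  have "(\<integral>\<^sup>+w. ennreal (enn2real (?\<tau> w)) \<partial>P x) = (\<integral>\<^sup>+w. ?\<tau> w \<partial>P x)"
    using \<tau>_fin by (intro nn_integral_cong_AE) (auto simp: less_top)
  then have t_int: "integrable (P x) (\<lambda>w. enn2real (?\<tau> w))"
    using fin by (intro integrableI_nonneg) (auto intro: le_less_trans)
  let ?G = "\<integral>w. area f (enn2real (?\<tau> w)) w + g (X (enn2real (?\<tau> w)) w) \<partial>P x"
  have "(\<lambda>k. \<integral>w. area f (enn2real (hit (L k) w)) w + g (X (enn2real (hit (L k) w)) w) \<partial>P x) \<longlonglongrightarrow> ?G"
  proof (rule gain_tendsto[OF t_int])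
    show "(\<lambda>w. enn2real (hit (L k) w)) \<in> borel_measurable M" for k by measurable
    show "AE w in P x. \<forall>k. enn2real (hit (L k) w) \<le> enn2real (?\<tau> w)"
      using \<tau>_fin ae1
    proof eventually_elim
      case (elim w)
      show ?case
      proof (intro allI enn2real_mono)
        show "hit (L k) w \<le> ?\<tau> w" for k unfolding elim(2) by (rule SUP_upper) simp
        show "?\<tau> w < top" using elim(1) less_top by blast
      qed
    qed
    show "AE w in P x. (\<lambda>k. enn2real (hit (L k) w)) \<longlonglongrightarrow> enn2real (?\<tau> w)"
      using \<tau>_fin ae1
    proof eventually_elim
      case (elim w)
      have "(\<lambda>k. hit (L k) w) \<longlonglongrightarrow> ?\<tau> w" unfolding elim(2) by (rule LIMSEQ_SUP[OF inc])
      then show ?case using elim(1) by (intro tendsto_enn2real) (auto simp: less_top)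
    qed
    show "AE w in P x. (\<lambda>k. X (enn2real (hit (L k) w)) w) \<longlonglongrightarrow> X (enn2real (?\<tau> w)) w"
      using \<tau>_fin ae2 by eventually_elim (auto simp: less_top)
  qed simp_all
  moreover have "(\<lambda>k. value_real x - inverse (real (Suc k))) \<longlonglongrightarrow> value_real x - 0"
    by (intro tendsto_diff tendsto_const LIMSEQ_inverse_real_of_nat)
  moreover have "value_real x - inverse (real (Suc k)) \<le>
      (\<integral>w. area f (enn2real (hit (L k) w)) w + g (X (enn2real (hit (L k) w)) w) \<partial>P x)" for k
    unfolding L_def by (rule hit_level_bounds(2)) simp
  ultimately have ge: "value_real x \<le> ?G"
    by (intro LIMSEQ_le[of _ "value_real x"]) auto
  \<comment> \<open>The entry time is almost surely finite, so on almost every path the truncation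
    at \<open>T\<close> is eventually inactive and the upper limit in \<open>lim_payoff\<close> is a
    genuine limit.\<close>
  have "((\<lambda>T. payoff P X f g x ?\<tau> T) \<longlongrightarrow> ?G) at_top"
    unfolding payoff_eq
  proof (rule tendsto_at_topI_sequentially)
    fix T :: "nat \<Rightarrow> real" assume T: "filterlim T at_top sequentially"
    have ev: "eventually (\<lambda>n. enn2real (min (?\<tau> w) (ennreal (T n))) = enn2real (?\<tau> w)) sequentially" if "?\<tau> w \<noteq> top" for w
    proof -
      have "eventually (\<lambda>n. enn2real (?\<tau> w) \<le> T n) sequentially"
        using T unfolding filterlim_at_top by blast
      then show ?thesis
      proof eventually_elim
        case (elim n)
        then have "ennreal (enn2real (?\<tau> w)) \<le> ennreal (T n)" by (rule ennreal_leI)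
        then show ?case using that by (simp add: min_absorb1 less_top)
      qed
    qed
    show "(\<lambda>n. \<integral>w. area f (enn2real (min (?\<tau> w) (ennreal (T n)))) w
      + g (X (enn2real (min (?\<tau> w) (ennreal (T n)))) w) \<partial>P x) \<longlonglongrightarrow> ?G"
    proof (rule gain_tendsto[OF t_int])
      show "(\<lambda>w. enn2real (min (?\<tau> w) (ennreal (T n)))) \<in> borel_measurable M" for n by measurable
      show "AE w in P x. \<forall>n. enn2real (min (?\<tau> w) (ennreal (T n))) \<le> enn2real (?\<tau> w)"
        using \<tau>_fin by eventually_elim (auto simp: less_top intro!: enn2real_mono)
      show "AE w in P x. (\<lambda>n. enn2real (min (?\<tau> w) (ennreal (T n)))) \<longlonglongrightarrow> enn2real (?\<tau> w)"
        using \<tau>_fin by eventually_elim (intro tendsto_eventually ev)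
      show "AE w in P x. (\<lambda>n. X (enn2real (min (?\<tau> w) (ennreal (T n)))) w) \<longlonglongrightarrow> X (enn2real (?\<tau> w)) w"
        using \<tau>_fin
      proof eventually_elim
        case (elim w)
        from ev[OF elim] have "eventually (\<lambda>n. X (enn2real (min (?\<tau> w) (ennreal (T n)))) w = X (enn2real (?\<tau> w)) w) sequentially"
          by eventually_elim simp
        then show ?case by (rule tendsto_eventually)
      qed
    qed simp_all
  qed
  then have "lim_payoff P X f g x ?\<tau> = ereal ?G"
    unfolding lim_payoff_def by (intro lim_imp_Limsup) simp_all
  moreover have "lim_payoff P X f g x ?\<tau> \<le> value_fn M P X f g x"
    unfolding value_fn_def using \<tau> by (intro SUP_upper) simp
  ultimately show "lim_payoff P X f g x ?\<tau> = value_fn M P X f g x"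
    using ge by (intro antisym) (simp_all add: value_fn_eq)
qed

end

theorem theorem2p12:
  fixes M :: "'w measure"
    and P :: "'a::{heine_borel, second_countable_topology} \<Rightarrow> 'w measure"
    and X :: "real \<Rightarrow> 'w \<Rightarrow> 'a"
    and f g :: "'a \<Rightarrow> real"
    and d :: "'a \<Rightarrow> real"
  assumes "standard_markov M P X"
    and "weak_feller P X"
    and "ergodic P X"
    and "continuous_on UNIV f" and "bounded (range f)"
    and "continuous_on UNIV g" and "bounded (range g)"
    and B1: "\<forall>x. d x < 0 \<and> gamma_fn M P X f (d x) x < \<infinity>"
  shows "\<forall>x. stopping M P X (tau_star M P X f g)
           \<and> lim_payoff P X f g x (tau_star M P X f g) = value_fn M P X f g x
           \<and> (\<integral>\<^sup>+ w. tau_star M P X f g w \<partial>P x)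
               \<le> ennreal ((real_of_ereal (gamma_fn M P X f (d x) x) + 2 * supnorm g + 1) / (- d x))"
proof
  fix x
  interpret finite_stopping_problem M P X f g d
    using assms by unfold_locales (auto simp: bcontinuous_def)
  show "stopping M P X (tau_star M P X f g)
           \<and> lim_payoff P X f g x (tau_star M P X f g) = value_fn M P X f g x
           \<and> (\<integral>\<^sup>+ w. tau_star M P X f g w \<partial>P x)
               \<le> ennreal ((real_of_ereal (gamma_fn M P X f (d x) x) + 2 * supnorm g + 1) / (- d x))"
    unfolding tau_star_eq_hit by (intro conjI optimal_hit_level(1,3) optimal_hit_level(2)[unfolded \<gamma>_def])
qed

end
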